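(* Let $0<p<\infty$. Let $\vec s=(s_1,\dots,s_m)$, $\vec r=(r_1,\dots,r_m)$, $\vec q=(q_1,\dots,q_m)$ (radial indices) and $\vec{\tilde s}=(\tilde s_1,\dots,\tilde s_m)$, $\vec{\tilde r}=(\tilde r_1,\dots,\tilde r_m)$, $\vec{\tilde q}=(\tilde q_1,\dots,\tilde q_m)$ (angular indices) satisfy $1<\vec s<\vec r<\infty$, $1<\vec{\tilde s}<\vec{\tilde r}<\infty$, $1<\vec q,\vec{\tilde q}<\infty$, and $$\frac1{s_i}=\frac1{r_i}+\frac1{q_i},\qquad \frac1{\tilde s_i}=\frac1{\tilde r_i}+\frac1{\tilde q_i},\qquad i=1,\dots,m.$$ Let $\sum_{i=1}^m\frac{N_{k^{(i)}}}{r_i}>\frac{N_k}{p}$ and let $\varphi$ be a non-negative integrable function on $(0,1]$. Then the commutator $\mathcal{H}_\varphi^b$ is bounded from $\dot M^p_{\vec r,\vec{\tilde r},k}(\mathbb{R}^n)$ to $\dot M^p_{\vec s,\vec{\tilde s},k}(\mathbb{R}^n)$ for all $b\in\mathrm{CMO}_{\vec q,\vec{\tilde q},k}(\mathbb{R}^n)$ if and only if $$\int_0^1 t^{-\frac{N_k}{p}}\varphi(t)\log\frac2t\,\mathrm{d}t<\infty.$$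
   Context: Setting. Let $n\ge 2$, $\mathbb{R}^n=\mathbb{R}^{n_1}\times\cdots\times\mathbb{R}^{n_m}$ with $\sum_{i=1}^m n_i=n$, $n_i\ge1$. Let $k=(k_1,\dots,k_n)$ with all $k_j\ge 0$, split into blocks $k=(k^{(1)},\dots,k^{(m)})$ with $k^{(i)}=(k^{(i)}_1,\dots,k^{(i)}_{n_i})$. Put $N_{k^{(i)}}=n_i+2\sum_{v=1}^{n_i}k^{(i)}_v$ and $N_k=n+2\sum_{j=1}^n k_j=\sum_{i=1}^m N_{k^{(i)}}$. The Dunkl measure is $\mathrm{d}\mu_k(x)=\prod_{j=1}^n|x_j|^{2k_j}\,\mathrm{d}x$; write $|E|_k=\mu_k(E)$. $B(0,R)$ is the open Euclidean ball in $\mathbb{R}^n$ of center $0$ and radius $R$. On each unit sphere $\mathbb{S}^{n_i-1}\subset\mathbb{R}^{n_i}$ let $\mathrm{d}\sigma_{k^{(i)}}(\omega)=\prod_{v=1}^{n_i}|\omega_v|^{2k^{(i)}_v}\,\mathrm{d}\sigma(\omega)$, $\mathrm{d}\sigma$ the surface measure (counting measure on $\{\pm1\}$ if $n_i=1$). Vector inequalities are understood componentwise. Mixed-norm radial-angular Dunkl--Lebesgue space. For vectors $1<\vec u,\vec w<\infty$ in $\mathbb{R}^m$ and measurable $f:\mathbb{R}^n\to\mathbb{C}$, writing $x_i=\rho_i\omega_i\in\mathbb{R}^{n_i}$ in polar coordinates, $\|f\|_{L^{\vec u}_{\mathrm{rad},k}L^{\vec w}_{\mathrm{ang},k}(\mathbb{R}^n)}$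 is obtained by taking successively, for $i=1,2,\dots,m$ (block $1$ innermost), first the $L^{w_i}(\mathbb{S}^{n_i-1},\mathrm{d}\sigma_{k^{(i)}})$ norm in $\omega_i$ and then the $L^{u_i}((0,\infty),\rho_i^{N_{k^{(i)}}-1}\mathrm{d}\rho_i)$ norm in $\rho_i$; i.e. $$\|f\|=\Biggl(\int_0^\infty\Biggl(\int_{\mathbb{S}^{n_m-1}}\cdots\Biggl(\int_0^\infty\Biggl(\int_{\mathbb{S}^{n_1-1}}|f(\rho_1\omega_1,\dots,\rho_m\omega_m)|^{w_1}\mathrm{d}\sigma_{k^{(1)}}(\omega_1)\Biggr)^{\frac{u_1}{w_1}}\rho_1^{N_{k^{(1)}}-1}\mathrm{d}\rho_1\Biggr)^{\frac{w_2}{u_1}}\cdots\mathrm{d}\sigma_{k^{(m)}}(\omega_m)\Biggr)^{\frac{u_m}{w_m}}\rho_m^{N_{k^{(m)}}-1}\mathrm{d}\rho_m\Biggr)^{\frac1{u_m}}.$$ Mixed-norm radial-angular Dunkl central Morrey space. For $0<p<\infty$ with $\sum_{i=1}^m\frac{N_{k^{(i)}}}{u_i}\ge\frac{N_k}{p}$, $\dot M^p_{\vec u,\vec w,k}(\mathbb{R}^n)$ is the set of measurable $f$ with $$\|f\|_{\dot M^p_{\vec u,\vec w,k}(\mathbb{R}^n)}=\sup_{R>0}|B(0,R)|_k^{\frac1p-\frac1{N_k}\sum_{i=1}^m\frac{N_{k^{(i)}}}{u_i}}\,\|f\chi_{B(0,R)}\|_{L^{\vec u}_{\mathrm{rad},k}L^{\vec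 w}_{\mathrm{ang},k}(\mathbb{R}^n)}<\infty.$$ Mixed-norm radial-angular Dunkl central bounded mean oscillation space. With $b_{B(0,R),k}=\frac1{|B(0,R)|_k}\int_{B(0,R)}b\,\mathrm{d}\mu_k$, $\mathrm{CMO}_{\vec u,\vec w,k}(\mathbb{R}^n)$ is the set of locally ($\mu_k$-)integrable $b$ with $$\|b\|_{\mathrm{CMO}_{\vec u,\vec w,k}(\mathbb{R}^n)}=\sup_{R>0}\frac{\|(b-b_{B(0,R),k})\chi_{B(0,R)}\|_{L^{\vec u}_{\mathrm{rad},k}L^{\vec w}_{\mathrm{ang},k}(\mathbb{R}^n)}}{\|\chi_{B(0,R)}\|_{L^{\vec u}_{\mathrm{rad},k}L^{\vec w}_{\mathrm{ang},k}(\mathbb{R}^n)}}<\infty.$$ Operators. $\mathcal{H}_\varphi f(x)=\int_0^1 f(tx)\varphi(t)\,\mathrm{d}t$ and $\mathcal{H}_\varphi^b f(x)=b(x)\mathcal{H}_\varphi f(x)-\mathcal{H}_\varphi(bf)(x)=\int_0^1(b(x)-b(tx))f(tx)\varphi(t)\,\mathrm{d}t$, whenever well defined. Bounded from $X$ to $Y$ means: $\mathcal{H}_\varphi^b f$ is defined almost everywhere for every $f\in X$ and $\|\mathcal{H}_\varphi^b f\|_Y\le C\|f\|_X$ with $C$ independent of $f$. *)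

theory Defs
  imports "HOL-Analysis.Analysis"
begin

text \<open>
  The decomposition of \<open>\<real>\<^sup>n\<close> into blocks is given by a map \<open>blk\<close> that sends each coordinate to the
  number of its block, with range \<open>{1..m}\<close>. The factor with number \<open>i\<close> is identified with the
  subspace of \<open>\<real>\<^sup>n\<close> on which all coordinates outside block \<open>i\<close> vanish, so that
  \<open>(x\<^sub>1, \<dots>, x\<^sub>m)\<close> is the sum \<open>x\<^sub>1 + \<dots> + x\<^sub>m\<close>.
\<close>

definition block :: "('n \<Rightarrow> nat) \<Rightarrow> nat \<Rightarrow> 'n set" where
  "block blk i = {j. blk j = i}"

definition hom_dim :: "real ^ 'n \<Rightarrow> 'n set \<Rightarrow> real" where
  "hom_dim k J = real (card J) + 2 * (\<Sum>j\<in>J. k $ j)"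

text \<open>The case distinction is needed because \<open>0 powr 0 = 0\<close> in the library.\<close>

definition abs_powr :: "real \<Rightarrow> real \<Rightarrow> real" where
  "abs_powr x a = (if a = 0 then 1 else \<bar>x\<bar> powr a)"

definition dunkl_weight :: "real ^ 'n \<Rightarrow> 'n set \<Rightarrow> real ^ 'n \<Rightarrow> real" where
  "dunkl_weight k J x = (\<Prod>j\<in>J. abs_powr (x $ j) (2 * k $ j))"

definition dunkl_measure :: "real ^ 'n \<Rightarrow> (real ^ 'n) measure" where
  "dunkl_measure k = density lebesgue (\<lambda>x. ennreal (dunkl_weight k UNIV x))"

text \<open>Lebesgue measure of the coordinate subspace belonging to \<open>J\<close>, as a measure on \<open>\<real>\<^sup>n\<close>.\<close>

definition block_lborel :: "'n set \<Rightarrow> (real ^ 'n) measure" where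
  "block_lborel J =
     distr (\<Pi>\<^sub>M j\<in>J. lborel) borel (\<lambda>x. \<chi> j. if j \<in> J then x j else 0)"

text \<open>
  Surface measure of the unit sphere of that subspace, defined through cones:
  \<open>\<sigma>(A) = d \<cdot> |{x. 0 < |x| \<le> 1 \<and> x/|x| \<in> A}|\<close>, where \<open>d = card J\<close>.
  For \<open>d = 1\<close> this is the counting measure on the two unit vectors.
\<close>

definition sphere_measure :: "'n set \<Rightarrow> (real ^ 'n) measure" where
  "sphere_measure J =
     scale_measure (of_nat (card J))
       (distr (density (block_lborel J) (indicator (cball 0 1 - {0}))) borel sgn)"

definition dunkl_sphere_measure :: "real ^ 'n \<Rightarrow> 'n set \<Rightarrow> (real ^ 'n) measure" where
  "dunkl_sphere_measure k J =
     density (sphere_measure J) (\<lambda>\<omega>. ennreal (dunkl_weight k J \<omega>))"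

text \<open>Real powers on \<open>[0, \<infinity>]\<close>, for exponents \<open>a > 0\<close> only.\<close>

definition ennpowr :: "ennreal \<Rightarrow> real \<Rightarrow> ennreal" where
  "ennpowr x a = (if x = \<infinity> then \<infinity> else ennreal (enn2real x powr a))"

definition rad_ang_norm ::
    "real ^ 'n \<Rightarrow> 'n set \<Rightarrow> real \<Rightarrow> real \<Rightarrow> (real ^ 'n \<Rightarrow> ennreal) \<Rightarrow> ennreal" where
  "rad_ang_norm k J u w g =
     ennpowr
       (\<integral>\<^sup>+\<rho>\<in>{0<..}.
          ennpowr (\<integral>\<^sup>+\<omega>. ennpowr (g (\<rho> *\<^sub>R \<omega>)) w \<partial>dunkl_sphere_measure k J) (u / w)
            * ennreal (\<rho> powr (hom_dim k J - 1)) \<partial>lborel)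
       (1 / u)"

text \<open>
  \<open>iter_norm blk k u w f i y\<close> is the result of taking the norms in the blocks \<open>1, \<dots>, i\<close>,
  as a function of the remaining variables \<open>y = x\<^bsub>i+1\<^esub> + \<dots> + x\<^sub>m\<close>.
\<close>

primrec iter_norm ::
    "('n \<Rightarrow> nat) \<Rightarrow> real ^ 'n \<Rightarrow> (nat \<Rightarrow> real) \<Rightarrow> (nat \<Rightarrow> real) \<Rightarrow> (real ^ 'n \<Rightarrow> complex)
      \<Rightarrow> nat \<Rightarrow> real ^ 'n \<Rightarrow> ennreal" where
  "iter_norm blk k u w f 0 y = ennreal (norm (f y))"
| "iter_norm blk k u w f (Suc i) y =
     rad_ang_norm k (block blk (Suc i)) (u (Suc i)) (w (Suc i))
       (\<lambda>x. iter_norm blk k u w f i (x + y))"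

definition mixed_norm ::
    "('n \<Rightarrow> nat) \<Rightarrow> nat \<Rightarrow> real ^ 'n \<Rightarrow> (nat \<Rightarrow> real) \<Rightarrow> (nat \<Rightarrow> real)
      \<Rightarrow> (real ^ 'n \<Rightarrow> complex) \<Rightarrow> ennreal" where
  "mixed_norm blk m k u w f = iter_norm blk k u w f m 0"

definition morrey_norm ::
    "('n::finite \<Rightarrow> nat) \<Rightarrow> nat \<Rightarrow> real ^ 'n \<Rightarrow> real \<Rightarrow> (nat \<Rightarrow> real) \<Rightarrow> (nat \<Rightarrow> real)
      \<Rightarrow> (real ^ 'n \<Rightarrow> complex) \<Rightarrow> ennreal" where
  "morrey_norm blk m k p u w f =
     (SUP R\<in>{0<..}.
        ennreal (measure (dunkl_measure k) (ball 0 R)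
                   powr (1 / p - (\<Sum>i=1..m. hom_dim k (block blk i) / u i) / hom_dim k UNIV))
          * mixed_norm blk m k u w (\<lambda>x. f x * indicator (ball 0 R) x))"

definition morrey_space ::
    "('n::finite \<Rightarrow> nat) \<Rightarrow> nat \<Rightarrow> real ^ 'n \<Rightarrow> real \<Rightarrow> (nat \<Rightarrow> real) \<Rightarrow> (nat \<Rightarrow> real)
      \<Rightarrow> (real ^ 'n \<Rightarrow> complex) set" where
  "morrey_space blk m k p u w =
     {f. f \<in> borel_measurable lebesgue \<and> morrey_norm blk m k p u w f < \<infinity>}"

definition ball_avg :: "real ^ 'n \<Rightarrow> (real ^ 'n::finite \<Rightarrow> complex) \<Rightarrow> real \<Rightarrow> complex" where
  "ball_avg k b R =
     (LINT x:ball 0 R|dunkl_measure k. b x) /\<^sub>R measure (dunkl_measure k) (ball 0 R)"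

definition cmo_norm ::
    "('n::finite \<Rightarrow> nat) \<Rightarrow> nat \<Rightarrow> real ^ 'n \<Rightarrow> (nat \<Rightarrow> real) \<Rightarrow> (nat \<Rightarrow> real)
      \<Rightarrow> (real ^ 'n \<Rightarrow> complex) \<Rightarrow> ennreal" where
  "cmo_norm blk m k u w b =
     (SUP R\<in>{0<..}.
        mixed_norm blk m k u w (\<lambda>x. (b x - ball_avg k b R) * indicator (ball 0 R) x)
          / mixed_norm blk m k u w (indicator (ball 0 R)))"

definition cmo_space ::
    "('n::finite \<Rightarrow> nat) \<Rightarrow> nat \<Rightarrow> real ^ 'n \<Rightarrow> (nat \<Rightarrow> real) \<Rightarrow> (nat \<Rightarrow> real)
      \<Rightarrow> (real ^ 'n \<Rightarrow> complex) set" where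
  "cmo_space blk m k u w =
     {b. (\<forall>K. compact K \<longrightarrow> set_integrable (dunkl_measure k) K b) \<and> cmo_norm blk m k u w b < \<infinity>}"

definition hardy_defined ::
    "(real \<Rightarrow> real) \<Rightarrow> (real ^ 'n \<Rightarrow> complex) \<Rightarrow> real ^ 'n \<Rightarrow> bool" where
  "hardy_defined \<phi> f x \<longleftrightarrow>
     set_integrable lebesgue {0<..1} (\<lambda>t. f (t *\<^sub>R x) * complex_of_real (\<phi> t))"

definition hardy_op ::
    "(real \<Rightarrow> real) \<Rightarrow> (real ^ 'n \<Rightarrow> complex) \<Rightarrow> real ^ 'n \<Rightarrow> complex" where
  "hardy_op \<phi> f x = (LINT t:{0<..1}|lebesgue. f (t *\<^sub>R x) * complex_of_real (\<phi> t))"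

definition commutator_defined ::
    "(real \<Rightarrow> real) \<Rightarrow> (real ^ 'n \<Rightarrow> complex) \<Rightarrow> (real ^ 'n \<Rightarrow> complex) \<Rightarrow> real ^ 'n \<Rightarrow> bool" where
  "commutator_defined \<phi> b f x \<longleftrightarrow>
     hardy_defined \<phi> f x \<and> hardy_defined \<phi> (\<lambda>y. b y * f y) x"

definition commutator ::
    "(real \<Rightarrow> real) \<Rightarrow> (real ^ 'n \<Rightarrow> complex) \<Rightarrow> (real ^ 'n \<Rightarrow> complex) \<Rightarrow> real ^ 'n \<Rightarrow> complex" where
  "commutator \<phi> b f x = b x * hardy_op \<phi> f x - hardy_op \<phi> (\<lambda>y. b y * f y) x"

lemma commutator_eq_integral:
  assumes "commutator_defined \<phi> b f x"
  shows "set_integrable lebesgue {0<..1}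
           (\<lambda>t. (b x - b (t *\<^sub>R x)) * f (t *\<^sub>R x) * complex_of_real (\<phi> t))"
    and "commutator \<phi> b f x =
           (LINT t:{0<..1}|lebesgue. (b x - b (t *\<^sub>R x)) * f (t *\<^sub>R x) * complex_of_real (\<phi> t))"
proof -
  let ?f = "\<lambda>t. f (t *\<^sub>R x) * complex_of_real (\<phi> t)"
  let ?g = "\<lambda>t. b (t *\<^sub>R x) * f (t *\<^sub>R x) * complex_of_real (\<phi> t)"
  have f: "set_integrable lebesgue {0<..1} (\<lambda>t. b x * ?f t)"
    and g: "set_integrable lebesgue {0<..1} ?g"
    using assms unfolding commutator_defined_def hardy_defined_def by auto
  have eq: "(\<lambda>t. (b x - b (t *\<^sub>R x)) * f (t *\<^sub>R x) * complex_of_real (\<phi> t))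
      = (\<lambda>t. b x * ?f t - ?g t)"
    by (simp add: algebra_simps)
  show "set_integrable lebesgue {0<..1}
      (\<lambda>t. (b x - b (t *\<^sub>R x)) * f (t *\<^sub>R x) * complex_of_real (\<phi> t))"
    unfolding eq using f g by (rule set_integral_diff)
  show "commutator \<phi> b f x =
      (LINT t:{0<..1}|lebesgue. (b x - b (t *\<^sub>R x)) * f (t *\<^sub>R x) * complex_of_real (\<phi> t))"
    unfolding eq set_integral_diff(2)[OF f g]
    by (simp add: commutator_def hardy_op_def)
qed

text \<open>Here \<open>u, u'\<close> and \<open>w, w'\<close> are the radial and angular indices of the source and the target.\<close>

definition commutator_bounded ::
    "('n::finite \<Rightarrow> nat) \<Rightarrow> nat \<Rightarrow> real ^ 'n \<Rightarrow> real \<Rightarrow> (nat \<Rightarrow> real) \<Rightarrow> (nat \<Rightarrow> real)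
      \<Rightarrow> (nat \<Rightarrow> real) \<Rightarrow> (nat \<Rightarrow> real) \<Rightarrow> (real \<Rightarrow> real) \<Rightarrow> (real ^ 'n \<Rightarrow> complex) \<Rightarrow> bool" where
  "commutator_bounded blk m k p u w u' w' \<phi> b \<longleftrightarrow>
     (\<exists>C::real. \<forall>f\<in>morrey_space blk m k p u w.
        (AE x in dunkl_measure k. commutator_defined \<phi> b f x) \<and>
        commutator \<phi> b f \<in> morrey_space blk m k p u' w' \<and>
        morrey_norm blk m k p u' w' (commutator \<phi> b f) \<le> ennreal C * morrey_norm blk m k p u w f)"

end

theory Submission
  imports Defs
begin

text \<open>
  Sufficiency: by the integral form of Minkowski's inequality and by Hoelder's inequality in each
  radial and angular variable, the commutator is controlled by the integral over \<open>t\<close> of \<open>\<phi> t\<close> times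
  the norm of \<open>(b - b(t \<cdot>)) \<chi>\<close> times that of \<open>f(t \<cdot>) \<chi>\<close>. Dilation scales the norms by powers of \<open>t\<close>, and
  the means of \<open>b\<close> over the balls of radii \<open>R\<close> and \<open>t R\<close> differ by at most a multiple of \<open>log (2 / t)\<close>,
  since passing to half the radius costs a constant.

  Necessity: \<open>b x = log |x|\<close> has bounded mean oscillation and \<open>f x = |x|\<^bsup>-N/p\<^esup>\<close> lies in the Morrey
  space; that both Hardy integrals exist at one single point \<open>x \<noteq> 0\<close> is already the integral condition.
  Integrability of \<open>|x|\<^bsup>-a\<^esup>\<close> near the origin in a mixed norm follows from a dyadic sum over balls.

  Functions are Lebesgue measurable, while the sphere and block measures live on Borel sets. They
  are replaced by Borel representatives, which is harmless because a Lebesgue null set meets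
  almost every sphere in a null set.
\<close>

section \<open>Mixed norms in one variable\<close>

text \<open>With all exponents equal to 1 the iterated norm is integration against the Dunkl
  measure. Volumes of balls, null sets and local integrability are therefore special cases of facts
  about iterated norms. The rest is governed by homogeneity. Let S(u) be the sum of N_i / u_i;
  replacing g(x) by g(t x) multiplies the norm by t^(-S(u)). Dilating f thus costs t^(-S(r)), while
  the Morrey bound on the ball of radius t R returns t^(S(r) - N/p), and together they leave the
  kernel t^(-N/p). Since S(s) = S(r) + S(q), all powers of R cancel and the estimate is uniform in
  R. The condition S(r) > N/p says that |x|^(-N/p) has finite mixed norm near the origin. The 2 in
  log (2 / t) has two sources: rounding up the number of halvings from R to t R adds 1 to log_2 (1 /
  t), and log (2 / t) >= log 2 on (0, 1] absorbs the oscillation terms that do not depend on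
  t.\<close>

lemma ennpowr_ennreal: "0 \<le> x \<Longrightarrow> ennpowr (ennreal x) a = ennreal (x powr a)"
  by (simp add: ennpowr_def)

lemma ennpowr_zero [simp]: "ennpowr 0 a = 0"
  by (simp add: ennpowr_def)

lemma ennpowr_top [simp]: "ennpowr \<infinity> a = \<infinity>" "ennpowr top a = \<infinity>"
  by (simp_all add: ennpowr_def)

lemma ennpowr_one [simp]: "ennpowr x 1 = x"
  by (cases x) (auto simp: ennpowr_def)

lemma ennpowr_one_base [simp]: "ennpowr 1 a = 1"
  by (simp add: ennpowr_def)

lemma ennpowr_eq_0_iff [simp]: "ennpowr x a = 0 \<longleftrightarrow> x = 0"
  by (cases x) (auto simp: ennpowr_def)

lemma ennpowr_eq_top_iff [simp]: "ennpowr x a = \<infinity> \<longleftrightarrow> x = \<infinity>" "ennpowr x a = top \<longleftrightarrow> x = top"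
  by (auto simp: ennpowr_def)

lemma ennpowr_less_top_iff [simp]: "ennpowr x a < \<infinity> \<longleftrightarrow> x < \<infinity>" "ennpowr x a < top \<longleftrightarrow> x < top"
  by (cases x; simp add: ennpowr_def)+

lemma ennpowr_mono: "x \<le> y \<Longrightarrow> 0 \<le> a \<Longrightarrow> ennpowr x a \<le> ennpowr y a"
  by (cases x; cases y) (auto simp: ennpowr_ennreal top_unique intro!: ennreal_leI powr_mono2)

text \<open>\<open>ennpowr\<close> fixes 0 and \<infinity> for every exponent, negative ones
  included, and 0 * \<infinity> = 0 agrees with this. The power laws therefore hold on the whole of
  [0, \<infinity>], and only monotonicity depends on the sign of the exponent.\<close>

lemma ennpowr_mult: "ennpowr (x * y) a = ennpowr x a * ennpowr y a"
  by (cases x; cases y)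
     (auto simp: ennpowr_ennreal powr_mult ennreal_mult[symmetric] ennreal_mult_top ennreal_top_mult)

lemma ennpowr_powr: "ennpowr (ennpowr x a) b = ennpowr x (a * b)"
  by (cases x) (auto simp: ennpowr_ennreal powr_powr)

lemma ennpowr_add: "ennpowr x a * ennpowr x b = ennpowr x (a + b)"
  by (cases x) (auto simp: ennpowr_ennreal powr_add ennreal_mult[symmetric] ennreal_mult_top ennreal_top_mult)

lemma ennpowr_indicator [simp]: "ennpowr (indicator A x) a = indicator A x"
  by (auto simp: indicator_def)

lemma measurable_ennpowr [measurable]:
  assumes [measurable]: "f \<in> borel_measurable M"
  shows "(\<lambda>x. ennpowr (f x) a) \<in> borel_measurable M"
  unfolding ennpowr_def by measurable

section \<open>The L^p functional on functions with values in [0, \<infinity>]: Hoelder and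
  Minkowski inequalities\<close>

definition lp :: "'a measure \<Rightarrow> real \<Rightarrow> ('a \<Rightarrow> ennreal) \<Rightarrow> ennreal" where
  "lp M p f = ennpowr (\<integral>\<^sup>+x. ennpowr (f x) p \<partial>M) (1 / p)"

lemma lp_mono_AE: "AE x in M. f x \<le> g x \<Longrightarrow> 0 < p \<Longrightarrow> lp M p f \<le> lp M p g"
  unfolding lp_def by (intro ennpowr_mono nn_integral_mono_AE) (auto elim!: eventually_mono intro: ennpowr_mono)

lemma lp_mono: "(\<And>x. x \<in> space M \<Longrightarrow> f x \<le> g x) \<Longrightarrow> 0 < p \<Longrightarrow> lp M p f \<le> lp M p g"
  by (intro lp_mono_AE AE_I2) auto

lemma lp_cong: "(\<And>x. x \<in> space M \<Longrightarrow> f x = g x) \<Longrightarrow> lp M p f = lp M p g"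
  unfolding lp_def by (simp cong: nn_integral_cong)

lemma lp_1 [simp]: "lp M 1 f = (\<integral>\<^sup>+x. f x \<partial>M)"
  by (simp add: lp_def)

lemma lp_cmult:
  assumes [measurable]: "f \<in> borel_measurable M" and "p > 0"
  shows "lp M p (\<lambda>x. c * f x) = c * lp M p f"
  using assms(2) by (simp add: lp_def ennpowr_mult nn_integral_cmult ennpowr_powr)

lemma measurable_lp [measurable]:
  assumes "sigma_finite_measure M" and [measurable]: "case_prod g \<in> borel_measurable (N \<Otimes>\<^sub>M M)"
  shows "(\<lambda>y. lp M p (g y)) \<in> borel_measurable N"
proof -
  interpret sigma_finite_measure M by fact
  show ?thesis unfolding lp_def by measurable
qed

lemma lp_eq_0_iff:
  assumes [measurable]: "f \<in> borel_measurable M"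
  shows "lp M p f = 0 \<longleftrightarrow> (AE x in M. f x = 0)"
  by (simp add: lp_def nn_integral_0_iff_AE)

lemma conjugate_sum:
  fixes s r q :: real
  assumes "0 < s" "1 / s = 1 / r + 1 / q"
  shows "s / r + s / q = 1"
proof -
  have "s / r + s / q = s * (1 / r + 1 / q)"
    by (simp add: algebra_simps)
  also have "\<dots> = 1"
    using assms(1) by (simp add: assms(2)[symmetric])
  finally show ?thesis .
qed

text \<open>Weighted arithmetic-geometric mean inequality for a^r and b^q with the weights s/r and
  s/q, whose sum is 1. An infinite factor makes the right-hand side infinite because both weights
  are positive.\<close>

lemma ennpowr_Young:
  assumes "0 < s" "0 < r" "0 < q" "1 / s = 1 / r + 1 / q"
  shows "ennpowr (a * b) s \<le> ennreal (s / r) * ennpowr a r + ennreal (s / q) * ennpowr b q"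
proof (cases "a = \<infinity> \<or> b = \<infinity>")
  case True
  then show ?thesis
    using assms by (auto simp: ennreal_mult_top)
next
  case False
  then obtain x y where xy: "a = ennreal x" "b = ennreal y" "0 \<le> x" "0 \<le> y"
    by (cases a; cases b) auto
  have 1: "s / r + s / q = 1"
    by (rule conjugate_sum) (use assms in auto)
  have "(x * y) powr s \<le> s / r * x powr r + s / q * y powr q"
  proof (cases "x = 0 \<or> y = 0")
    case True
    then show ?thesis using assms by auto
  next
    case False
    then show ?thesis
      using Youngs_inequality_0[of "s / r" "s / q" "x powr r" "y powr q"] assms xy 1
      by (auto simp: powr_powr powr_mult)
  qed
  then show ?thesis
    using xy assms
    by (auto simp: ennreal_mult[symmetric] ennpowr_ennreal ennreal_plus[symmetric] simp del: ennreal_plus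
             intro!: ennreal_leI)
qed

lemma lp_Holder:
  assumes srq: "0 < s" "0 < r" "0 < q" "1 / s = 1 / r + 1 / q"
    and [measurable]: "f \<in> borel_measurable M" "g \<in> borel_measurable M"
  shows "lp M s (\<lambda>x. f x * g x) \<le> lp M r f * lp M q g"
proof -
  \<comment> \<open>A vanishing norm is settled before an infinite one: 0 * \<infinity> = 0, so the
    right-hand side is then 0 whatever the other norm is, and the product must vanish almost
    everywhere.\<close>
  consider "lp M r f = 0" | "lp M q g = 0" | "lp M r f \<noteq> 0" "lp M q g \<noteq> 0" "lp M r f = \<infinity> \<or> lp M q g = \<infinity>"
    | "lp M r f \<noteq> 0" "lp M r f \<noteq> \<infinity>" "lp M q g \<noteq> 0" "lp M q g \<noteq> \<infinity>"
    by blast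
  then show ?thesis
  proof cases
    case 1
    then have "lp M s (\<lambda>x. f x * g x) = 0"
      by (subst (asm) lp_eq_0_iff, simp, subst lp_eq_0_iff) auto
    then show ?thesis by simp
  next
    case 2
    then have "lp M s (\<lambda>x. f x * g x) = 0"
      by (subst (asm) lp_eq_0_iff, simp, subst lp_eq_0_iff) auto
    then show ?thesis by simp
  next
    case 3
    then show ?thesis by (auto simp: ennreal_mult_top ennreal_top_mult)
  next
    case 4
    then obtain A B where AB: "lp M r f = ennreal A" "lp M q g = ennreal B" "0 < A" "0 < B"
      by (cases "lp M r f"; cases "lp M q g") auto
    \<comment> \<open>Both factors are normalised to norm 1, where the integrated Young inequality
      gives the bound s/r + s/q = 1.\<close>
    define f' where "f' x = ennreal (1 / A) * f x" for x
    define g' where "g' x = ennreal (1 / B) * g x" for x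
    have [measurable]: "f' \<in> borel_measurable M" "g' \<in> borel_measurable M"
      unfolding f'_def g'_def by auto
    have "lp M r f' = 1" "lp M q g' = 1"
      unfolding f'_def g'_def using AB srq
      by (simp_all add: lp_cmult ennreal_mult[symmetric])
    then have int: "(\<integral>\<^sup>+x. ennpowr (f' x) r \<partial>M) = 1" "(\<integral>\<^sup>+x. ennpowr (g' x) q \<partial>M) = 1"
      unfolding lp_def using srq
      by (metis ennpowr_powr ennpowr_one ennpowr_one_base divide_self less_irrefl mult.commute mult.right_neutral
        times_divide_eq_right)+
    have "(\<integral>\<^sup>+x. ennpowr (f' x * g' x) s \<partial>M)
      \<le> (\<integral>\<^sup>+x. ennreal (s / r) * ennpowr (f' x) r + ennreal (s / q) * ennpowr (g' x) q \<partial>M)"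
      by (intro nn_integral_mono ennpowr_Young srq)
    also have "\<dots> = ennreal (s / r) + ennreal (s / q)"
      by (simp add: nn_integral_add nn_integral_cmult int)
    also have "\<dots> = 1"
      using srq conjugate_sum[OF srq(1,4)] by (simp add: ennreal_plus[symmetric] del: ennreal_plus)
    finally have "lp M s (\<lambda>x. f' x * g' x) \<le> ennpowr 1 (1 / s)"
      unfolding lp_def using srq by (intro ennpowr_mono) auto
    then have le1: "lp M s (\<lambda>x. f' x * g' x) \<le> 1"
      by simp
    have "f x = ennreal A * f' x" "g x = ennreal B * g' x" for x
      using AB by (simp_all add: f'_def g'_def mult.assoc[symmetric] ennreal_mult[symmetric])
    then have eq: "(\<lambda>x. f x * g x) = (\<lambda>x. (ennreal A * ennreal B) * (f' x * g' x))"
      by (auto simp: ac_simps)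
    have "lp M s (\<lambda>x. f x * g x) = (ennreal A * ennreal B) * lp M s (\<lambda>x. f' x * g' x)"
      unfolding eq using srq by (intro lp_cmult) auto
    also have "\<dots> \<le> (ennreal A * ennreal B) * 1"
      by (intro mult_left_mono le1) auto
    finally show ?thesis using AB by simp
  qed
qed

text \<open>
  With \<open>a t = \<parallel>g(\<cdot>, t)\<parallel>\<^sub>p\<close>, Hoelder's inequality in \<open>t\<close> for \<open>g = (g a\<^bsup>-1/p'\<^esup>) a\<^bsup>1/p'\<^esup>\<close> bounds
  \<open>(\<integral> g dt)\<^sup>p\<close> by \<open>(\<integral> a dt)\<^bsup>p-1\<^esup> \<integral> g\<^sup>p a\<^bsup>1-p\<^esup> dt\<close>; then integrate in \<open>x\<close>.
\<close>

lemma lp_Minkowski: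
  assumes "sigma_finite_measure M" "sigma_finite_measure T" and p: "1 < p"
    and meas [measurable]: "case_prod g \<in> borel_measurable (M \<Otimes>\<^sub>M T)"
  shows "lp M p (\<lambda>x. \<integral>\<^sup>+t. g x t \<partial>T) \<le> (\<integral>\<^sup>+t. lp M p (\<lambda>x. g x t) \<partial>T)"
proof -
  interpret M: sigma_finite_measure M by fact
  interpret T: sigma_finite_measure T by fact
  interpret MT: pair_sigma_finite M T ..
  define p' where "p' = p / (p - 1)"
  have p': "0 < p'" "1 / 1 = 1 / p + 1 / p'"
    using p by (auto simp: p'_def field_simps)
  define a where "a t = lp M p (\<lambda>x. g x t)" for t
  have [measurable]: "a \<in> borel_measurable T"
    unfolding a_def by (intro measurable_lp M.sigma_finite_measure_axioms) measurable
  define A where "A = (\<integral>\<^sup>+t. a t \<partial>T)"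
  \<comment> \<open>The weight a^(-1/p'), set to 0 at the two degenerate values. Nothing is lost:
    once A is finite, a is finite for almost every t, and a t = 0 means that g(., t) vanishes almost
    everywhere.\<close>
  define e where "e t = (if a t = 0 \<or> a t = \<infinity> then 0 else ennpowr (a t) (- 1 / p'))" for t
  have [measurable]: "e \<in> borel_measurable T"
    unfolding e_def by measurable
  define G where "G x = (\<integral>\<^sup>+t. g x t \<partial>T)" for x
  have [measurable]: "G \<in> borel_measurable M"
    unfolding G_def by measurable
  show ?thesis
  proof (cases "A = \<infinity>")
    case True
    then show ?thesis unfolding A_def a_def by simp
  next
    case False
    have finA: "AE t in T. a t \<noteq> \<infinity>"
      using False unfolding A_def by (intro nn_integral_noteq_infinite) auto
    have "AE t in T. AE x in M. g x t \<le> (g x t * e t) * ennpowr (a t) (1 / p')"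
      using finA AE_space
    proof eventually_elim
      case (elim t)
      note [measurable] = elim(2)
      show ?case
      proof (cases "a t = 0")
        case True
        then have "AE x in M. g x t = 0"
          unfolding a_def by (subst (asm) lp_eq_0_iff) measurable
        then show ?thesis by eventually_elim auto
      next
        case False
        then have "e t * ennpowr (a t) (1 / p') = 1"
          using elim unfolding e_def by (cases "a t") (auto simp: ennpowr_ennreal ennreal_mult[symmetric] powr_add[symmetric])
        then show ?thesis by (simp add: mult.assoc)
      qed
    qed
    then have ae: "AE x in M. AE t in T. g x t \<le> (g x t * e t) * ennpowr (a t) (1 / p')"
      by (subst MT.AE_commute) measurable
    have "AE x in M. ennpowr (G x) p \<le> ennpowr A (p / p') * (\<integral>\<^sup>+t. ennpowr (g x t * e t) p \<partial>T)"
      using ae AE_space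
    proof eventually_elim
      case (elim x)
      note [measurable] = elim(2)
      have "G x \<le> (\<integral>\<^sup>+t. (g x t * e t) * ennpowr (a t) (1 / p') \<partial>T)"
        unfolding G_def by (intro nn_integral_mono_AE elim)
      also have "\<dots> = lp T 1 (\<lambda>t. (g x t * e t) * ennpowr (a t) (1 / p'))"
        by simp
      also have "\<dots> \<le> lp T p (\<lambda>t. g x t * e t) * lp T p' (\<lambda>t. ennpowr (a t) (1 / p'))"
        using p p' by (intro lp_Holder) auto
      also have "lp T p' (\<lambda>t. ennpowr (a t) (1 / p')) = ennpowr A (1 / p')"
        using p' by (simp add: lp_def ennpowr_powr A_def)
      finally have "ennpowr (G x) p \<le> ennpowr (lp T p (\<lambda>t. g x t * e t) * ennpowr A (1 / p')) p"
        using p by (intro ennpowr_mono) auto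
      then show ?case
        using p by (simp add: ennpowr_mult ennpowr_powr lp_def mult.commute)
    qed
    then have "(\<integral>\<^sup>+x. ennpowr (G x) p \<partial>M)
        \<le> (\<integral>\<^sup>+x. ennpowr A (p / p') * (\<integral>\<^sup>+t. ennpowr (g x t * e t) p \<partial>T) \<partial>M)"
      by (rule nn_integral_mono_AE)
    also have "\<dots> = ennpowr A (p / p') * (\<integral>\<^sup>+x. (\<integral>\<^sup>+t. ennpowr (g x t * e t) p \<partial>T) \<partial>M)"
      by (intro nn_integral_cmult) measurable
    also have "(\<integral>\<^sup>+x. (\<integral>\<^sup>+t. ennpowr (g x t * e t) p \<partial>T) \<partial>M)
        = (\<integral>\<^sup>+t. (\<integral>\<^sup>+x. ennpowr (g x t * e t) p \<partial>M) \<partial>T)"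
      by (intro MT.Fubini'[symmetric]) measurable
    also have "\<dots> \<le> (\<integral>\<^sup>+t. a t \<partial>T)"
    proof (intro nn_integral_mono)
      fix t assume [measurable]: "t \<in> space T"
      have "(\<integral>\<^sup>+x. ennpowr (g x t * e t) p \<partial>M) = (\<integral>\<^sup>+x. ennpowr (e t) p * ennpowr (g x t) p \<partial>M)"
        by (simp add: ennpowr_mult mult.commute)
      also have "\<dots> = ennpowr (e t) p * (\<integral>\<^sup>+x. ennpowr (g x t) p \<partial>M)"
        by (intro nn_integral_cmult) measurable
      also have "(\<integral>\<^sup>+x. ennpowr (g x t) p \<partial>M) = ennpowr (a t) p"
        using p by (simp add: a_def lp_def ennpowr_powr)
      \<comment> \<open>Because p / p' = p - 1, the powers combine to a^(1 - p) a^p = a; at a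
        degenerate value the left-hand side is 0.\<close>
      also have "ennpowr (e t) p * ennpowr (a t) p \<le> a t"
      proof (cases "a t = 0 \<or> a t = \<infinity>")
        case True
        then show ?thesis by (auto simp: e_def)
      next
        case False
        have "- 1 / p' * p + p = 1"
          using p p' by (simp add: p'_def field_simps)
        then show ?thesis
          using False by (simp add: e_def ennpowr_powr ennpowr_add)
      qed
      finally show "(\<integral>\<^sup>+x. ennpowr (g x t * e t) p \<partial>M) \<le> a t" .
    qed
    finally have "(\<integral>\<^sup>+x. ennpowr (G x) p \<partial>M) \<le> ennpowr A (p / p') * A"
      unfolding A_def by (simp add: mult_left_mono)
    also have "\<dots> = ennpowr A (p / p') * ennpowr A 1"
      by simp
    also have "\<dots> = ennpowr A (p / p' + 1)"
      by (rule ennpowr_add)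
    also have "p / p' + 1 = p"
      using p by (simp add: p'_def)
    finally have "lp M p G \<le> ennpowr (ennpowr A p) (1 / p)"
      unfolding lp_def using p by (intro ennpowr_mono) auto
    then show ?thesis
      using p by (simp add: ennpowr_powr G_def[abs_def] A_def a_def)
  qed
qed

section \<open>Polar coordinates for the Dunkl measure\<close>

lemma measurable_vec_nth [measurable]: "(\<lambda>x::real^'n. x $ j) \<in> borel_measurable borel"
  by (intro borel_measurable_continuous_onI continuous_intros)

lemma borel_measurable_vecI:
  fixes f :: "'a \<Rightarrow> real^'n"
  assumes "\<And>j. (\<lambda>x. f x $ j) \<in> borel_measurable M"
  shows "f \<in> borel_measurable M"
  using assms by (subst borel_measurable_euclidean_space) (auto simp: Basis_vec_def inner_axis)

interpretation lborel_prod: product_sigma_finite "\<lambda>_::'n. lborel :: real measure" ..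

definition emb :: "'n set \<Rightarrow> ('n \<Rightarrow> real) \<Rightarrow> real ^ 'n" where
  "emb J x = (\<chi> j. if j \<in> J then x j else 0)"

lemma measurable_emb [measurable]: "emb J \<in> borel_measurable (\<Pi>\<^sub>M j\<in>J. lborel)"
proof (rule borel_measurable_vecI)
  show "(\<lambda>x. emb J x $ j) \<in> borel_measurable (\<Pi>\<^sub>M j\<in>J. lborel)" for j
    by (cases "j \<in> J") (auto simp: emb_def)
qed

lemma sets_block_lborel [simp, measurable_cong]: "sets (block_lborel J) = sets borel"
  and space_block_lborel [simp]: "space (block_lborel J) = UNIV"
  by (simp_all add: block_lborel_def)

lemma nn_integral_block_lborel:
  fixes J :: "'n::finite set"
  assumes [measurable]: "g \<in> borel_measurable borel"
  shows "(\<integral>\<^sup>+x. g x \<partial>block_lborel J) = (\<integral>\<^sup>+x. g (emb J x) \<partial>(\<Pi>\<^sub>M j\<in>J. lborel))"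
  using measurable_emb[of J] unfolding block_lborel_def emb_def[symmetric] by (subst nn_integral_distr) auto

lemma nn_integral_block_lborel_prod:
  fixes J :: "'n::finite set"
  assumes [measurable]: "\<And>j. f j \<in> borel_measurable borel"
  shows "(\<integral>\<^sup>+x. (\<Prod>j\<in>J. f j (x $ j)) \<partial>block_lborel J) = (\<Prod>j\<in>J. \<integral>\<^sup>+t. f j t \<partial>lborel)"
proof -
  have "(\<integral>\<^sup>+x. (\<Prod>j\<in>J. f j (x $ j)) \<partial>block_lborel J) = (\<integral>\<^sup>+x. (\<Prod>j\<in>J. f j (emb J x $ j)) \<partial>(\<Pi>\<^sub>M j\<in>J. lborel))"
    by (intro nn_integral_block_lborel) measurable
  also have "\<dots> = (\<integral>\<^sup>+x. (\<Prod>j\<in>J. f j (x j)) \<partial>(\<Pi>\<^sub>M j\<in>J. lborel))"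
    by (simp add: emb_def)
  also have "\<dots> = (\<Prod>j\<in>J. \<integral>\<^sup>+t. f j t \<partial>lborel)"
    by (intro lborel_prod.product_nn_integral_prod) auto
  finally show ?thesis .
qed

lemma emeasure_block_lborel_cball: "emeasure (block_lborel J) (cball (0::real^'n) R) < \<infinity>"
proof -
  have "emeasure (block_lborel J) (cball 0 R) = (\<integral>\<^sup>+x. indicator (cball 0 R) x \<partial>block_lborel J)"
    by simp
  also have "\<dots> \<le> (\<integral>\<^sup>+x. (\<Prod>j\<in>J. indicator {-R..R} (x $ j)) \<partial>block_lborel J)"
  proof (intro nn_integral_mono)
    fix x :: "real^'n"
    show "indicator (cball 0 R) x \<le> ((\<Prod>j\<in>J. indicator {-R..R} (x $ j)) :: ennreal)"
    proof (cases "norm x \<le> R")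
      case True
      have "\<bar>x $ j\<bar> \<le> R" for j
        using True component_le_norm_cart[of x j] by linarith
      then have "x $ j \<in> {-R..R}" for j
        by (auto simp: abs_le_iff minus_le_iff)
      then show ?thesis
        by (auto simp: indicator_def)
    qed auto
  qed
  also have "\<dots> = (\<Prod>j\<in>J. \<integral>\<^sup>+t. indicator {-R..R} t \<partial>lborel)"
    by (intro nn_integral_block_lborel_prod) auto
  also have "\<dots> < \<infinity>"
    by (cases "-R \<le> R") (auto simp: ennreal_power[symmetric] power_less_top_ennreal)
  finally show ?thesis .
qed

lemma sigma_finite_block_lborel: "sigma_finite_measure (block_lborel J :: (real^'n) measure)"
proof
  show "\<exists>A::(real^'n) set set. countable A \<and> A \<subseteq> sets (block_lborel J) \<and> \<Union>A = space (block_lborel J) \<and>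
      (\<forall>a\<in>A. emeasure (block_lborel J) a \<noteq> \<infinity>)"
  proof (intro exI[of _ "range (\<lambda>n::nat. cball (0::real^'n) (real n))"] conjI ballI)
    show "\<Union> (range (\<lambda>n::nat. cball (0::real^'n) (real n))) = space (block_lborel J)"
      using real_arch_simple by auto
    show "emeasure (block_lborel J) a \<noteq> \<infinity>" if "a \<in> range (\<lambda>n::nat. cball (0::real^'n) (real n))" for a
      using that emeasure_block_lborel_cball[of J] by (auto simp: less_top)
  qed auto
qed

interpretation block_lborel: sigma_finite_measure "block_lborel J :: (real^'n) measure" for J
  by (rule sigma_finite_block_lborel)

text \<open>Vectors supported on disjoint sets of coordinates are merged by addition, so Tonelli's
  theorem on the product of the coordinate lines takes this additive form.\<close>

lemma nn_integral_block_lborel_Un: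
  fixes A B :: "'n::finite set"
  assumes "A \<inter> B = {}" and [measurable]: "g \<in> borel_measurable borel"
  shows "(\<integral>\<^sup>+x. g x \<partial>block_lborel (A \<union> B)) = (\<integral>\<^sup>+x. \<integral>\<^sup>+y. g (x + y) \<partial>block_lborel B \<partial>block_lborel A)"
proof -
  have emb: "emb (A \<union> B) (merge A B (x, y)) = emb A x + emb B y" for x y :: "'n \<Rightarrow> real"
    using assms(1) by (auto simp: emb_def vec_eq_iff merge_def)
  have "(\<integral>\<^sup>+x. g x \<partial>block_lborel (A \<union> B)) = (\<integral>\<^sup>+x. g (emb (A \<union> B) x) \<partial>(\<Pi>\<^sub>M j\<in>A \<union> B. lborel))"
    by (intro nn_integral_block_lborel) measurable
  also have "\<dots> = (\<integral>\<^sup>+x. (\<integral>\<^sup>+y. g (emb (A \<union> B) (merge A B (x, y))) \<partial>(\<Pi>\<^sub>M j\<in>B. lborel)) \<partial>(\<Pi>\<^sub>M j\<in>A. lborel))"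
    by (intro lborel_prod.product_nn_integral_fold assms(1)) auto
  also have "\<dots> = (\<integral>\<^sup>+x. (\<integral>\<^sup>+y. g (emb A x + emb B y) \<partial>(\<Pi>\<^sub>M j\<in>B. lborel)) \<partial>(\<Pi>\<^sub>M j\<in>A. lborel))"
    unfolding emb ..
  also have "\<dots> = (\<integral>\<^sup>+x. (\<integral>\<^sup>+y. g (emb A x + y) \<partial>block_lborel B) \<partial>(\<Pi>\<^sub>M j\<in>A. lborel))"
    by (intro nn_integral_cong nn_integral_block_lborel[symmetric]) auto
  also have "\<dots> = (\<integral>\<^sup>+x. (\<integral>\<^sup>+y. g (x + y) \<partial>block_lborel B) \<partial>block_lborel A)"
    by (intro nn_integral_block_lborel[symmetric]) measurable
  finally show ?thesis .
qed

lemma nn_integral_block_lborel_singleton: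
  fixes j :: "'n::finite"
  assumes [measurable]: "g \<in> borel_measurable borel"
  shows "(\<integral>\<^sup>+x. g x \<partial>block_lborel {j}) = (\<integral>\<^sup>+t. g (axis j t) \<partial>lborel)"
proof -
  have [measurable]: "(\<lambda>t. axis j t :: real^'n) \<in> borel_measurable borel"
    by (rule borel_measurable_vecI) (auto simp: axis_def)
  have "(\<integral>\<^sup>+x. g x \<partial>block_lborel {j}) = (\<integral>\<^sup>+x. g (axis j (x j)) \<partial>(\<Pi>\<^sub>M j\<in>{j}. lborel))"
    by (subst nn_integral_block_lborel) (auto intro!: nn_integral_cong arg_cong[of _ _ g] simp: emb_def axis_def vec_eq_iff)
  also have "\<dots> = (\<integral>\<^sup>+t. g (axis j t) \<partial>lborel)"
    by (intro lborel_prod.product_nn_integral_singleton) auto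
  finally show ?thesis .
qed

lemma nn_integral_block_lborel_empty:
  fixes g :: "real^'n \<Rightarrow> ennreal"
  assumes [measurable]: "g \<in> borel_measurable borel"
  shows "(\<integral>\<^sup>+x. g x \<partial>block_lborel {}) = g 0"
proof -
  have "emb {} (\<lambda>k. undefined) = (0 :: real^'n)"
    by (auto simp: emb_def vec_eq_iff)
  then show ?thesis
    by (simp add: nn_integral_block_lborel lborel_prod.nn_integral_empty)
qed

text \<open>Lebesgue measure is determined by its values on boxes. This links the subspace measures
  to the ambient one after all blocks have been put together.\<close>

lemma block_lborel_UNIV: "(block_lborel UNIV :: (real^'n) measure) = lborel"
proof (rule lborel_eqI[symmetric])
  fix l u :: "real^'n"
  assume le: "\<And>b. b \<in> Basis \<Longrightarrow> l \<bullet> b \<le> u \<bullet> b"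
  have le': "l $ j \<le> u $ j" for j
    using le[of "axis j 1"] by (simp add: inner_axis axis_in_Basis_iff)
  have ind: "(indicator (box l u) x :: ennreal) = (\<Prod>j\<in>UNIV. indicator {l $ j <..< u $ j} (x $ j))" for x
    by (auto simp: indicator_def mem_box_cart)
  have "emeasure (block_lborel UNIV) (box l u) = (\<integral>\<^sup>+x. indicator (box l u) x \<partial>block_lborel UNIV)"
    by simp
  also have "\<dots> = (\<Prod>j\<in>UNIV. \<integral>\<^sup>+t. indicator {l $ j <..< u $ j} t \<partial>lborel)"
    unfolding ind by (intro nn_integral_block_lborel_prod) auto
  also have "\<dots> = ennreal (\<Prod>j\<in>UNIV. (u - l) $ j)"
    using le' by (simp add: prod_ennreal)
  also have "(\<Prod>j\<in>UNIV. (u - l) $ j) = (\<Prod>b\<in>Basis. (u - l) \<bullet> b)"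
  proof -
    have B: "Basis = (\<lambda>j. axis j (1::real)) ` (UNIV :: 'n set)"
      by (auto simp: Basis_vec_def)
    show ?thesis
      unfolding B by (subst prod.reindex) (auto simp: inj_on_def axis_eq_axis inner_axis)
  qed
  finally show "emeasure (block_lborel UNIV) (box l u) = ennreal (\<Prod>b\<in>Basis. (u - l) \<bullet> b)" .
qed simp

lemma AE_block_lborel_support: "AE x in block_lborel J. \<forall>j. j \<notin> J \<longrightarrow> x $ j = 0"
proof -
  have "AE x in (\<Pi>\<^sub>M j\<in>J. lborel). \<forall>j. j \<notin> J \<longrightarrow> emb J x $ j = 0"
    by (auto simp: emb_def)
  then show ?thesis
    using measurable_emb[of J] unfolding block_lborel_def emb_def[symmetric]
    by (subst AE_distr_iff) auto
qed

text \<open>Splitting off coordinate j leaves the null set {0} on a line. For a single block this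
  makes the origin null; for all coordinates it makes the Dunkl weight positive almost
  everywhere.\<close>

lemma AE_block_lborel_component_nonzero:
  fixes J :: "'n::finite set"
  assumes "j \<in> J"
  shows "AE x in block_lborel J. x $ j \<noteq> 0"
proof -
  have J: "J = {j} \<union> (J - {j})"
    using assms by auto
  have "(\<integral>\<^sup>+x. indicator {0} (x $ j) \<partial>block_lborel J)
      = (\<integral>\<^sup>+x. \<integral>\<^sup>+y. indicator {0} ((x + y) $ j) \<partial>block_lborel (J - {j}) \<partial>block_lborel {j})"
    by (subst J, subst nn_integral_block_lborel_Un) auto
  also have "\<dots> = (\<integral>\<^sup>+t. \<integral>\<^sup>+y. indicator {0} ((axis j t + y) $ j) \<partial>block_lborel (J - {j}) \<partial>lborel)"
    by (intro nn_integral_block_lborel_singleton) measurable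
  also have "\<dots> = (\<integral>\<^sup>+t. 0 \<partial>(lborel :: real measure))"
  proof (intro nn_integral_cong_AE)
    have "AE t in lborel. t \<noteq> (0::real)"
      by (rule AE_lborel_singleton)
    then show "AE t in lborel. (\<integral>\<^sup>+y. indicator {0} ((axis j t + y) $ j) \<partial>block_lborel (J - {j})) = 0"
    proof eventually_elim
      case (elim t)
      have "AE y in block_lborel (J - {j}). indicator {0} ((axis j t + y) $ j) = (0::ennreal)"
        using AE_block_lborel_support[of "J - {j}"]
        by eventually_elim (use elim in \<open>auto simp: indicator_def axis_def\<close>)
      then show ?case
        by (subst nn_integral_0_iff_AE) auto
    qed
  qed
  finally have "(\<integral>\<^sup>+x. indicator {0} (x $ j) \<partial>block_lborel J) = 0"
    by simp
  then have "AE x in block_lborel J. indicator {0} (x $ j) = (0::ennreal)"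
    by (subst (asm) nn_integral_0_iff_AE) auto
  then show ?thesis
    by (auto simp: indicator_def split: if_splits elim!: eventually_mono)
qed

text \<open>One affine substitution on the real line per coordinate, by induction over J. The
  function g is generalised since the induction hypothesis is applied to its translates by the new
  coordinate.\<close>

lemma nn_integral_block_lborel_scale:
  fixes J :: "'n::finite set"
  assumes c: "0 < c" and "g \<in> borel_measurable borel"
  shows "(\<integral>\<^sup>+x. g x \<partial>block_lborel J) = ennreal (c ^ card J) * (\<integral>\<^sup>+x. g (c *\<^sub>R x) \<partial>block_lborel J)"
  using finite[of J] assms(2)
proof (induction J arbitrary: g rule: finite_induct)
  case empty
  then show ?case by (simp add: nn_integral_block_lborel_empty)
next
  case (insert j J)
  note [measurable] = insert.prems
  have ins: "(\<integral>\<^sup>+x. h x \<partial>block_lborel (insert j J)) = (\<integral>\<^sup>+t. \<integral>\<^sup>+y. h (axis j t + y) \<partial>block_lborel J \<partial>lborel)"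
    if [measurable]: "h \<in> borel_measurable borel" for h
  proof -
    have "(\<integral>\<^sup>+x. h x \<partial>block_lborel (insert j J)) = (\<integral>\<^sup>+x. h x \<partial>block_lborel ({j} \<union> J))"
      by simp
    also have "\<dots> = (\<integral>\<^sup>+x. \<integral>\<^sup>+y. h (x + y) \<partial>block_lborel J \<partial>block_lborel {j})"
      using insert by (intro nn_integral_block_lborel_Un) auto
    also have "\<dots> = (\<integral>\<^sup>+t. \<integral>\<^sup>+y. h (axis j t + y) \<partial>block_lborel J \<partial>lborel)"
      by (intro nn_integral_block_lborel_singleton) measurable
    finally show ?thesis .
  qed
  have [measurable]: "(\<lambda>t. axis j t :: real^'n) \<in> borel_measurable borel"
    by (rule borel_measurable_vecI) (auto simp: axis_def)
  have ax: "c *\<^sub>R (axis j t + y) = axis j (c * t) + c *\<^sub>R y" for t and y :: "real^'n"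
    by (auto simp: vec_eq_iff axis_def algebra_simps)
  have "(\<integral>\<^sup>+x. g x \<partial>block_lborel (insert j J)) = (\<integral>\<^sup>+t. \<integral>\<^sup>+y. g (axis j t + y) \<partial>block_lborel J \<partial>lborel)"
    by (rule ins) fact
  also have "\<dots> = (\<integral>\<^sup>+t. ennreal (c ^ card J) * (\<integral>\<^sup>+y. g (axis j t + c *\<^sub>R y) \<partial>block_lborel J) \<partial>lborel)"
    by (intro nn_integral_cong insert.IH) measurable
  also have "\<dots> = ennreal (c ^ card J) * (\<integral>\<^sup>+t. (\<integral>\<^sup>+y. g (axis j t + c *\<^sub>R y) \<partial>block_lborel J) \<partial>lborel)"
    by (intro nn_integral_cmult) measurable
  also have "(\<integral>\<^sup>+t. (\<integral>\<^sup>+y. g (axis j t + c *\<^sub>R y) \<partial>block_lborel J) \<partial>lborel)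
      = ennreal c * (\<integral>\<^sup>+t. (\<integral>\<^sup>+y. g (axis j (c * t) + c *\<^sub>R y) \<partial>block_lborel J) \<partial>lborel)"
    using c by (subst nn_integral_real_affine[of _ c 0]) auto
  also have "(\<integral>\<^sup>+t. (\<integral>\<^sup>+y. g (axis j (c * t) + c *\<^sub>R y) \<partial>block_lborel J) \<partial>lborel)
      = (\<integral>\<^sup>+x. g (c *\<^sub>R x) \<partial>block_lborel (insert j J))"
    by (subst ins) (auto simp: ax)
  finally show ?case
    using insert c by (simp add: mult.assoc[symmetric] ennreal_mult[symmetric] mult.commute)
qed

section \<open>Surface measure and polar coordinates in a coordinate subspace\<close>

lemma sets_sphere_measure [simp, measurable_cong]: "sets (sphere_measure J) = sets borel"
  and space_sphere_measure [simp]: "space (sphere_measure J) = UNIV"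
  by (simp_all add: sphere_measure_def space_scale_measure)

lemma nn_integral_sphere_measure:
  fixes J :: "'n::finite set"
  assumes [measurable]: "g \<in> borel_measurable borel"
  shows "(\<integral>\<^sup>+\<omega>. g \<omega> \<partial>sphere_measure J)
    = of_nat (card J) * (\<integral>\<^sup>+x. indicator (cball 0 1 - {0}) x * g (sgn x) \<partial>block_lborel J)"
proof -
  define B where "B = cball 0 1 - {0 :: real^'n}"
  have [measurable]: "B \<in> sets borel"
    unfolding B_def by (intro sets.Diff) auto
  show ?thesis
    unfolding sphere_measure_def B_def[symmetric]
    by (subst nn_integral_scale_measure, simp, subst nn_integral_distr, measurable, subst nn_integral_density)
       auto
qed

text \<open>The antiderivative is -s^(-d). With a = |x| the value cancels the factor |x|^d that the
  change to polar coordinates leaves behind.\<close>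

lemma nn_integral_powr_tail:
  assumes "0 < a" "0 < d"
  shows "(\<integral>\<^sup>+s. ennreal (d * s powr (- d - 1)) * indicator {a..} s \<partial>lborel) = ennreal (a powr - d)"
proof -
  have "(\<integral>\<^sup>+s. ennreal (d * s powr (- d - 1)) * indicator {a..} s \<partial>lborel) = ennreal (0 - (- (a powr - d)))"
  proof (rule nn_integral_FTC_atLeast)
    show "((\<lambda>s. - (s powr - d)) \<longlongrightarrow> 0) at_top"
      using tendsto_minus[OF tendsto_neg_powr[of "- d", OF _ filterlim_ident]] assms by simp
    show "((\<lambda>s. - (s powr - d)) has_real_derivative d * s powr (- d - 1)) (at s)" if "a \<le> s" for s
      using that assms by (auto intro!: derivative_eq_intros)
  qed (use assms in auto)
  then show ?thesis by simp
qed

text \<open>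
  Unfolding the sphere measure, the right-hand side is the integral over \<open>(\<rho>, x)\<close> with
  \<open>0 < |x| \<le> 1\<close> of \<open>d \<rho>\<^bsup>d-1\<^esup> g(\<rho> x / |x|)\<close>. Substituting \<open>\<rho> = s |x|\<close> and then \<open>x \<rightarrow> x / s\<close> turns it into
  the integral of \<open>g(x) |x|\<^sup>d \<cdot> d s\<^bsup>-d-1\<^esup>\<close> over \<open>s \<ge> |x|\<close>, and the \<open>s\<close>-integral is \<open>|x|\<^bsup>-d\<^esup>\<close>.
\<close>

lemma nn_integral_polar:
  fixes J :: "'n::finite set"
  assumes "J \<noteq> {}" and [measurable]: "g \<in> borel_measurable borel"
  shows "(\<integral>\<^sup>+x. g x \<partial>block_lborel J)
    = (\<integral>\<^sup>+\<rho>\<in>{0<..}. (\<integral>\<^sup>+\<omega>. g (\<rho> *\<^sub>R \<omega>) \<partial>sphere_measure J) * ennreal (\<rho> powr (real (card J) - 1)) \<partial>lborel)"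
proof -
  define d where "d = real (card J)"
  have d: "0 < d" "ennreal d = of_nat (card J)"
    using assms(1) by (simp_all add: d_def card_gt_0_iff ennreal_of_nat_eq_real_of_nat)
  interpret P: pair_sigma_finite "lborel :: real measure" "block_lborel J :: (real^'n) measure" ..
  define B where "B = cball 0 1 - {0 :: real^'n}"
  have [measurable]: "B \<in> sets borel"
    unfolding B_def by (intro sets.Diff) auto
  have dm: "ennreal d * ennreal (r powr a) = ennreal (d * r powr a)" for r a
    using d by (simp add: ennreal_mult)
  have "(\<integral>\<^sup>+\<rho>\<in>{0<..}. (\<integral>\<^sup>+\<omega>. g (\<rho> *\<^sub>R \<omega>) \<partial>sphere_measure J) * ennreal (\<rho> powr (d - 1)) \<partial>lborel)
      = (\<integral>\<^sup>+\<rho>. (\<integral>\<^sup>+x. indicator B x * (g (\<rho> *\<^sub>R sgn x) * ennreal (d * \<rho> powr (d - 1)) * indicator {0<..} \<rho>) \<partial>block_lborel J) \<partial>lborel)"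
  proof (rule nn_integral_cong)
    fix \<rho> :: real
    have "(\<integral>\<^sup>+\<omega>. g (\<rho> *\<^sub>R \<omega>) \<partial>sphere_measure J) * ennreal (\<rho> powr (d - 1)) * indicator {0<..} \<rho>
      = (ennreal d * ennreal (\<rho> powr (d - 1)) * indicator {0<..} \<rho>) * (\<integral>\<^sup>+x. indicator B x * g (\<rho> *\<^sub>R sgn x) \<partial>block_lborel J)"
      unfolding B_def by (subst nn_integral_sphere_measure) (auto simp: d ac_simps)
    also have "\<dots> = (\<integral>\<^sup>+x. (ennreal d * ennreal (\<rho> powr (d - 1)) * indicator {0<..} \<rho>) * (indicator B x * g (\<rho> *\<^sub>R sgn x)) \<partial>block_lborel J)"
      by (intro nn_integral_cmult[symmetric]) measurable
    finally show "(\<integral>\<^sup>+\<omega>. g (\<rho> *\<^sub>R \<omega>) \<partial>sphere_measure J) * ennreal (\<rho> powr (d - 1)) * indicator {0<..} \<rho> = 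
      (\<integral>\<^sup>+x. indicator B x * (g (\<rho> *\<^sub>R sgn x) * ennreal (d * \<rho> powr (d - 1)) * indicator {0<..} \<rho>) \<partial>block_lborel J)"
      by (simp add: dm ac_simps)
  qed
  also have "\<dots> = (\<integral>\<^sup>+x. (\<integral>\<^sup>+\<rho>. indicator B x * (g (\<rho> *\<^sub>R sgn x) * ennreal (d * \<rho> powr (d - 1)) * indicator {0<..} \<rho>) \<partial>lborel) \<partial>block_lborel J)"
    by (intro P.Fubini'[symmetric]) measurable
  \<comment> \<open>Substitution \<rho> = s |x| for fixed x, which turns \<rho> x / |x| into s x and
    collects the power |x|^d.\<close>
  also have "\<dots> = (\<integral>\<^sup>+x. (\<integral>\<^sup>+s. indicator B x * (g (s *\<^sub>R x) * ennreal (norm x powr d * (d * s powr (d - 1))) * indicator {0<..} s) \<partial>lborel) \<partial>block_lborel J)"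
  proof (rule nn_integral_cong)
    fix x :: "real^'n"
    show "(\<integral>\<^sup>+\<rho>. indicator B x * (g (\<rho> *\<^sub>R sgn x) * ennreal (d * \<rho> powr (d - 1)) * indicator {0<..} \<rho>) \<partial>lborel)
      = (\<integral>\<^sup>+s. indicator B x * (g (s *\<^sub>R x) * ennreal (norm x powr d * (d * s powr (d - 1))) * indicator {0<..} s) \<partial>lborel)"
    proof (cases "x \<in> B")
      case True
      then have n: "norm x > 0" by (auto simp: B_def)
      have "(\<integral>\<^sup>+\<rho>. indicator B x * (g (\<rho> *\<^sub>R sgn x) * ennreal (d * \<rho> powr (d - 1)) * indicator {0<..} \<rho>) \<partial>lborel)
        = ennreal (norm x) * (\<integral>\<^sup>+s. indicator B x * (g ((norm x * s) *\<^sub>R sgn x) * ennreal (d * (norm x * s) powr (d - 1)) * indicator {0<..} (norm x * s)) \<partial>lborel)"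
        using n by (subst nn_integral_real_affine[of _ "norm x" 0]) auto
      also have "\<dots> = (\<integral>\<^sup>+s. ennreal (norm x) * (indicator B x * (g ((norm x * s) *\<^sub>R sgn x) * ennreal (d * (norm x * s) powr (d - 1)) * indicator {0<..} (norm x * s))) \<partial>lborel)"
        by (intro nn_integral_cmult[symmetric]) measurable
      also have "\<dots> = (\<integral>\<^sup>+s. indicator B x * (g (s *\<^sub>R x) * ennreal (norm x powr d * (d * s powr (d - 1))) * indicator {0<..} s) \<partial>lborel)"
      proof (rule nn_integral_cong)
        fix s :: real
        have 1: "(norm x * s) *\<^sub>R sgn x = s *\<^sub>R x"
          using n by (simp add: sgn_div_norm)
        show "ennreal (norm x) * (indicator B x * (g ((norm x * s) *\<^sub>R sgn x) * ennreal (d * (norm x * s) powr (d - 1)) * indicator {0<..} (norm x * s)))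
          = indicator B x * (g (s *\<^sub>R x) * ennreal (norm x powr d * (d * s powr (d - 1))) * indicator {0<..} s)"
        proof (cases "0 < s")
          case s: True
          have "norm x * (d * (norm x * s) powr (d - 1)) = norm x powr d * (d * s powr (d - 1))"
            using n s by (simp add: powr_mult powr_diff)
          then have e: "ennreal (norm x) * ennreal (d * (norm x * s) powr (d - 1)) = ennreal (norm x powr d * (d * s powr (d - 1)))"
            using d by (subst ennreal_mult[symmetric]) auto
          have i: "indicator {0<..} (norm x * s) = (indicator {0<..} s :: ennreal)"
            using n s by simp
          show ?thesis
            unfolding 1 i e[symmetric] by (simp only: ac_simps)
        next
          case False
          then show ?thesis using n by (auto simp: indicator_def zero_less_mult_iff)
        qed
      qed
      finally show ?thesis .
    next
      case False
      then show ?thesis by simp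
    qed
  qed
  also have "\<dots> = (\<integral>\<^sup>+s. (\<integral>\<^sup>+x. indicator B x * (g (s *\<^sub>R x) * ennreal (norm x powr d * (d * s powr (d - 1))) * indicator {0<..} s) \<partial>block_lborel J) \<partial>lborel)"
    by (intro P.Fubini') measurable
  \<comment> \<open>Dilation by s for fixed s: the range 0 < |x| <= 1 becomes 0 < |x| <= s. It is
    written as an indicator of \<open>s - norm x\<close>, a composition of measurable maps in s and
    x jointly, as the exchange of integrals requires.\<close>
  also have "\<dots> = (\<integral>\<^sup>+s. (\<integral>\<^sup>+x. g x * indicator (- {0}) x * ennreal (norm x powr d) * (ennreal (d * s powr (- d - 1)) * indicator {0..} (s - norm x)) \<partial>block_lborel J) \<partial>lborel)"
  proof (rule nn_integral_cong)
    fix s :: real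
    show "(\<integral>\<^sup>+x. indicator B x * (g (s *\<^sub>R x) * ennreal (norm x powr d * (d * s powr (d - 1))) * indicator {0<..} s) \<partial>block_lborel J)
      = (\<integral>\<^sup>+x. g x * indicator (- {0}) x * ennreal (norm x powr d) * (ennreal (d * s powr (- d - 1)) * indicator {0..} (s - norm x)) \<partial>block_lborel J)"
    proof (cases "0 < s")
      case s: True
      have "(\<integral>\<^sup>+x. g x * indicator (- {0}) x * ennreal (norm x powr d) * (ennreal (d * s powr (- d - 1)) * indicator {0..} (s - norm x)) \<partial>block_lborel J)
        = ennreal (s ^ card J) * (\<integral>\<^sup>+x. g (s *\<^sub>R x) * indicator (- {0}) (s *\<^sub>R x) * ennreal (norm (s *\<^sub>R x) powr d) * (ennreal (d * s powr (- d - 1)) * indicator {0..} (s - norm (s *\<^sub>R x))) \<partial>block_lborel J)"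
        by (intro nn_integral_block_lborel_scale s) measurable
      also have "\<dots> = (\<integral>\<^sup>+x. ennreal (s ^ card J) * (g (s *\<^sub>R x) * indicator (- {0}) (s *\<^sub>R x) * ennreal (norm (s *\<^sub>R x) powr d) * (ennreal (d * s powr (- d - 1)) * indicator {0..} (s - norm (s *\<^sub>R x)))) \<partial>block_lborel J)"
        by (intro nn_integral_cmult[symmetric]) measurable
      also have "\<dots> = (\<integral>\<^sup>+x. indicator B x * (g (s *\<^sub>R x) * ennreal (norm x powr d * (d * s powr (d - 1))) * indicator {0<..} s) \<partial>block_lborel J)"
      proof (rule nn_integral_cong)
        fix x :: "real^'n"
        have i: "indicator (- {0}) (s *\<^sub>R x) * indicator {0..} (s - norm (s *\<^sub>R x)) = (indicator B x * indicator {0<..} s :: ennreal)"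
        proof -
          have "norm (s *\<^sub>R x) \<le> s \<longleftrightarrow> norm x \<le> 1" "s *\<^sub>R x = 0 \<longleftrightarrow> x = 0"
            using s by simp_all
          then show ?thesis
            using s unfolding indicator_def B_def by auto
        qed
        have "s ^ card J * norm (s *\<^sub>R x) powr d * (d * s powr (- d - 1)) = norm x powr d * (d * s powr (d - 1))"
        proof -
          have 1: "s ^ card J = s powr d" "norm (s *\<^sub>R x) powr d = s powr d * norm x powr d"
            using s by (simp_all add: d_def powr_realpow powr_mult)
          have 2: "s powr (d - 1) = s powr d * s powr d * s powr (- d - 1)"
            by (simp add: powr_add[symmetric])
          show ?thesis
            unfolding 1 2 by (simp only: ac_simps)
        qed
        then have e: "ennreal (s ^ card J) * ennreal (norm (s *\<^sub>R x) powr d) * ennreal (d * s powr (- d - 1)) = ennreal (norm x powr d * (d * s powr (d - 1)))"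
          using d s by (simp add: ennreal_mult[symmetric])
        have "ennreal (s ^ card J) * (g (s *\<^sub>R x) * indicator (- {0}) (s *\<^sub>R x) * ennreal (norm (s *\<^sub>R x) powr d) * (ennreal (d * s powr (- d - 1)) * indicator {0..} (s - norm (s *\<^sub>R x))))
          = (ennreal (s ^ card J) * ennreal (norm (s *\<^sub>R x) powr d) * ennreal (d * s powr (- d - 1))) * g (s *\<^sub>R x) * (indicator (- {0}) (s *\<^sub>R x) * indicator {0..} (s - norm (s *\<^sub>R x)))"
          by (simp only: ac_simps)
        also have "\<dots> = indicator B x * (g (s *\<^sub>R x) * ennreal (norm x powr d * (d * s powr (d - 1))) * indicator {0<..} s)"
          unfolding e i by (simp only: ac_simps)
        finally show "ennreal (s ^ card J) * (g (s *\<^sub>R x) * indicator (- {0}) (s *\<^sub>R x) * ennreal (norm (s *\<^sub>R x) powr d) * (ennreal (d * s powr (- d - 1)) * indicator {0..} (s - norm (s *\<^sub>R x))))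
          = indicator B x * (g (s *\<^sub>R x) * ennreal (norm x powr d * (d * s powr (d - 1))) * indicator {0<..} s)" .
      qed
      finally show ?thesis by simp
    next
      case False
      then have "indicator (- {0}) x * (indicator {0..} (s - norm x) :: ennreal) = 0" for x :: "real^'n"
      proof (cases "x = 0")
        case False
        then have "0 < norm x"
          by simp
        with \<open>\<not> 0 < s\<close> have "\<not> norm x \<le> s"
          by linarith
        then show ?thesis by simp
      qed simp
      then have z: "g x * indicator (- {0}) x * ennreal (norm x powr d) * (ennreal (d * s powr (- d - 1)) * indicator {0..} (s - norm x)) = 0" for x
        unfolding mult_eq_0_iff by blast
      show ?thesis unfolding z using False by simp
    qed
  qed
  also have "\<dots> = (\<integral>\<^sup>+x. (\<integral>\<^sup>+s. g x * indicator (- {0}) x * ennreal (norm x powr d) * (ennreal (d * s powr (- d - 1)) * indicator {0..} (s - norm x)) \<partial>lborel) \<partial>block_lborel J)"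
    by (intro P.Fubini'[symmetric]) measurable
  also have "\<dots> = (\<integral>\<^sup>+x. g x \<partial>block_lborel J)"
  proof (intro nn_integral_cong_AE)
    \<comment> \<open>Some coordinate in J is nonzero almost everywhere, so the cut-off at the
      origin changes nothing.\<close>
    obtain j where "j \<in> J" using assms(1) by auto
    from AE_block_lborel_component_nonzero[OF this]
    show "AE x in block_lborel J. (\<integral>\<^sup>+s. g x * indicator (- {0}) x * ennreal (norm x powr d) * (ennreal (d * s powr (- d - 1)) * indicator {0..} (s - norm x)) \<partial>lborel) = g x"
    proof eventually_elim
      case (elim x)
      then have n: "x \<noteq> 0" "0 < norm x" by auto
      have cut: "indicator {0..} (s - norm x) = (indicator {norm x..} s :: ennreal)" for s
        by (auto simp: indicator_def)
      have "(\<integral>\<^sup>+s. g x * indicator (- {0}) x * ennreal (norm x powr d) * (ennreal (d * s powr (- d - 1)) * indicator {0..} (s - norm x)) \<partial>lborel)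
        = g x * indicator (- {0}) x * ennreal (norm x powr d) * (\<integral>\<^sup>+s. ennreal (d * s powr (- d - 1)) * indicator {0..} (s - norm x) \<partial>lborel)"
        by (intro nn_integral_cmult) measurable
      also have "\<dots> = g x * (ennreal (norm x powr d) * ennreal (norm x powr - d))"
        unfolding cut using n d by (simp add: nn_integral_powr_tail mult.assoc)
      also have "\<dots> = g x"
        using n by (simp add: ennreal_mult[symmetric] powr_add[symmetric])
      finally show ?case .
    qed
  qed
  finally show ?thesis by (simp add: d_def)
qed

section \<open>The Dunkl weight, and polar coordinates with weight\<close>

lemma abs_powr_measurable [measurable]: "(\<lambda>x. abs_powr x a) \<in> borel_measurable borel"
  unfolding abs_powr_def by (cases "a = 0") auto

lemma dunkl_weight_measurable [measurable]: "dunkl_weight k J \<in> borel_measurable borel"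
proof -
  have "(\<lambda>x. \<Prod>j\<in>J. abs_powr (x $ j) (2 * k $ j)) \<in> borel_measurable borel"
    by measurable
  then show ?thesis unfolding dunkl_weight_def[abs_def] .
qed

lemma abs_powr_nonneg: "0 \<le> abs_powr x a"
  by (simp add: abs_powr_def)

lemma dunkl_weight_nonneg: "0 \<le> dunkl_weight k J x"
  by (simp add: dunkl_weight_def prod_nonneg abs_powr_nonneg)

lemma dunkl_weight_Un:
  "A \<inter> B = {} \<Longrightarrow> dunkl_weight k (A \<union> B) x = dunkl_weight k A x * dunkl_weight k B x"
  by (simp add: dunkl_weight_def prod.union_disjoint)

lemma dunkl_weight_cong:
  "(\<And>j. j \<in> J \<Longrightarrow> x $ j = y $ j) \<Longrightarrow> dunkl_weight k J x = dunkl_weight k J y"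
  by (simp add: dunkl_weight_def)

lemma dunkl_weight_scale:
  assumes "0 < c"
  shows "dunkl_weight k J (c *\<^sub>R x) = c powr (2 * (\<Sum>j\<in>J. k $ j)) * dunkl_weight k J x"
proof -
  have "abs_powr (c * t) a = c powr a * abs_powr t a" for t a
    using assms by (auto simp: abs_powr_def abs_mult powr_mult)
  then have "dunkl_weight k J (c *\<^sub>R x) = (\<Prod>j\<in>J. c powr (2 * k $ j)) * dunkl_weight k J x"
    by (simp add: dunkl_weight_def prod.distrib)
  also have "(\<Prod>j\<in>J. c powr (2 * k $ j)) = c powr (2 * (\<Sum>j\<in>J. k $ j))"
    using assms by (simp add: powr_sum sum_distrib_left)
  finally show ?thesis .
qed

lemma dunkl_weight_le_1:
  assumes "\<And>j. k $ j \<ge> 0" "norm x \<le> 1"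
  shows "dunkl_weight k J x \<le> 1"
proof -
  have "\<bar>x $ j\<bar> \<le> 1" for j
    using assms(2) component_le_norm_cart[of x j] by linarith
  then have "abs_powr (x $ j) (2 * k $ j) \<le> 1" for j
    using assms(1)[of j] powr_mono2[of "2 * k $ j" "\<bar>x $ j\<bar>" 1] by (auto simp: abs_powr_def)
  then show ?thesis
    unfolding dunkl_weight_def by (intro prod_le_1) (auto simp: abs_powr_nonneg)
qed

lemma dunkl_weight_pos:
  "(\<And>j. j \<in> J \<Longrightarrow> x $ j \<noteq> 0) \<Longrightarrow> 0 < dunkl_weight k J x"
  unfolding dunkl_weight_def by (intro prod_pos) (auto simp: abs_powr_def)

lemma sets_dunkl_sphere_measure [simp, measurable_cong]: "sets (dunkl_sphere_measure k J) = sets borel"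
  and space_dunkl_sphere_measure [simp]: "space (dunkl_sphere_measure k J) = UNIV"
  by (simp_all add: dunkl_sphere_measure_def)

lemma nn_integral_dunkl_sphere_measure:
  assumes [measurable]: "g \<in> borel_measurable borel"
  shows "(\<integral>\<^sup>+\<omega>. g \<omega> \<partial>dunkl_sphere_measure k J)
    = (\<integral>\<^sup>+\<omega>. ennreal (dunkl_weight k J \<omega>) * g \<omega> \<partial>sphere_measure J)"
  unfolding dunkl_sphere_measure_def by (intro nn_integral_density) measurable

text \<open>The weight is at most 1 on unit vectors because its exponents are nonnegative, and the
  cone over the sphere lies in a ball of finite measure.\<close>

lemma finite_dunkl_sphere_measure:
  fixes J :: "'n::finite set"
  assumes "\<And>j. k $ j \<ge> 0"
  shows "finite_measure (dunkl_sphere_measure k J)"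
proof
  have "emeasure (dunkl_sphere_measure k J) UNIV = (\<integral>\<^sup>+\<omega>. 1 \<partial>dunkl_sphere_measure k J)"
    by simp
  also have "\<dots> = of_nat (card J) * (\<integral>\<^sup>+x. indicator (cball 0 1 - {0}) x * (ennreal (dunkl_weight k J (sgn x))) \<partial>block_lborel J)"
    by (subst nn_integral_dunkl_sphere_measure, simp, subst nn_integral_sphere_measure) auto
  also have "\<dots> \<le> of_nat (card J) * (\<integral>\<^sup>+x. indicator (cball 0 1) x \<partial>block_lborel J)"
    using assms
    by (intro mult_left_mono nn_integral_mono)
       (auto simp: indicator_def norm_sgn intro!: dunkl_weight_le_1)
  also have "\<dots> < \<infinity>"
    using emeasure_block_lborel_cball[of J 1] by (simp add: ennreal_mult_less_top of_nat_less_top)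
  finally show "emeasure (dunkl_sphere_measure k J) (space (dunkl_sphere_measure k J)) \<noteq> \<infinity>"
    by simp
qed

text \<open>The sphere measure is encoded as a measure on the whole of \<real>^n; this recovers the
  set that carries it.\<close>

lemma AE_dunkl_sphere_measure:
  fixes J :: "'n::finite set"
  shows "AE \<omega> in dunkl_sphere_measure k J. norm \<omega> = 1 \<and> (\<forall>j. j \<notin> J \<longrightarrow> \<omega> $ j = 0)"
proof -
  define P where "P \<omega> \<longleftrightarrow> norm \<omega> = 1 \<and> (\<forall>j. j \<notin> J \<longrightarrow> \<omega> $ j = 0)" for \<omega> :: "real^'n"
  have [measurable]: "Measurable.pred borel P"
    unfolding P_def[abs_def] by measurable
  define B where "B = cball 0 1 - {0 :: real^'n}"
  have [measurable]: "B \<in> sets borel"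
    unfolding B_def by (intro sets.Diff) auto
  have "AE x in block_lborel J. indicator B x * indicator {\<omega>. \<not> P \<omega>} (sgn x) = (0::ennreal)"
    using AE_block_lborel_support[of J] by eventually_elim (auto simp: B_def P_def indicator_def norm_sgn sgn_div_norm)
  then have "(\<integral>\<^sup>+\<omega>. indicator {\<omega>. \<not> P \<omega>} \<omega> \<partial>sphere_measure J) = 0"
    unfolding B_def[symmetric]
    by (subst nn_integral_sphere_measure, simp, fold B_def, subst (asm) nn_integral_0_iff_AE[symmetric]) auto
  then have "AE \<omega> in sphere_measure J. P \<omega>"
    by (subst (asm) nn_integral_0_iff_AE) (auto simp: indicator_def split: if_splits)
  then show ?thesis
    unfolding dunkl_sphere_measure_def P_def by (subst AE_density) auto
qed

text \<open>Absorbs the radial weight and the restriction to positive radii of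
  \<open>rad_ang_norm\<close> into a sigma-finite measure, so that both the angular and the radial
  norm are instances of \<open>lp\<close>.\<close>

definition radial_measure :: "real ^ 'n \<Rightarrow> 'n set \<Rightarrow> real measure" where
  "radial_measure k J = density lborel (\<lambda>\<rho>. ennreal (\<rho> powr (hom_dim k J - 1)) * indicator {0<..} \<rho>)"

lemma sets_radial_measure [simp, measurable_cong]: "sets (radial_measure k J) = sets borel"
  and space_radial_measure [simp]: "space (radial_measure k J) = UNIV"
  by (simp_all add: radial_measure_def)

lemma nn_integral_radial_measure:
  assumes [measurable]: "g \<in> borel_measurable borel"
  shows "(\<integral>\<^sup>+\<rho>. g \<rho> \<partial>radial_measure k J) = (\<integral>\<^sup>+\<rho>\<in>{0<..}. g \<rho> * ennreal (\<rho> powr (hom_dim k J - 1)) \<partial>lborel)"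
  unfolding radial_measure_def by (subst nn_integral_density) (auto simp: ac_simps)

lemma AE_radial_measure: "AE \<rho> in radial_measure k J. 0 < \<rho>"
  unfolding radial_measure_def by (subst AE_density) (auto simp: indicator_def split: if_splits)

lemma sigma_finite_radial_measure: "sigma_finite_measure (radial_measure k J)"
  unfolding radial_measure_def
  by (subst sigma_finite_measure.sigma_finite_iff_density_finite)
     (auto intro: sigma_finite_lborel simp: indicator_def split: if_splits)

lemma nn_integral_radial_measure_scale:
  assumes "0 < c" and [measurable]: "g \<in> borel_measurable borel"
  shows "(\<integral>\<^sup>+\<rho>. g (c * \<rho>) \<partial>radial_measure k J)
    = ennreal (c powr - hom_dim k J) * (\<integral>\<^sup>+\<rho>. g \<rho> \<partial>radial_measure k J)"
proof -
  define N where "N = hom_dim k J"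
  have "(\<integral>\<^sup>+\<rho>. g \<rho> \<partial>radial_measure k J)
      = ennreal c * (\<integral>\<^sup>+\<rho>. g (c * \<rho>) * ennreal ((c * \<rho>) powr (N - 1)) * indicator {0<..} (c * \<rho>) \<partial>lborel)"
    using assms(1) by (subst nn_integral_radial_measure, simp, subst nn_integral_real_affine[of _ c 0]) (auto simp: N_def)
  also have "\<dots> = (\<integral>\<^sup>+\<rho>. ennreal c * (g (c * \<rho>) * ennreal ((c * \<rho>) powr (N - 1)) * indicator {0<..} (c * \<rho>)) \<partial>lborel)"
    by (intro nn_integral_cmult[symmetric]) measurable
  also have "\<dots> = (\<integral>\<^sup>+\<rho>. ennreal (c powr N) * (g (c * \<rho>) * ennreal (\<rho> powr (N - 1)) * indicator {0<..} \<rho>) \<partial>lborel)"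
  proof (rule nn_integral_cong)
    fix \<rho> :: real
    show "ennreal c * (g (c * \<rho>) * ennreal ((c * \<rho>) powr (N - 1)) * indicator {0<..} (c * \<rho>))
      = ennreal (c powr N) * (g (c * \<rho>) * ennreal (\<rho> powr (N - 1)) * indicator {0<..} \<rho>)"
    proof (cases "0 < \<rho>")
      case True
      have "c * (c * \<rho>) powr (N - 1) = c powr N * \<rho> powr (N - 1)"
        using assms(1) True by (simp add: powr_mult powr_diff)
      then have e: "ennreal c * ennreal ((c * \<rho>) powr (N - 1)) = ennreal (c powr N) * ennreal (\<rho> powr (N - 1))"
        using assms(1) by (simp add: ennreal_mult[symmetric])
      have i: "indicator {0<..} (c * \<rho>) = (indicator {0<..} \<rho> :: ennreal)"
        using assms(1) True by simp
      have "ennreal c * (g (c * \<rho>) * ennreal ((c * \<rho>) powr (N - 1)) * indicator {0<..} (c * \<rho>))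
        = (ennreal c * ennreal ((c * \<rho>) powr (N - 1))) * (g (c * \<rho>) * indicator {0<..} (c * \<rho>))"
        by (simp only: ac_simps)
      then show ?thesis
        unfolding e i by (simp only: ac_simps)
    qed (use assms(1) in \<open>auto simp: indicator_def zero_less_mult_iff\<close>)
  qed
  also have "\<dots> = ennreal (c powr N) * (\<integral>\<^sup>+\<rho>. g (c * \<rho>) * ennreal (\<rho> powr (N - 1)) * indicator {0<..} \<rho> \<partial>lborel)"
    by (intro nn_integral_cmult) measurable
  also have "\<dots> = ennreal (c powr N) * (\<integral>\<^sup>+\<rho>. g (c * \<rho>) \<partial>radial_measure k J)"
    by (subst nn_integral_radial_measure) (auto simp: N_def)
  finally have "ennreal (c powr - N) * (\<integral>\<^sup>+\<rho>. g \<rho> \<partial>radial_measure k J)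
      = ennreal (c powr - N) * ennreal (c powr N) * (\<integral>\<^sup>+\<rho>. g (c * \<rho>) \<partial>radial_measure k J)"
    by (simp add: mult.assoc)
  also have "ennreal (c powr - N) * ennreal (c powr N) = 1"
    using assms(1) by (simp add: ennreal_mult[symmetric] powr_add[symmetric])
  finally show ?thesis by (simp add: N_def)
qed

text \<open>The weight is homogeneous of degree twice the sum of k over J, which moves the radial
  power from card J - 1 to the homogeneous dimension minus 1.\<close>

lemma nn_integral_dunkl_polar:
  fixes J :: "'n::finite set"
  assumes "J \<noteq> {}" and [measurable]: "g \<in> borel_measurable borel"
  shows "(\<integral>\<^sup>+x. ennreal (dunkl_weight k J x) * g x \<partial>block_lborel J)
    = (\<integral>\<^sup>+\<rho>. (\<integral>\<^sup>+\<omega>. g (\<rho> *\<^sub>R \<omega>) \<partial>dunkl_sphere_measure k J) \<partial>radial_measure k J)"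
proof -
  \<comment> \<open>The unweighted surface measure is the Dunkl one for k = 0, whose finiteness is
    already known.\<close>
  interpret S: sigma_finite_measure "sphere_measure J :: (real^'n) measure"
  proof -
    have "finite_measure (dunkl_sphere_measure 0 J :: (real^'n) measure)"
      by (rule finite_dunkl_sphere_measure) simp
    moreover have "dunkl_sphere_measure 0 J = (sphere_measure J :: (real^'n) measure)"
      by (simp add: dunkl_sphere_measure_def dunkl_weight_def abs_powr_def density_1)
    ultimately show "sigma_finite_measure (sphere_measure J :: (real^'n) measure)"
      by (simp add: finite_measure.axioms(1))
  qed
  have "(\<integral>\<^sup>+x. ennreal (dunkl_weight k J x) * g x \<partial>block_lborel J)
      = (\<integral>\<^sup>+\<rho>\<in>{0<..}. (\<integral>\<^sup>+\<omega>. ennreal (dunkl_weight k J (\<rho> *\<^sub>R \<omega>)) * g (\<rho> *\<^sub>R \<omega>) \<partial>sphere_measure J) * ennreal (\<rho> powr (real (card J) - 1)) \<partial>lborel)"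
    by (intro nn_integral_polar assms(1)) measurable
  also have "\<dots> = (\<integral>\<^sup>+\<rho>\<in>{0<..}. (\<integral>\<^sup>+\<omega>. ennreal (dunkl_weight k J \<omega>) * g (\<rho> *\<^sub>R \<omega>) \<partial>sphere_measure J) * ennreal (\<rho> powr (hom_dim k J - 1)) \<partial>lborel)"
  proof (intro set_nn_integral_cong refl)
    fix \<rho> :: real assume "\<rho> \<in> space lborel \<inter> {0<..}"
    then have \<rho>: "0 < \<rho>" by simp
    define K where "K = 2 * (\<Sum>j\<in>J. k $ j)"
    have "(\<integral>\<^sup>+\<omega>. ennreal (dunkl_weight k J (\<rho> *\<^sub>R \<omega>)) * g (\<rho> *\<^sub>R \<omega>) \<partial>sphere_measure J)
      = (\<integral>\<^sup>+\<omega>. ennreal (\<rho> powr K) * (ennreal (dunkl_weight k J \<omega>) * g (\<rho> *\<^sub>R \<omega>)) \<partial>sphere_measure J)"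
      using \<rho> by (simp add: dunkl_weight_scale ennreal_mult dunkl_weight_nonneg K_def mult.assoc)
    also have "\<dots> = ennreal (\<rho> powr K) * (\<integral>\<^sup>+\<omega>. ennreal (dunkl_weight k J \<omega>) * g (\<rho> *\<^sub>R \<omega>) \<partial>sphere_measure J)"
      by (intro nn_integral_cmult) measurable
    finally have "(\<integral>\<^sup>+\<omega>. ennreal (dunkl_weight k J (\<rho> *\<^sub>R \<omega>)) * g (\<rho> *\<^sub>R \<omega>) \<partial>sphere_measure J) * ennreal (\<rho> powr (real (card J) - 1))
      = (\<integral>\<^sup>+\<omega>. ennreal (dunkl_weight k J \<omega>) * g (\<rho> *\<^sub>R \<omega>) \<partial>sphere_measure J) * (ennreal (\<rho> powr K) * ennreal (\<rho> powr (real (card J) - 1)))"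
      by (simp add: ac_simps)
    also have "ennreal (\<rho> powr K) * ennreal (\<rho> powr (real (card J) - 1)) = ennreal (\<rho> powr (hom_dim k J - 1))"
      by (simp add: ennreal_mult[symmetric] powr_add[symmetric] K_def hom_dim_def algebra_simps)
    finally show "(\<integral>\<^sup>+\<omega>. ennreal (dunkl_weight k J (\<rho> *\<^sub>R \<omega>)) * g (\<rho> *\<^sub>R \<omega>) \<partial>sphere_measure J) * ennreal (\<rho> powr (real (card J) - 1))
      = (\<integral>\<^sup>+\<omega>. ennreal (dunkl_weight k J \<omega>) * g (\<rho> *\<^sub>R \<omega>) \<partial>sphere_measure J) * ennreal (\<rho> powr (hom_dim k J - 1))" .
  qed
  also have "\<dots> = (\<integral>\<^sup>+\<rho>. (\<integral>\<^sup>+\<omega>. ennreal (dunkl_weight k J \<omega>) * g (\<rho> *\<^sub>R \<omega>) \<partial>sphere_measure J) \<partial>radial_measure k J)"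
    by (intro nn_integral_radial_measure[symmetric]) measurable
  also have "\<dots> = (\<integral>\<^sup>+\<rho>. (\<integral>\<^sup>+\<omega>. g (\<rho> *\<^sub>R \<omega>) \<partial>dunkl_sphere_measure k J) \<partial>radial_measure k J)"
    by (intro nn_integral_cong nn_integral_dunkl_sphere_measure[symmetric]) measurable
  finally show ?thesis .
qed

section \<open>Iterated norms\<close>

text \<open>\<open>iter_norm\<close> for functions with values in \<open>[0, \<infinity>]\<close>; the integral in Minkowski's inequality is one.\<close>

primrec inorm ::
    "('n \<Rightarrow> nat) \<Rightarrow> real ^ 'n \<Rightarrow> (nat \<Rightarrow> real) \<Rightarrow> (nat \<Rightarrow> real) \<Rightarrow> (real ^ 'n \<Rightarrow> ennreal)
      \<Rightarrow> nat \<Rightarrow> real ^ 'n \<Rightarrow> ennreal" where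
  "inorm blk k u w g 0 y = g y"
| "inorm blk k u w g (Suc i) y =
     rad_ang_norm k (block blk (Suc i)) (u (Suc i)) (w (Suc i)) (\<lambda>x. inorm blk k u w g i (x + y))"

lemma iter_norm_eq_inorm: "iter_norm blk k u w f i y = inorm blk k u w (\<lambda>x. ennreal (norm (f x))) i y"
  by (induction i arbitrary: y) simp_all

lemma measurable_indicator_ball [simp, measurable]:
  "(indicator (ball c R) :: 'a::metric_space \<Rightarrow> ennreal) \<in> borel_measurable borel"
  by (intro borel_measurable_indicator) simp

locale dunkl_blocks =
  fixes blk :: "'n::finite \<Rightarrow> nat" and m :: nat and k :: "real ^ 'n"
  assumes range_blk: "range blk = {1..m}" and k_nonneg: "\<And>j. k $ j \<ge> 0"
begin

abbreviation "radm i \<equiv> radial_measure k (block blk i)"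
abbreviation "sphm i \<equiv> dunkl_sphere_measure k (block blk i)"
abbreviation "N i \<equiv> hom_dim k (block blk i)"

definition "pos_exp u \<longleftrightarrow> (\<forall>i\<in>{1..m}. 0 < (u i :: real))"

lemma pos_expD: "pos_exp u \<Longrightarrow> Suc i \<le> m \<Longrightarrow> 0 < u (Suc i)"
  by (simp add: pos_exp_def)

lemma block_nonempty: "i \<in> {1..m} \<Longrightarrow> block blk i \<noteq> {}"
  using range_blk unfolding block_def by (metis (mono_tags, lifting) empty_Collect_eq image_iff)

lemma sigma_finite_radm: "sigma_finite_measure (radm i)"
  by (rule sigma_finite_radial_measure)

lemma finite_sphm: "finite_measure (sphm i)"
  by (intro finite_dunkl_sphere_measure k_nonneg)

lemma sigma_finite_sphm: "sigma_finite_measure (sphm i)"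
  using finite_sphm by (rule finite_measure.axioms(1))

lemmas measurable_lp_radm = measurable_lp[OF sigma_finite_radm]
  and measurable_lp_sphm = measurable_lp[OF sigma_finite_sphm]

lemma rad_ang_norm_eq_lp:
  assumes [measurable]: "g \<in> borel_measurable borel" and "0 < w"
  shows "rad_ang_norm k (block blk i) u w g
    = lp (radm i) u (\<lambda>\<rho>. lp (sphm i) w (\<lambda>\<omega>. g (\<rho> *\<^sub>R \<omega>)))"
proof -
  note [measurable] = measurable_lp_sphm
  have eq: "ennpowr (lp (sphm i) w (\<lambda>\<omega>. g (\<rho> *\<^sub>R \<omega>))) u
      = ennpowr (\<integral>\<^sup>+\<omega>. ennpowr (g (\<rho> *\<^sub>R \<omega>)) w \<partial>sphm i) (u / w)" for \<rho>
    by (simp add: lp_def ennpowr_powr)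
  have meas: "(\<lambda>\<rho>. lp (sphm i) w (\<lambda>\<omega>. g (\<rho> *\<^sub>R \<omega>))) \<in> borel_measurable borel"
    by measurable
  have "(\<integral>\<^sup>+\<rho>. ennpowr (lp (sphm i) w (\<lambda>\<omega>. g (\<rho> *\<^sub>R \<omega>))) u \<partial>radm i)
      = (\<integral>\<^sup>+\<rho>\<in>{0<..}. ennpowr (lp (sphm i) w (\<lambda>\<omega>. g (\<rho> *\<^sub>R \<omega>))) u * ennreal (\<rho> powr (N i - 1)) \<partial>lborel)"
    by (intro nn_integral_radial_measure measurable_ennpowr meas)
  then show ?thesis
    unfolding rad_ang_norm_def by (subst lp_def) (simp add: eq)
qed

text \<open>Minkowski's inequality carries an integral over t through every norm, so each partial
  norm has to be measurable jointly in t and in the variables that are still free. The induction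
  treats the two as one pair.\<close>

lemma inorm_measurable_param:
  assumes meas: "case_prod g \<in> borel_measurable (borel \<Otimes>\<^sub>M T)"
    and "pos_exp w" "i \<le> m"
  shows "(\<lambda>(y, t). inorm blk k u w (\<lambda>x. g x t) i y) \<in> borel_measurable (borel \<Otimes>\<^sub>M T)"
  using assms(3)
proof (induction i)
  case 0
  then show ?case using meas by simp
next
  case (Suc i)
  define h where "h z = inorm blk k u w (\<lambda>x. g x (snd z)) i (fst z)" for z
  have h [measurable]: "h \<in> borel_measurable (borel \<Otimes>\<^sub>M T)"
    using Suc by (simp add: h_def[abs_def] case_prod_beta')
  have sec: "(\<lambda>y. h (y, t)) \<in> borel_measurable borel" if [measurable]: "t \<in> space T" for t
    by measurable
  note [measurable] = measurable_lp_sphm measurable_lp_radm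
  have "(\<lambda>z. lp (radm (Suc i)) (u (Suc i)) (\<lambda>\<rho>. lp (sphm (Suc i)) (w (Suc i)) (\<lambda>\<omega>. h (\<rho> *\<^sub>R \<omega> + fst z, snd z))))
      \<in> borel_measurable (borel \<Otimes>\<^sub>M T)"
    by measurable
  moreover have "inorm blk k u w (\<lambda>x. g x (snd z)) (Suc i) (fst z)
      = lp (radm (Suc i)) (u (Suc i)) (\<lambda>\<rho>. lp (sphm (Suc i)) (w (Suc i)) (\<lambda>\<omega>. h (\<rho> *\<^sub>R \<omega> + fst z, snd z)))"
    if "z \<in> space (borel \<Otimes>\<^sub>M T)" for z
  proof -
    have t: "snd z \<in> space T"
      using that by (auto simp: space_pair_measure)
    note [measurable] = sec[OF t]
    have "inorm blk k u w (\<lambda>x. g x (snd z)) (Suc i) (fst z)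
      = rad_ang_norm k (block blk (Suc i)) (u (Suc i)) (w (Suc i)) (\<lambda>x. h (x + fst z, snd z))"
      by (simp add: h_def)
    also have "\<dots> = lp (radm (Suc i)) (u (Suc i)) (\<lambda>\<rho>. lp (sphm (Suc i)) (w (Suc i)) (\<lambda>\<omega>. h (\<rho> *\<^sub>R \<omega> + fst z, snd z)))"
      using Suc.prems assms(2)
      by (intro rad_ang_norm_eq_lp measurable_compose[OF _ sec[OF t]]) (auto intro: pos_expD)
    finally show ?thesis .
  qed
  ultimately show ?case
    by (subst case_prod_beta', subst measurable_cong) auto
qed

lemma inorm_measurable:
  assumes [measurable]: "g \<in> borel_measurable borel" and "pos_exp w" "i \<le> m"
  shows "inorm blk k u w g i \<in> borel_measurable borel"
proof -
  \<comment> \<open>A one-point parameter space reduces the claim to the parametrised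
    version.\<close>
  have "(\<lambda>(y, t). inorm blk k u w (\<lambda>x. g x) i y) \<in> borel_measurable (borel \<Otimes>\<^sub>M count_space {()})"
    using assms(2,3) by (intro inorm_measurable_param[where g="\<lambda>x t. g x"]) measurable
  then have "(\<lambda>y. (\<lambda>(y, t). inorm blk k u w (\<lambda>x. g x) i y) (y, ())) \<in> borel_measurable borel"
    by (rule measurable_compose[rotated]) measurable
  then show ?thesis by simp
qed

lemma inorm_Suc:
  assumes "g \<in> borel_measurable borel" and "pos_exp w" "Suc i \<le> m"
  shows "inorm blk k u w g (Suc i) y
    = lp (radm (Suc i)) (u (Suc i)) (\<lambda>\<rho>. lp (sphm (Suc i)) (w (Suc i)) (\<lambda>\<omega>. inorm blk k u w g i (\<rho> *\<^sub>R \<omega> + y)))"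
proof -
  note [measurable] = inorm_measurable[OF assms(1,2), of i]
  show ?thesis
    using assms by (simp, intro rad_ang_norm_eq_lp) (auto intro: pos_expD)
qed

lemma inorm_1_Suc:
  assumes "g \<in> borel_measurable borel" "Suc i \<le> m"
  shows "inorm blk k (\<lambda>_. 1) (\<lambda>_. 1) g (Suc i) y
    = (\<integral>\<^sup>+\<rho>. (\<integral>\<^sup>+\<omega>. inorm blk k (\<lambda>_. 1) (\<lambda>_. 1) g i (\<rho> *\<^sub>R \<omega> + y) \<partial>sphm (Suc i)) \<partial>radm (Suc i))"
  using assms by (subst inorm_Suc) (auto simp: pos_exp_def)

text \<open>With exponents 1 each stage is plain integration over one block in polar coordinates, so
  Tonelli reassembles the Dunkl integral over the blocks treated so far. All facts about
  \<open>dunkl_measure\<close> on balls are obtained through this identity.\<close>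

lemma inorm_1_eq_integral:
  assumes [measurable]: "g \<in> borel_measurable borel" and "i \<le> m"
  shows "inorm blk k (\<lambda>_. 1) (\<lambda>_. 1) g i y
    = (\<integral>\<^sup>+x. ennreal (dunkl_weight k (blk -` {1..i}) x) * g (x + y) \<partial>block_lborel (blk -` {1..i}))"
  using assms(2)
proof (induction i arbitrary: y)
  case 0
  then show ?case
    by (simp add: nn_integral_block_lborel_empty) (simp add: dunkl_weight_def)
next
  case (Suc i)
  define A where "A = blk -` {1..i}"
  define B where "B = block blk (Suc i)"
  have AB: "blk -` {1..Suc i} = B \<union> A" "B \<inter> A = {}"
    by (auto simp: A_def B_def block_def)
  define h where "h z = inorm blk k (\<lambda>_. 1) (\<lambda>_. 1) g i z" for z
  have [measurable]: "h \<in> borel_measurable borel"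
    using inorm_measurable[of g "\<lambda>_. 1" i "\<lambda>_. 1"] Suc.prems by (simp add: h_def[abs_def] pos_exp_def)
  have "inorm blk k (\<lambda>_. 1) (\<lambda>_. 1) g (Suc i) y
      = (\<integral>\<^sup>+\<rho>. (\<integral>\<^sup>+\<omega>. h (\<rho> *\<^sub>R \<omega> + y) \<partial>sphm (Suc i)) \<partial>radm (Suc i))"
    using Suc.prems by (subst inorm_1_Suc) (auto simp: h_def)
  also have "\<dots> = (\<integral>\<^sup>+x. ennreal (dunkl_weight k B x) * h (x + y) \<partial>block_lborel B)"
    unfolding B_def using Suc.prems
    by (intro nn_integral_dunkl_polar[symmetric, where g="\<lambda>x. h (x + y)"] block_nonempty) auto
  also have "\<dots> = (\<integral>\<^sup>+x. ennreal (dunkl_weight k B x) * (\<integral>\<^sup>+x'. ennreal (dunkl_weight k A x') * g (x' + (x + y)) \<partial>block_lborel A) \<partial>block_lborel B)"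
    using Suc by (simp add: h_def A_def)
  also have "\<dots> = (\<integral>\<^sup>+x. (\<integral>\<^sup>+x'. ennreal (dunkl_weight k B x) * (ennreal (dunkl_weight k A x') * g (x' + (x + y))) \<partial>block_lborel A) \<partial>block_lborel B)"
    by (intro nn_integral_cong nn_integral_cmult[symmetric]) measurable
  also have "\<dots> = (\<integral>\<^sup>+x. (\<integral>\<^sup>+x'. ennreal (dunkl_weight k (B \<union> A) (x + x')) * g ((x + x') + y) \<partial>block_lborel A) \<partial>block_lborel B)"
  \<comment> \<open>Almost every x is supported on B and almost every x' on A; for such vectors the
    weight at x + x' is the product of the two block weights.\<close>
  proof (rule nn_integral_cong_AE)
    show "AE x in block_lborel B.
        (\<integral>\<^sup>+x'. ennreal (dunkl_weight k B x) * (ennreal (dunkl_weight k A x') * g (x' + (x + y))) \<partial>block_lborel A)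
      = (\<integral>\<^sup>+x'. ennreal (dunkl_weight k (B \<union> A) (x + x')) * g ((x + x') + y) \<partial>block_lborel A)"
      using AE_block_lborel_support[of B]
    proof eventually_elim
      case (elim x)
      show ?case
      proof (rule nn_integral_cong_AE)
        show "AE x' in block_lborel A. ennreal (dunkl_weight k B x) * (ennreal (dunkl_weight k A x') * g (x' + (x + y)))
          = ennreal (dunkl_weight k (B \<union> A) (x + x')) * g ((x + x') + y)"
          using AE_block_lborel_support[of A]
        proof eventually_elim
          case (elim x')
          have "dunkl_weight k B (x + x') = dunkl_weight k B x" "dunkl_weight k A (x + x') = dunkl_weight k A x'"
            using elim \<open>\<forall>j. j \<notin> B \<longrightarrow> x $ j = 0\<close> AB(2) by (auto intro!: dunkl_weight_cong)
          then have "dunkl_weight k (B \<union> A) (x + x') = dunkl_weight k B x * dunkl_weight k A x'"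
            using AB(2) by (simp add: dunkl_weight_Un)
          then show ?case
            by (simp add: ennreal_mult dunkl_weight_nonneg ac_simps)
        qed
      qed
    qed
  qed
  also have "\<dots> = (\<integral>\<^sup>+x. ennreal (dunkl_weight k (B \<union> A) x) * g (x + y) \<partial>block_lborel (B \<union> A))"
    by (intro nn_integral_block_lborel_Un[symmetric, where g="\<lambda>x. ennreal (dunkl_weight k (B \<union> A) x) * g (x + y)"] AB(2)) measurable
  finally show ?case unfolding AB(1) .
qed

text \<open>This carries null sets through the iteration. A vanishing iterated L^1 norm of the
  indicator of M at one stage vanishes one stage lower for almost every \<rho> and \<omega>, so the
  comparison can descend to points outside M. Only monotonicity of \<open>nn_integral\<close>
  enters, hence g and h may be arbitrary functions, for instance Lebesgue measurable ones. That is
  why \<open>rad_ang_norm\<close> is unfolded directly instead of being rewritten with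
  \<open>lp\<close>.\<close>

lemma inorm_mono_off:
  assumes M [measurable]: "M \<in> sets borel" and le: "\<And>x. x \<notin> M \<Longrightarrow> g x \<le> h x"
    and "pos_exp u" "pos_exp w" "i \<le> m"
    and "inorm blk k (\<lambda>_. 1) (\<lambda>_. 1) (indicator M) i y = 0"
  shows "inorm blk k u w g i y \<le> inorm blk k u w h i y"
  using assms(5,6)
proof (induction i arbitrary: y)
  case 0
  then show ?case using le by (auto simp: indicator_def split: if_splits)
next
  case (Suc i)
  define D where "D z = inorm blk k (\<lambda>_. 1) (\<lambda>_. 1) (indicator M) i z" for z
  have [measurable]: "D \<in> borel_measurable borel"
    using inorm_measurable[of "indicator M" "\<lambda>_. 1" i "\<lambda>_. 1"] Suc.prems by (simp add: D_def[abs_def] pos_exp_def)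
  interpret S: finite_measure "sphm (Suc i)" by (rule finite_sphm)
  let ?J = "block blk (Suc i)"
  have "(\<integral>\<^sup>+\<rho>. (\<integral>\<^sup>+\<omega>. D (\<rho> *\<^sub>R \<omega> + y) \<partial>sphm (Suc i)) \<partial>radm (Suc i)) = 0"
    using Suc.prems by (subst (asm) inorm_1_Suc) (auto simp: D_def)
  then have "AE \<rho> in radm (Suc i). AE \<omega> in sphm (Suc i). D (\<rho> *\<^sub>R \<omega> + y) = 0"
    by (subst (asm) nn_integral_0_iff_AE, simp, subst (asm) nn_integral_0_iff_AE) auto
  then have ae: "AE \<rho> in lborel. 0 < \<rho> \<longrightarrow> (AE \<omega> in sphm (Suc i). D (\<rho> *\<^sub>R \<omega> + y) = 0)"
    unfolding radial_measure_def
    by (subst (asm) AE_density) (auto simp: indicator_def elim!: eventually_mono)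
  have u: "0 < u (Suc i)" and w: "0 < w (Suc i)"
    using assms(3,4) Suc.prems by (auto intro: pos_expD)
  show ?case
    unfolding inorm.simps rad_ang_norm_def
  proof (intro ennpowr_mono nn_integral_mono_AE)
    show "AE \<rho> in lborel. ennpowr (\<integral>\<^sup>+ \<omega>. ennpowr (inorm blk k u w g i (\<rho> *\<^sub>R \<omega> + y)) (w (Suc i)) \<partial>sphm (Suc i)) (u (Suc i) / w (Suc i))
            * ennreal (\<rho> powr (N (Suc i) - 1)) * indicator {0<..} \<rho>
         \<le> ennpowr (\<integral>\<^sup>+ \<omega>. ennpowr (inorm blk k u w h i (\<rho> *\<^sub>R \<omega> + y)) (w (Suc i)) \<partial>sphm (Suc i)) (u (Suc i) / w (Suc i))
            * ennreal (\<rho> powr (N (Suc i) - 1)) * indicator {0<..} \<rho>"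
      using ae
    proof eventually_elim
      case (elim \<rho>)
      show ?case
      proof (cases "0 < \<rho>")
        case True
        with elim have "AE \<omega> in sphm (Suc i). D (\<rho> *\<^sub>R \<omega> + y) = 0" by simp
        then have "AE \<omega> in sphm (Suc i). ennpowr (inorm blk k u w g i (\<rho> *\<^sub>R \<omega> + y)) (w (Suc i))
            \<le> ennpowr (inorm blk k u w h i (\<rho> *\<^sub>R \<omega> + y)) (w (Suc i))"
          by eventually_elim (use Suc w in \<open>auto intro!: ennpowr_mono simp: D_def\<close>)
        then show ?thesis
          using u w by (intro mult_right_mono ennpowr_mono nn_integral_mono_AE) auto
      qed simp
    qed
  qed (use u in auto)
qed

section \<open>Hoelder, Minkowski and dilation for iterated norms\<close>

lemma inorm_cmult:
  assumes [measurable]: "g \<in> borel_measurable borel" and "pos_exp u" "pos_exp w" "i \<le> m"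
  shows "inorm blk k u w (\<lambda>x. c * g x) i y = c * inorm blk k u w g i y"
  using assms(4)
proof (induction i arbitrary: y)
  case (Suc i)
  have [measurable]: "inorm blk k u w g i \<in> borel_measurable borel"
    using Suc assms by (intro inorm_measurable) auto
  note [measurable] = measurable_lp_sphm
  have p: "0 < u (Suc i)" "0 < w (Suc i)"
    using assms Suc.prems by (auto intro: pos_expD)
  have "inorm blk k u w (\<lambda>x. c * g x) (Suc i) y
    = lp (radm (Suc i)) (u (Suc i)) (\<lambda>\<rho>. lp (sphm (Suc i)) (w (Suc i)) (\<lambda>\<omega>. c * inorm blk k u w g i (\<rho> *\<^sub>R \<omega> + y)))"
    using Suc assms by (subst inorm_Suc) auto
  also have "\<dots> = lp (radm (Suc i)) (u (Suc i)) (\<lambda>\<rho>. c * lp (sphm (Suc i)) (w (Suc i)) (\<lambda>\<omega>. inorm blk k u w g i (\<rho> *\<^sub>R \<omega> + y)))"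
    using p by (intro lp_cong lp_cmult) auto
  also have "\<dots> = c * lp (radm (Suc i)) (u (Suc i)) (\<lambda>\<rho>. lp (sphm (Suc i)) (w (Suc i)) (\<lambda>\<omega>. inorm blk k u w g i (\<rho> *\<^sub>R \<omega> + y)))"
    using p by (intro lp_cmult) auto
  also have "\<dots> = c * inorm blk k u w g (Suc i) y"
    using Suc.prems assms by (subst inorm_Suc) auto
  finally show ?case .
qed simp

lemma inorm_Holder:
  assumes [measurable]: "g \<in> borel_measurable borel" "h \<in> borel_measurable borel"
    and pos: "pos_exp s" "pos_exp s'" "pos_exp r" "pos_exp r'" "pos_exp q" "pos_exp q'"
    and conj: "\<And>i. i \<in> {1..m} \<Longrightarrow> 1 / s i = 1 / r i + 1 / q i"
      "\<And>i. i \<in> {1..m} \<Longrightarrow> 1 / s' i = 1 / r' i + 1 / q' i"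
    and "i \<le> m"
  shows "inorm blk k s s' (\<lambda>x. g x * h x) i y \<le> inorm blk k r r' g i y * inorm blk k q q' h i y"
  using assms(11)
proof (induction i arbitrary: y)
  case (Suc i)
  have [measurable]: "inorm blk k r r' g i \<in> borel_measurable borel" "inorm blk k q q' h i \<in> borel_measurable borel"
    using Suc pos by (auto intro!: inorm_measurable)
  note [measurable] = measurable_lp_sphm
  have p: "0 < s (Suc i)" "0 < s' (Suc i)" "0 < r (Suc i)" "0 < r' (Suc i)" "0 < q (Suc i)" "0 < q' (Suc i)"
    using pos Suc.prems by (auto intro: pos_expD)
  have "inorm blk k s s' (\<lambda>x. g x * h x) (Suc i) y
    = lp (radm (Suc i)) (s (Suc i)) (\<lambda>\<rho>. lp (sphm (Suc i)) (s' (Suc i)) (\<lambda>\<omega>. inorm blk k s s' (\<lambda>x. g x * h x) i (\<rho> *\<^sub>R \<omega> + y)))"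
    using Suc.prems pos by (intro inorm_Suc) auto
  also have "\<dots> \<le> lp (radm (Suc i)) (s (Suc i)) (\<lambda>\<rho>. lp (sphm (Suc i)) (s' (Suc i))
      (\<lambda>\<omega>. inorm blk k r r' g i (\<rho> *\<^sub>R \<omega> + y) * inorm blk k q q' h i (\<rho> *\<^sub>R \<omega> + y)))"
    using Suc p by (intro lp_mono) auto
  also have "\<dots> \<le> lp (radm (Suc i)) (s (Suc i)) (\<lambda>\<rho>. lp (sphm (Suc i)) (r' (Suc i))
      (\<lambda>\<omega>. inorm blk k r r' g i (\<rho> *\<^sub>R \<omega> + y)) * lp (sphm (Suc i)) (q' (Suc i)) (\<lambda>\<omega>. inorm blk k q q' h i (\<rho> *\<^sub>R \<omega> + y)))"
    using p conj Suc.prems by (intro lp_mono lp_Holder) auto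
  also have "\<dots> \<le> lp (radm (Suc i)) (r (Suc i)) (\<lambda>\<rho>. lp (sphm (Suc i)) (r' (Suc i)) (\<lambda>\<omega>. inorm blk k r r' g i (\<rho> *\<^sub>R \<omega> + y)))
      * lp (radm (Suc i)) (q (Suc i)) (\<lambda>\<rho>. lp (sphm (Suc i)) (q' (Suc i)) (\<lambda>\<omega>. inorm blk k q q' h i (\<rho> *\<^sub>R \<omega> + y)))"
    using p conj Suc.prems by (intro lp_Holder) auto
  also have "\<dots> = inorm blk k r r' g (Suc i) y * inorm blk k q q' h (Suc i) y"
    using Suc.prems pos by (simp add: inorm_Suc del: inorm.simps)
  finally show ?case .
qed simp

lemma inorm_Minkowski:
  assumes T: "sigma_finite_measure T" and meas [measurable]: "case_prod g \<in> borel_measurable (borel \<Otimes>\<^sub>M T)"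
    and uw: "\<And>i. i \<in> {1..m} \<Longrightarrow> 1 < u i \<and> 1 < w i" and "i \<le> m"
  shows "inorm blk k u w (\<lambda>x. \<integral>\<^sup>+t. g x t \<partial>T) i y \<le> (\<integral>\<^sup>+t. inorm blk k u w (\<lambda>x. g x t) i y \<partial>T)"
  using assms(4)
proof (induction i arbitrary: y)
  case (Suc i)
  interpret T: sigma_finite_measure T by fact
  have pos: "pos_exp u" "pos_exp w"
    using uw by (force simp: pos_exp_def)+
  define h where "h z t = inorm blk k u w (\<lambda>x. g x t) i z" for z t
  have [measurable]: "case_prod h \<in> borel_measurable (borel \<Otimes>\<^sub>M T)"
    unfolding h_def using Suc pos by (intro inorm_measurable_param) auto
  note [measurable] = measurable_lp_sphm
  have p: "1 < u (Suc i)" "1 < w (Suc i)"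
    using uw Suc.prems by auto
  have "inorm blk k u w (\<lambda>x. \<integral>\<^sup>+t. g x t \<partial>T) (Suc i) y
    = lp (radm (Suc i)) (u (Suc i)) (\<lambda>\<rho>. lp (sphm (Suc i)) (w (Suc i)) (\<lambda>\<omega>. inorm blk k u w (\<lambda>x. \<integral>\<^sup>+t. g x t \<partial>T) i (\<rho> *\<^sub>R \<omega> + y)))"
    using Suc.prems pos by (intro inorm_Suc) auto
  also have "\<dots> \<le> lp (radm (Suc i)) (u (Suc i)) (\<lambda>\<rho>. lp (sphm (Suc i)) (w (Suc i)) (\<lambda>\<omega>. \<integral>\<^sup>+t. h (\<rho> *\<^sub>R \<omega> + y) t \<partial>T))"
    using Suc p by (intro lp_mono) (auto simp: h_def)
  also have "\<dots> \<le> lp (radm (Suc i)) (u (Suc i)) (\<lambda>\<rho>. \<integral>\<^sup>+t. lp (sphm (Suc i)) (w (Suc i)) (\<lambda>\<omega>. h (\<rho> *\<^sub>R \<omega> + y) t) \<partial>T)"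
    using p by (intro lp_mono lp_Minkowski sigma_finite_sphm T) auto
  also have "\<dots> \<le> (\<integral>\<^sup>+t. lp (radm (Suc i)) (u (Suc i)) (\<lambda>\<rho>. lp (sphm (Suc i)) (w (Suc i)) (\<lambda>\<omega>. h (\<rho> *\<^sub>R \<omega> + y) t)) \<partial>T)"
    using p by (intro lp_Minkowski sigma_finite_radm T) auto
  also have "\<dots> = (\<integral>\<^sup>+t. inorm blk k u w (\<lambda>x. g x t) (Suc i) y \<partial>T)"
    unfolding h_def using Suc.prems pos by (intro nn_integral_cong inorm_Suc[symmetric]) auto
  finally show ?case .
qed simp

text \<open>The factor t goes into the radii, and the substitution in the radial integral of block j
  gives t^(-N_j / u_j); the unit vectors are not affected. The free variables y are dilated along,
  as the next stage of the induction requires.\<close>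

lemma inorm_scale:
  assumes [measurable]: "g \<in> borel_measurable borel" and pos: "pos_exp u" "pos_exp w" and "i \<le> m" and t: "0 < t"
  shows "inorm blk k u w (\<lambda>x. g (t *\<^sub>R x)) i y
    = ennreal (t powr - (\<Sum>j=1..i. N j / u j)) * inorm blk k u w g i (t *\<^sub>R y)"
  using assms(4)
proof (induction i arbitrary: y)
  case 0
  then show ?case using t by simp
next
  case (Suc i)
  define c where "c = t powr - (\<Sum>j=1..i. N j / u j)"
  define h where "h = inorm blk k u w g i"
  have [measurable]: "h \<in> borel_measurable borel"
    unfolding h_def using Suc pos by (intro inorm_measurable) auto
  note [measurable] = measurable_lp_sphm
  have p: "0 < u (Suc i)" "0 < w (Suc i)"
    using pos Suc.prems by (auto intro: pos_expD)
  define H where "H \<rho> = lp (sphm (Suc i)) (w (Suc i)) (\<lambda>\<omega>. h (\<rho> *\<^sub>R \<omega> + t *\<^sub>R y))" for \<rho>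
  have [measurable]: "H \<in> borel_measurable borel"
    unfolding H_def by measurable
  have "inorm blk k u w (\<lambda>x. g (t *\<^sub>R x)) (Suc i) y
    = lp (radm (Suc i)) (u (Suc i)) (\<lambda>\<rho>. lp (sphm (Suc i)) (w (Suc i)) (\<lambda>\<omega>. ennreal c * h ((t * \<rho>) *\<^sub>R \<omega> + t *\<^sub>R y)))"
    using Suc pos by (subst inorm_Suc) (auto simp: c_def h_def algebra_simps)
  also have "\<dots> = lp (radm (Suc i)) (u (Suc i)) (\<lambda>\<rho>. ennreal c * H (t * \<rho>))"
    unfolding H_def using p by (intro lp_cong lp_cmult) auto
  also have "\<dots> = ennreal c * lp (radm (Suc i)) (u (Suc i)) (\<lambda>\<rho>. H (t * \<rho>))"
    using p by (intro lp_cmult) auto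
  also have "lp (radm (Suc i)) (u (Suc i)) (\<lambda>\<rho>. H (t * \<rho>))
      = ennpowr (ennreal (t powr - N (Suc i)) * (\<integral>\<^sup>+\<rho>. ennpowr (H \<rho>) (u (Suc i)) \<partial>radm (Suc i))) (1 / u (Suc i))"
    unfolding lp_def
    by (subst nn_integral_radial_measure_scale[OF t, where g="\<lambda>\<rho>. ennpowr (H \<rho>) (u (Suc i))"]) auto
  also have "\<dots> = ennreal (t powr - (N (Suc i) / u (Suc i))) * lp (radm (Suc i)) (u (Suc i)) H"
    by (simp add: ennpowr_mult ennpowr_ennreal powr_powr lp_def)
  also have "lp (radm (Suc i)) (u (Suc i)) H = inorm blk k u w g (Suc i) (t *\<^sub>R y)"
    using Suc.prems pos by (subst inorm_Suc) (auto simp: H_def[abs_def] h_def)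
  also have "ennreal c * (ennreal (t powr - (N (Suc i) / u (Suc i))) * inorm blk k u w g (Suc i) (t *\<^sub>R y))
      = ennreal (c * t powr - (N (Suc i) / u (Suc i))) * inorm blk k u w g (Suc i) (t *\<^sub>R y)"
    by (simp add: c_def ennreal_mult mult.assoc)
  also have "c * t powr - (N (Suc i) / u (Suc i)) = t powr - (\<Sum>j=1..Suc i. N j / u j)"
    by (simp add: c_def powr_add[symmetric])
  finally show ?case .
qed

text \<open>The homogeneous dimension of a block is at least 1, so the radial density is bounded on
  a bounded interval.\<close>

lemma radm_ball_finite:
  assumes "i \<in> {1..m}" "0 < R"
  shows "(\<integral>\<^sup>+\<rho>. indicator {..<R} \<rho> \<partial>radm i) < \<infinity>"
proof -
  have N: "1 \<le> N i"
  proof -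
    have "1 \<le> card (block blk i)"
      using block_nonempty[OF assms(1)] by (simp add: Suc_le_eq card_gt_0_iff)
    moreover have "0 \<le> (\<Sum>j\<in>block blk i. k $ j)"
      by (intro sum_nonneg k_nonneg)
    ultimately show ?thesis by (simp add: hom_dim_def)
  qed
  have "(\<integral>\<^sup>+\<rho>. indicator {..<R} \<rho> \<partial>radm i)
      = (\<integral>\<^sup>+\<rho>. indicator {..<R} \<rho> * ennreal (\<rho> powr (N i - 1)) * indicator {0<..} \<rho> \<partial>lborel)"
    by (intro nn_integral_radial_measure) auto
  also have "\<dots> \<le> (\<integral>\<^sup>+\<rho>. ennreal (R powr (N i - 1)) * indicator {0..R} \<rho> \<partial>lborel)"
    using N by (intro nn_integral_mono) (auto simp: indicator_def intro!: ennreal_leI powr_mono2)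
  also have "\<dots> < \<infinity>"
    using assms(2) by (simp add: nn_integral_cmult ennreal_mult_less_top)
  finally show ?thesis .
qed

text \<open>Up to a finite constant, each stage reproduces the indicator of the ball in the
  remaining variables. A new block vector is orthogonal to y, hence |\<rho> \<omega> + y| < R forces
  both \<rho> < R and |y| < R. The support condition on y supplies this orthogonality.\<close>

lemma inorm_ball_bounded:
  assumes pos: "pos_exp u" "pos_exp w" and "i \<le> m" and R: "0 < R"
  shows "\<exists>c<\<infinity>. \<forall>y. (\<forall>j. blk j \<in> {1..i} \<longrightarrow> y $ j = 0) \<longrightarrow>
    inorm blk k u w (indicator (ball 0 R)) i y \<le> c * indicator (ball 0 R) y"
  using assms(3)
proof (induction i)
  case 0
  then show ?case by (intro exI[of _ 1]) auto
next
  case (Suc i)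
  then obtain c where c: "c < \<infinity>" and le: "\<And>y. (\<forall>j. blk j \<in> {1..i} \<longrightarrow> y $ j = 0) \<Longrightarrow>
    inorm blk k u w (indicator (ball 0 R)) i y \<le> c * indicator (ball 0 R) y"
    by auto
  have p: "0 < u (Suc i)" "0 < w (Suc i)"
    using pos Suc.prems by (auto intro: pos_expD)
  interpret S: finite_measure "sphm (Suc i)" by (rule finite_sphm)
  define a where "a = lp (sphm (Suc i)) (w (Suc i)) (\<lambda>_. c)"
  define b where "b = lp (radm (Suc i)) (u (Suc i)) (\<lambda>\<rho>. indicator {..<R} \<rho>)"
  have a: "a < \<infinity>"
  proof -
    have "emeasure (sphm (Suc i)) UNIV < top"
      by (simp add: less_top[symmetric])
    then show ?thesis
      using c by (simp add: a_def lp_def ennreal_mult_less_top)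
  qed
  have b: "b < \<infinity>"
    unfolding b_def lp_def using radm_ball_finite[of "Suc i" R] R Suc.prems by (simp add: less_top)
  show ?case
  proof (intro exI[of _ "a * b"] conjI allI impI)
    show "a * b < \<infinity>" using a b by (simp add: ennreal_mult_less_top)
    fix y :: "real^'n" assume y: "\<forall>j. blk j \<in> {1..Suc i} \<longrightarrow> y $ j = 0"
    have bound: "inorm blk k u w (indicator (ball 0 R)) i (\<rho> *\<^sub>R \<omega> + y) \<le> c * (indicator {..<R} \<rho> * indicator (ball 0 R) y)"
      if \<rho>: "0 < \<rho>" and \<omega>: "norm \<omega> = 1" "\<forall>j. j \<notin> block blk (Suc i) \<longrightarrow> \<omega> $ j = 0" for \<rho> \<omega>
    proof -
      have "inorm blk k u w (indicator (ball 0 R)) i (\<rho> *\<^sub>R \<omega> + y) \<le> c * indicator (ball 0 R) (\<rho> *\<^sub>R \<omega> + y)"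
        using \<omega> y by (intro le) (auto simp: block_def)
      also have "indicator (ball 0 R) (\<rho> *\<^sub>R \<omega> + y) \<le> (indicator {..<R} \<rho> * indicator (ball 0 R) y :: ennreal)"
      proof -
        have "\<omega> $ j * y $ j = 0" for j
          using \<omega> y by (cases "blk j = Suc i") (auto simp: block_def)
        then have "\<omega> \<bullet> y = 0"
          unfolding inner_vec_def by (intro sum.neutral) (simp del: mult_eq_0_iff)
        then have orth: "orthogonal (\<rho> *\<^sub>R \<omega>) y"
          by (simp add: orthogonal_def)
        have sq: "(norm (\<rho> *\<^sub>R \<omega> + y))\<^sup>2 = \<rho>\<^sup>2 + (norm y)\<^sup>2"
          using norm_add_Pythagorean[OF orth] \<omega>(1) by simp
        have "\<rho> \<le> norm (\<rho> *\<^sub>R \<omega> + y)" "norm y \<le> norm (\<rho> *\<^sub>R \<omega> + y)"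
          by (rule power2_le_imp_le, simp add: sq, simp)+
        then show ?thesis by (auto simp: indicator_def)
      qed
      finally show ?thesis by (simp add: mult_left_mono)
    qed
    have "inorm blk k u w (indicator (ball 0 R)) (Suc i) y
      = lp (radm (Suc i)) (u (Suc i)) (\<lambda>\<rho>. lp (sphm (Suc i)) (w (Suc i)) (\<lambda>\<omega>. inorm blk k u w (indicator (ball 0 R)) i (\<rho> *\<^sub>R \<omega> + y)))"
      using Suc.prems pos by (intro inorm_Suc) auto
    also have "\<dots> \<le> lp (radm (Suc i)) (u (Suc i)) (\<lambda>\<rho>. lp (sphm (Suc i)) (w (Suc i)) (\<lambda>\<omega>. (indicator {..<R} \<rho> * indicator (ball 0 R) y) * c))"
    proof (intro lp_mono_AE p)
      show "AE \<rho> in radm (Suc i). lp (sphm (Suc i)) (w (Suc i)) (\<lambda>\<omega>. inorm blk k u w (indicator (ball 0 R)) i (\<rho> *\<^sub>R \<omega> + y))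
        \<le> lp (sphm (Suc i)) (w (Suc i)) (\<lambda>\<omega>. (indicator {..<R} \<rho> * indicator (ball 0 R) y) * c)"
        using AE_radial_measure
      proof eventually_elim
        case (elim \<rho>)
        show ?case
        proof (intro lp_mono_AE p)
          show "AE \<omega> in sphm (Suc i). inorm blk k u w (indicator (ball 0 R)) i (\<rho> *\<^sub>R \<omega> + y)
            \<le> (indicator {..<R} \<rho> * indicator (ball 0 R) y) * c"
            using AE_dunkl_sphere_measure[where J="block blk (Suc i)"]
          proof eventually_elim
            case (elim \<omega>)
            then show ?case using bound[of \<rho> \<omega>] \<open>0 < \<rho>\<close> by (simp add: mult.commute)
          qed
        qed
      qed
    qed
    also have "\<dots> = lp (radm (Suc i)) (u (Suc i)) (\<lambda>\<rho>. (indicator (ball 0 R) y * a) * indicator {..<R} \<rho>)"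
      unfolding a_def using p by (intro lp_cong) (subst lp_cmult, auto simp: ac_simps)
    also have "\<dots> = (indicator (ball 0 R) y * a) * b"
      unfolding b_def using p by (intro lp_cmult) auto
    finally show "inorm blk k u w (indicator (ball 0 R)) (Suc i) y \<le> a * b * indicator (ball 0 R) y"
      by (simp add: ac_simps)
  qed
qed


section \<open>The full mixed norm, norms of balls, and local integrability\<close>

lemma blk_vimage: "blk -` {1..m} = UNIV"
  using range_blk by blast

lemma hom_dim_pos: "i \<in> {1..m} \<Longrightarrow> 0 < N i"
proof -
  assume "i \<in> {1..m}"
  then have "0 < card (block blk i)"
    using block_nonempty by (simp add: card_gt_0_iff)
  moreover have "0 \<le> (\<Sum>j\<in>block blk i. k $ j)"
    by (intro sum_nonneg k_nonneg)
  ultimately show ?thesis by (simp add: hom_dim_def)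
qed

lemma hom_dim_sum: "(\<Sum>i=1..m. N i) = hom_dim k UNIV"
proof -
  have g: "(\<Sum>i\<in>{1..m}. sum h (block blk i)) = sum h UNIV" for h :: "'n \<Rightarrow> real"
    using sum.group[of UNIV "{1..m}" blk h] range_blk by (simp add: block_def)
  have "(\<Sum>i=1..m. N i) = (\<Sum>i\<in>{1..m}. sum (\<lambda>j. 1 + 2 * k $ j) (block blk i))"
    by (simp add: hom_dim_def sum.distrib sum_distrib_left)
  then show ?thesis
    unfolding g by (simp add: hom_dim_def sum.distrib sum_distrib_left)
qed

definition mn :: "(nat \<Rightarrow> real) \<Rightarrow> (nat \<Rightarrow> real) \<Rightarrow> (real ^ 'n \<Rightarrow> ennreal) \<Rightarrow> ennreal" where
  "mn u w g = inorm blk k u w g m 0"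

text \<open>The homogeneity exponent of the mixed norm: dilating the argument by t gives t^(-scal
  u), and the norm of the indicator of a ball grows like R^(scal u). The angular exponents do not
  enter.\<close>

definition scal :: "(nat \<Rightarrow> real) \<Rightarrow> real" where
  "scal u = (\<Sum>i=1..m. N i / u i)"

lemma mixed_norm_eq_mn: "mixed_norm blk m k u w f = mn u w (\<lambda>x. ennreal (norm (f x)))"
  by (simp add: mixed_norm_def mn_def iter_norm_eq_inorm)

lemma mn_1_lborel:
  assumes [measurable]: "g \<in> borel_measurable borel"
  shows "mn (\<lambda>_. 1) (\<lambda>_. 1) g = (\<integral>\<^sup>+x. ennreal (dunkl_weight k UNIV x) * g x \<partial>lborel)"
  unfolding mn_def inorm_1_eq_integral[OF assms order.refl] blk_vimage block_lborel_UNIV by simp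

lemma nn_integral_dunkl_measure:
  assumes [measurable]: "g \<in> borel_measurable borel"
  shows "(\<integral>\<^sup>+x. g x \<partial>dunkl_measure k) = mn (\<lambda>_. 1) (\<lambda>_. 1) g"
proof -
  have "(\<integral>\<^sup>+x. g x \<partial>dunkl_measure k) = (\<integral>\<^sup>+x. ennreal (dunkl_weight k UNIV x) * g x \<partial>lebesgue)"
    unfolding dunkl_measure_def by (intro nn_integral_density measurable_completion) measurable
  then show ?thesis
    by (simp add: nn_integral_completion mn_1_lborel)
qed

text \<open>A Borel null set M covers the exceptional points. Its Dunkl integral is 0, which is the
  vanishing iterated L^1 norm that \<open>inorm_mono_off\<close> asks for.\<close>

lemma mn_mono_AE:
  assumes "AE x in lborel. g x \<le> h x" "pos_exp u" "pos_exp w"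
  shows "mn u w g \<le> mn u w h"
proof -
  obtain M where M: "{x \<in> space lborel. \<not> g x \<le> h x} \<subseteq> M" "emeasure lborel M = 0" "M \<in> sets lborel"
    using assms(1) by (rule AE_E)
  then have [measurable]: "M \<in> sets borel" by simp
  have "AE x in lborel. x \<notin> M"
    using M by (intro AE_not_in) (auto simp: null_sets_def)
  then have "mn (\<lambda>_. 1) (\<lambda>_. 1) (indicator M) = 0"
    by (subst mn_1_lborel, simp, subst nn_integral_0_iff_AE) (auto simp: indicator_def)
  then show ?thesis
    using M assms(2,3) unfolding mn_def by (intro inorm_mono_off[of M]) auto
qed

lemma mn_mono:
  assumes "\<And>x. g x \<le> h x" "pos_exp u" "pos_exp w"
  shows "mn u w g \<le> mn u w h"
  using assms by (intro mn_mono_AE) auto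

lemma mn_cong_AE:
  assumes "AE x in lborel. g x = h x" "pos_exp u" "pos_exp w"
  shows "mn u w g = mn u w h"
  using assms(1) by (intro antisym mn_mono_AE assms(2,3)) (auto elim: eventually_mono)

lemma mn_cmult:
  assumes "g \<in> borel_measurable borel" "pos_exp u" "pos_exp w"
  shows "mn u w (\<lambda>x. c * g x) = c * mn u w g"
  unfolding mn_def using assms by (intro inorm_cmult) auto

lemma mn_Holder:
  assumes "g \<in> borel_measurable borel" "h \<in> borel_measurable borel"
    and "pos_exp s" "pos_exp s'" "pos_exp r" "pos_exp r'" "pos_exp q" "pos_exp q'"
    and "\<And>i. i \<in> {1..m} \<Longrightarrow> 1 / s i = 1 / r i + 1 / q i"
      "\<And>i. i \<in> {1..m} \<Longrightarrow> 1 / s' i = 1 / r' i + 1 / q' i"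
  shows "mn s s' (\<lambda>x. g x * h x) \<le> mn r r' g * mn q q' h"
  unfolding mn_def using assms by (intro inorm_Holder) auto

definition exp_gt1 :: "(nat \<Rightarrow> real) \<Rightarrow> bool" where
  "exp_gt1 u \<longleftrightarrow> (\<forall>i\<in>{1..m}. 1 < u i)"

lemma exp_gt1_pos: "exp_gt1 u \<Longrightarrow> pos_exp u"
  by (force simp: exp_gt1_def pos_exp_def)

lemma mn_Minkowski:
  assumes "sigma_finite_measure T" "case_prod g \<in> borel_measurable (borel \<Otimes>\<^sub>M T)" "exp_gt1 u" "exp_gt1 w"
  shows "mn u w (\<lambda>x. \<integral>\<^sup>+t. g x t \<partial>T) \<le> (\<integral>\<^sup>+t. mn u w (\<lambda>x. g x t) \<partial>T)"
  unfolding mn_def using assms by (intro inorm_Minkowski) (auto simp: exp_gt1_def)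

text \<open>Minkowski's integral inequality over a two-point space.\<close>

lemma mn_add:
  assumes [measurable]: "g \<in> borel_measurable borel" "h \<in> borel_measurable borel" and "exp_gt1 u" "exp_gt1 w"
  shows "mn u w (\<lambda>x. g x + h x) \<le> mn u w g + mn u w h"
proof -
  let ?T = "count_space (UNIV :: bool set)"
  have "mn u w (\<lambda>x. \<integral>\<^sup>+b. (if b then g x else h x) \<partial>?T) \<le> (\<integral>\<^sup>+b. mn u w (\<lambda>x. if b then g x else h x) \<partial>?T)"
    using assms by (intro mn_Minkowski sigma_finite_measure_count_space_finite) auto
  then show ?thesis
    by (simp add: nn_integral_count_space_finite UNIV_bool add.commute)
qed

lemma mn_scale:
  assumes "g \<in> borel_measurable borel" "pos_exp u" "pos_exp w" "0 < t"
  shows "mn u w (\<lambda>x. g (t *\<^sub>R x)) = ennreal (t powr - scal u) * mn u w g"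
  unfolding mn_def scal_def using assms by (subst inorm_scale) auto

lemma scal_1: "scal (\<lambda>_. 1) = hom_dim k UNIV"
  using hom_dim_sum by (simp add: scal_def)

lemma pos_exp_1 [simp]: "pos_exp (\<lambda>_. 1)"
  by (simp add: pos_exp_def)

lemma mn_ball_finite:
  assumes "pos_exp u" "pos_exp w" "0 < R"
  shows "mn u w (indicator (ball 0 R)) < \<infinity>"
proof -
  obtain c where c: "c < \<infinity>" "\<forall>y. (\<forall>j. blk j \<in> {1..m} \<longrightarrow> y $ j = 0) \<longrightarrow>
      inorm blk k u w (indicator (ball 0 R)) m y \<le> c * indicator (ball 0 R) y"
    using inorm_ball_bounded[OF assms(1,2) order.refl assms(3)] by blast
  have "mn u w (indicator (ball 0 R)) \<le> c"
    using c(2)[rule_format, of 0] assms(3) by (simp add: mn_def)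
  then show ?thesis
    using c(1) by (rule le_less_trans)
qed

text \<open>The norm of the unit ball. For positive exponents it is finite, so the conversion to a
  real number is faithful, and dilation then yields the norm of every ball.\<close>

definition ballc :: "(nat \<Rightarrow> real) \<Rightarrow> (nat \<Rightarrow> real) \<Rightarrow> real" where
  "ballc u w = enn2real (mn u w (indicator (ball 0 1)))"

lemma indicator_ball_scale:
  "0 < t \<Longrightarrow> indicator (ball 0 R) (x :: real^'n) = indicator (ball 0 (t * R)) (t *\<^sub>R x)"
  by (auto simp: indicator_def)

lemma mn_ball:
  assumes "pos_exp u" "pos_exp w" "0 < R"
  shows "mn u w (indicator (ball 0 R)) = ennreal (R powr scal u * ballc u w)"
proof -
  have "(indicator (ball 0 R) :: real^'n \<Rightarrow> ennreal) = (\<lambda>x. indicator (ball 0 1) ((1 / R) *\<^sub>R x))"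
    using assms(3) indicator_ball_scale[of "1 / R" R] by auto
  then have "mn u w (indicator (ball 0 R)) = ennreal ((1 / R) powr - scal u) * mn u w (indicator (ball 0 1))"
    using mn_scale[of "indicator (ball 0 1)" u w "1 / R"] assms by simp
  also have "mn u w (indicator (ball 0 1)) = ennreal (ballc u w)"
    using mn_ball_finite[OF assms(1,2), of 1] by (simp add: ballc_def)
  also have "(1 / R) powr - scal u = R powr scal u"
    using assms(3) by (simp add: powr_divide powr_minus field_simps)
  finally show ?thesis
    by (simp add: ennreal_mult ballc_def)
qed

abbreviation "dimk \<equiv> hom_dim k UNIV"
text \<open>The Dunkl volume of the unit ball, because exponents 1 mean integration.\<close>

abbreviation "vol \<equiv> ballc (\<lambda>_. 1) (\<lambda>_. 1)"

lemma ball_dunkl_sets: "ball 0 R \<in> sets (dunkl_measure k)"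
  by (simp add: dunkl_measure_def)

lemma emeasure_dunkl_ball:
  assumes "0 < R"
  shows "emeasure (dunkl_measure k) (ball 0 R) = ennreal (R powr dimk * vol)"
proof -
  have "emeasure (dunkl_measure k) (ball 0 R) = (\<integral>\<^sup>+x. indicator (ball 0 R) x \<partial>dunkl_measure k)"
    by (simp add: ball_dunkl_sets)
  also have "\<dots> = mn (\<lambda>_. 1) (\<lambda>_. 1) (indicator (ball 0 R))"
    by (intro nn_integral_dunkl_measure) simp
  also have "\<dots> = ennreal (R powr dimk * vol)"
    using assms by (simp add: mn_ball scal_1)
  finally show ?thesis .
qed

lemma ballc_nonneg: "0 \<le> ballc u w"
  by (simp add: ballc_def)

lemma measure_dunkl_ball:
  assumes "0 < R"
  shows "measure (dunkl_measure k) (ball 0 R) = R powr dimk * vol"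
  using emeasure_dunkl_ball[OF assms] by (simp add: measure_def ballc_nonneg)

lemma AE_dunkl_weight_pos: "AE x in lborel. 0 < dunkl_weight k UNIV x"
proof -
  have "AE x::real^'n in lborel. x $ j \<noteq> 0" for j
    using AE_block_lborel_component_nonzero[of j UNIV] unfolding block_lborel_UNIV by simp
  then have "AE x::real^'n in lborel. \<forall>j\<in>UNIV. x $ j \<noteq> 0"
    by (intro AE_finite_allI) auto
  then show ?thesis
    by eventually_elim (auto intro: dunkl_weight_pos)
qed

lemma vol_pos: "0 < vol"
proof (rule ccontr)
  assume "\<not> 0 < vol"
  then have "mn (\<lambda>_. 1) (\<lambda>_. 1) (indicator (ball 0 1)) = 0"
    using ballc_nonneg[of "\<lambda>_. 1" "\<lambda>_. 1"] by (simp add: mn_ball)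
  then have "(\<integral>\<^sup>+x. ennreal (dunkl_weight k UNIV x) * indicator (ball 0 1) x \<partial>lborel) = 0"
    by (subst (asm) mn_1_lborel) simp_all
  then have "AE x in lborel. ennreal (dunkl_weight k UNIV x) * indicator (ball 0 1) x = 0"
    by (subst (asm) nn_integral_0_iff_AE) auto
  with AE_dunkl_weight_pos have "AE x in lborel. x \<notin> ball (0 :: real^'n) 1"
    by eventually_elim (auto simp: indicator_def)
  then have "emeasure lborel (ball (0 :: real^'n) 1) = 0"
    by (subst (asm) AE_iff_measurable[of "ball 0 1"]) auto
  moreover have "0 < measure lborel (ball (0 :: real^'n) 1)"
    using content_ball_pos[of 1 "0 :: real^'n"] by simp
  ultimately show False
    by (simp add: measure_def)
qed

definition conj_exp :: "(nat \<Rightarrow> real) \<Rightarrow> nat \<Rightarrow> real" where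
  "conj_exp u i = u i / (u i - 1)"

lemma conj_exp:
  assumes "exp_gt1 u"
  shows "pos_exp (conj_exp u)" "i \<in> {1..m} \<Longrightarrow> 1 / 1 = 1 / u i + 1 / conj_exp u i"
  using assms unfolding exp_gt1_def pos_exp_def conj_exp_def by (force simp: field_simps)+

lemma scal_conj_exp:
  assumes "exp_gt1 u"
  shows "scal u + scal (conj_exp u) = dimk"
proof -
  have "scal u + scal (conj_exp u) = (\<Sum>i=1..m. N i * (1 / u i + 1 / conj_exp u i))"
    by (simp add: scal_def sum.distrib[symmetric] algebra_simps)
  also have "\<dots> = (\<Sum>i=1..m. N i)"
    using conj_exp(2)[OF assms] by (intro sum.cong) auto
  finally show ?thesis by (simp only: hom_dim_sum)
qed

text \<open>Hoelder's inequality against the indicator of the ball, with the dual exponents in every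
  variable and all target exponents equal to 1. It turns bounds in mixed norm into local
  integrability and into bounds for means.\<close>

lemma nn_integral_le_mn:
  assumes [measurable]: "g \<in> borel_measurable borel" and uw: "exp_gt1 u" "exp_gt1 w" and "0 < R"
  shows "(\<integral>\<^sup>+x. g x * indicator (ball 0 R) x \<partial>dunkl_measure k)
    \<le> mn u w (\<lambda>x. g x * indicator (ball 0 R) x) * ennreal (R powr (dimk - scal u) * ballc (conj_exp u) (conj_exp w))"
proof -
  have "(\<integral>\<^sup>+x. g x * indicator (ball 0 R) x \<partial>dunkl_measure k) = mn (\<lambda>_. 1) (\<lambda>_. 1) (\<lambda>x. g x * indicator (ball 0 R) x)"
    by (intro nn_integral_dunkl_measure) measurable
  \<comment> \<open>The indicator is doubled so that each Hoelder factor receives one copy.\<close>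
  also have "\<dots> = mn (\<lambda>_. 1) (\<lambda>_. 1) (\<lambda>x. (g x * indicator (ball 0 R) x) * indicator (ball 0 R) x)"
    by (rule arg_cong[of _ _ "mn (\<lambda>_. 1) (\<lambda>_. 1)"]) (auto simp: indicator_def)
  also have "\<dots> \<le> mn u w (\<lambda>x. g x * indicator (ball 0 R) x) * mn (conj_exp u) (conj_exp w) (indicator (ball 0 R))"
    using uw by (intro mn_Holder conj_exp) (auto simp: exp_gt1_pos conj_exp(1))
  also have "mn (conj_exp u) (conj_exp w) (indicator (ball 0 R)) = ennreal (R powr (dimk - scal u) * ballc (conj_exp u) (conj_exp w))"
  proof -
    have "scal (conj_exp u) = dimk - scal u"
      using scal_conj_exp[OF uw(1)] by linarith
    then show ?thesis
      using mn_ball[OF conj_exp(1)[OF uw(1)] conj_exp(1)[OF uw(2)] assms(4)] by metis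
  qed
  finally show ?thesis .
qed

text \<open>If the norm of the unit ball vanished, Hoelder's inequality would force its Dunkl volume
  to vanish as well.\<close>

lemma ballc_pos:
  assumes "exp_gt1 u" "exp_gt1 w"
  shows "0 < ballc u w"
proof (rule ccontr)
  assume "\<not> 0 < ballc u w"
  then have "ballc u w = 0"
    using ballc_nonneg[of u w] by simp
  then have "mn u w (\<lambda>x. 1 * indicator (ball 0 1) x) = 0"
    using assms by (simp add: mn_ball exp_gt1_pos)
  then have "(\<integral>\<^sup>+x. 1 * indicator (ball 0 1) x \<partial>dunkl_measure k) = 0"
    using nn_integral_le_mn[of "\<lambda>_. 1" u w 1] assms by simp
  then show False
    using emeasure_dunkl_ball[of 1] vol_pos by (simp add: ball_dunkl_sets)
qed

text \<open>The single term with 2^(-j-1) <= |x| < 2^(-j) already dominates. The sum is written as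
  an integral over the counting measure so that Minkowski's inequality applies to it.\<close>

lemma norm_powr_dyadic_bound:
  fixes x :: "'a::real_normed_vector"
  assumes "0 \<le> a"
  shows "ennreal (norm x powr - a) * indicator (ball 0 1) x
    \<le> (\<integral>\<^sup>+j. ennreal (2 powr (a * (real j + 1))) * indicator {..<0} (norm x - 2 powr - real j) \<partial>count_space UNIV)"
proof (cases "x \<noteq> 0 \<and> norm x < 1")
  case True
  define L where "L = - log 2 (norm x)"
  have L: "0 < L" "norm x = 2 powr - L"
    using True by (simp_all add: L_def powr_log_cancel)
  \<comment> \<open>The largest integer strictly below L, so that |x| lies strictly inside the ball
    of radius 2^(-j).\<close>
  define j where "j = nat (\<lceil>L\<rceil> - 1)"
  have j: "real j < L" "L \<le> real j + 1"
    using L(1) unfolding j_def by linarith+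
  have "ennreal (norm x powr - a) * indicator (ball 0 1) x = ennreal (2 powr (a * L))"
    using True by (simp add: L(2) powr_powr mult.commute)
  also have "\<dots> \<le> ennreal (2 powr (a * (real j + 1)))"
    using j assms by (intro ennreal_leI) (simp add: mult_left_mono)
  also have "\<dots> = ennreal (2 powr (a * (real j + 1))) * indicator {..<0} (norm x - 2 powr - real j)"
    using j by (simp add: L(2))
  also have "\<dots> \<le> (\<integral>\<^sup>+j. ennreal (2 powr (a * (real j + 1))) * indicator {..<0} (norm x - 2 powr - real j) \<partial>count_space UNIV)"
    by (rule nn_integral_ge_point) simp
  finally show ?thesis .
qed auto

text \<open>The ball of radius 2^(-j) contributes a multiple of 2^(a j) 2^(-j scal u), and a < scal
  u makes this a convergent geometric series. Only norms of balls are needed, which avoids computing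
  with |x| inside the nested integrals.\<close>

lemma mn_norm_powr_finite:
  assumes uw: "exp_gt1 u" "exp_gt1 w" and a: "0 \<le> a" "a < scal u"
  shows "mn u w (\<lambda>x. ennreal (norm x powr - a) * indicator (ball 0 1) x) < \<infinity>"
proof -
  let ?g = "\<lambda>(x::real^'n) j. ennreal (2 powr (a * (real j + 1))) * indicator {..<0} (norm x - 2 powr - real j)"
  define f where "f j = (2 powr a * ballc u w) * (2 powr (a - scal u)) ^ j" for j
  have "mn u w (\<lambda>x. ennreal (norm x powr - a) * indicator (ball 0 1) x) \<le> mn u w (\<lambda>x. \<integral>\<^sup>+j. ?g x j \<partial>count_space UNIV)"
    using uw by (intro mn_mono norm_powr_dyadic_bound a) (auto simp: exp_gt1_pos)
  also have "\<dots> \<le> (\<integral>\<^sup>+j. mn u w (\<lambda>x. ?g x j) \<partial>count_space UNIV)"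
    using uw by (intro mn_Minkowski sigma_finite_measure_count_space) measurable
  also have "\<dots> = (\<integral>\<^sup>+j. ennreal (f j) \<partial>count_space UNIV)"
  proof (intro nn_integral_cong)
    fix j :: nat
    have "mn u w (\<lambda>x. ?g x j) = ennreal (2 powr (a * (real j + 1))) * mn u w (\<lambda>x. indicator {..<0} (norm x - 2 powr - real j))"
      using uw by (intro mn_cmult) (auto simp: exp_gt1_pos)
    moreover have "mn u w (\<lambda>x. indicator {..<0} (norm x - 2 powr - real j)) = mn u w (indicator (ball 0 (2 powr - real j)))"
      by (rule arg_cong[of _ _ "mn u w"]) (auto simp: indicator_def)
    moreover have "mn u w (indicator (ball 0 (2 powr - real j))) = ennreal ((2 powr - real j) powr scal u * ballc u w)"
      using uw by (intro mn_ball) (auto simp: exp_gt1_pos)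
    moreover have "f j = 2 powr (a * (real j + 1)) * ((2 powr - real j) powr scal u * ballc u w)"
    proof -
      have "f j = 2 powr a * 2 powr ((a - scal u) * real j) * ballc u w"
        by (simp add: f_def powr_realpow[symmetric] powr_powr)
      also have "2 powr a * 2 powr ((a - scal u) * real j) = (2 powr (a + (a - scal u) * real j) :: real)"
        by (rule powr_add[symmetric])
      also have "a + (a - scal u) * real j = a * (real j + 1) + - real j * scal u"
        by (simp add: algebra_simps)
      also have "2 powr \<dots> = 2 powr (a * (real j + 1)) * (2 powr - real j) powr scal u"
        unfolding powr_powr by (rule powr_add)
      finally show ?thesis by (simp only: mult.assoc)
    qed
    ultimately show "mn u w (\<lambda>x. ?g x j) = ennreal (f j)"
      by (simp only: ennreal_mult[OF powr_ge_zero mult_nonneg_nonneg[OF powr_ge_zero ballc_nonneg]])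
  qed
  also have "\<dots> = (\<Sum>j. ennreal (f j))"
    by (rule nn_integral_count_space_nat)
  also have "\<dots> < \<infinity>"
  proof -
    have "2 powr (a - scal u) < (1::real)"
      using a by (simp add: powr_less_one)
    then have "summable f"
      unfolding f_def by (intro summable_mult summable_geometric) simp
    moreover have "0 \<le> f j" for j
      by (simp add: f_def ballc_nonneg)
    ultimately show ?thesis
      unfolding infinity_ennreal_def less_top[symmetric] by (intro ennreal_suminf_neq_top)
  qed
  finally show ?thesis .
qed

end

section \<open>The Hardy operator and mean oscillation\<close>

lemma borel_representative:
  fixes f :: "'a::euclidean_space \<Rightarrow> complex"
  assumes "f \<in> borel_measurable lebesgue"
  obtains f' where "f' \<in> borel_measurable borel" "AE x in lborel. f x = f' x"
proof -
  have "(\<lambda>x. Re (f x)) \<in> borel_measurable lebesgue" "(\<lambda>x. Im (f x)) \<in> borel_measurable lebesgue"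
    using assms by measurable
  then obtain a b where ab: "a \<in> borel_measurable lborel" "AE x in lborel. Re (f x) = a x"
      "b \<in> borel_measurable lborel" "AE x in lborel. Im (f x) = b x"
    by (metis completion_ex_borel_measurable_real)
  then have [measurable]: "a \<in> borel_measurable borel" "b \<in> borel_measurable borel"
    by simp_all
  show thesis
  proof
    show "(\<lambda>x. Complex (a x) (b x)) \<in> borel_measurable borel"
      by (subst borel_measurable_complex_iff) simp
    show "AE x in lborel. f x = Complex (a x) (b x)"
      using ab(2,4) by eventually_elim (simp add: complex_eq_iff)
  qed
qed

text \<open>Every dilate of a null set is null, so exchanging the order of t and x shows that almost
  every ray meets a null set in a null set of parameters. The Hardy operator integrates along rays,
  hence changing f on a null set changes it only on a null set.\<close>

lemma AE_dilation:
  fixes P :: "real^'n \<Rightarrow> bool"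
  assumes "AE x in lborel. P x"
  shows "AE x in lborel. AE t in lborel. 0 < t \<longrightarrow> P (t *\<^sub>R x)"
proof -
  obtain M where M: "{x \<in> space lborel. \<not> P x} \<subseteq> M" "emeasure lborel M = 0" "M \<in> sets lborel"
    using assms by (rule AE_E)
  then have [measurable]: "M \<in> sets borel" by simp
  have "AE x in lborel. 0 < t \<longrightarrow> t *\<^sub>R x \<notin> M" for t
  proof (cases "0 < t")
    case True
    have "ennreal (t ^ CARD('n)) * (\<integral>\<^sup>+x. indicator M (t *\<^sub>R x) \<partial>(lborel :: (real^'n) measure)) = (\<integral>\<^sup>+x. indicator M x \<partial>lborel)"
      using nn_integral_block_lborel_scale[OF True, of "indicator M" UNIV] unfolding block_lborel_UNIV by simp
    also have "\<dots> = 0"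
      using M by simp
    finally have "(\<integral>\<^sup>+x. indicator M (t *\<^sub>R x) \<partial>(lborel :: (real^'n) measure)) = 0"
      using True by simp
    then have "AE x in lborel. indicator M (t *\<^sub>R x) = (0::ennreal)"
      by (subst (asm) nn_integral_0_iff_AE) auto
    then show ?thesis
      by (auto simp: indicator_def split: if_splits elim!: eventually_mono)
  qed simp
  then have "AE t in lborel. AE x in lborel. 0 < t \<longrightarrow> t *\<^sub>R x \<notin> M"
    by simp
  then have "AE x in lborel. AE t in lborel. 0 < t \<longrightarrow> t *\<^sub>R x \<notin> M"
    by (subst lborel_pair.AE_commute) measurable
  then show ?thesis
    using M by (elim eventually_mono) auto
qed

lemma lebesgue_integral_borel_representative:
  fixes F G :: "real \<Rightarrow> complex"
  assumes [measurable]: "F \<in> borel_measurable borel" and ae: "AE t in lborel. G t = F t"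
  shows "integrable lebesgue G \<longleftrightarrow> integrable lborel F" "integral\<^sup>L lebesgue G = integral\<^sup>L lborel F"
proof -
  have F: "F \<in> borel_measurable lebesgue"
    by (intro measurable_completion) simp
  have ae': "AE t in lebesgue. F t = G t"
    using ae by (subst AE_completion_iff) (auto elim: eventually_mono)
  have G: "G \<in> borel_measurable lebesgue"
    using borel_measurable_AE[OF F ae'] .
  show "integrable lebesgue G \<longleftrightarrow> integrable lborel F"
    using integrable_cong_AE[OF F G ae'] by (simp add: integrable_completion)
  show "integral\<^sup>L lebesgue G = integral\<^sup>L lborel F"
    using integral_cong_AE[OF F G ae'] by (simp add: integral_completion)
qed

context dunkl_blocks
begin

section \<open>Dunkl null sets and the Morrey norm on balls\<close>

lemma dimk_pos: "0 < dimk"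
proof -
  have "0 \<le> (\<Sum>j\<in>UNIV. k $ j)"
    by (intro sum_nonneg k_nonneg)
  moreover have "0 < CARD('n)"
    by simp
  ultimately show ?thesis
    by (simp add: hom_dim_def add_pos_nonneg)
qed

lemma AE_dunkl_iff: "(AE x in dunkl_measure k. P x) \<longleftrightarrow> (AE x in lborel. P x)"
proof -
  have "(AE x in dunkl_measure k. P x) \<longleftrightarrow> (AE x in lborel. 0 < dunkl_weight k UNIV x \<longrightarrow> P x)"
    unfolding dunkl_measure_def
    by (subst AE_density) (auto simp: AE_completion_iff intro!: measurable_completion)
  also have "\<dots> \<longleftrightarrow> (AE x in lborel. P x)"
  proof
    assume "AE x in lborel. 0 < dunkl_weight k UNIV x \<longrightarrow> P x"
    with AE_dunkl_weight_pos show "AE x in lborel. P x"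
      by eventually_elim simp
  qed (auto elim: eventually_mono)
  finally show ?thesis .
qed

lemma morrey_norm_eq:
  "morrey_norm blk m k p u w f = (SUP R\<in>{0<..}. ennreal ((R powr dimk * vol) powr (1 / p - scal u / dimk))
     * mn u w (\<lambda>x. ennreal (norm (f x)) * indicator (ball 0 R) x))"
  unfolding morrey_norm_def mixed_norm_eq_mn
proof (intro SUP_cong refl)
  fix R :: real assume R: "R \<in> {0<..}"
  have "ennreal (norm (f x * indicator (ball 0 R) x)) = ennreal (norm (f x)) * indicator (ball 0 R) x" for x
    by (auto simp: indicator_def)
  then show "ennreal (measure (dunkl_measure k) (ball 0 R) powr (1 / p - (\<Sum>i = 1..m. N i / u i) / dimk)) *
      mn u w (\<lambda>x. ennreal (norm (f x * indicator (ball 0 R) x))) =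
    ennreal ((R powr dimk * vol) powr (1 / p - scal u / dimk)) * mn u w (\<lambda>x. ennreal (norm (f x)) * indicator (ball 0 R) x)"
    using R by (simp add: measure_dunkl_ball scal_def)
qed

lemma vol_powr:
  assumes "0 < R"
  shows "(R powr dimk * vol) powr (1 / p - scal u / dimk) = R powr (dimk / p - scal u) * vol powr (1 / p - scal u / dimk)"
    "(R powr dimk * vol) powr (scal u / dimk - 1 / p) = R powr (scal u - dimk / p) * vol powr (scal u / dimk - 1 / p)"
proof -
  have "dimk * (1 / p - scal u / dimk) = dimk / p - scal u" "dimk * (scal u / dimk - 1 / p) = scal u - dimk / p"
    using dimk_pos by (simp_all add: algebra_simps)
  then show "(R powr dimk * vol) powr (1 / p - scal u / dimk) = R powr (dimk / p - scal u) * vol powr (1 / p - scal u / dimk)"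
    "(R powr dimk * vol) powr (scal u / dimk - 1 / p) = R powr (scal u - dimk / p) * vol powr (scal u / dimk - 1 / p)"
    using vol_pos by (simp_all add: powr_mult powr_powr)
qed

lemma mn_le_morrey:
  assumes "0 < R"
  shows "mn u w (\<lambda>x. ennreal (norm (f x)) * indicator (ball 0 R) x)
    \<le> ennreal (R powr (scal u - dimk / p) * vol powr (scal u / dimk - 1 / p)) * morrey_norm blk m k p u w f"
proof -
  define c where "c = (R powr dimk * vol) powr (1 / p - scal u / dimk)"
  define d where "d = (R powr dimk * vol) powr (scal u / dimk - 1 / p)"
  have "d * c = 1"
    using assms vol_pos by (simp add: c_def d_def powr_add[symmetric])
  then have dc: "ennreal d * ennreal c = 1"
    by (simp add: ennreal_mult[symmetric] c_def d_def)
  have "ennreal c * mn u w (\<lambda>x. ennreal (norm (f x)) * indicator (ball 0 R) x) \<le> morrey_norm blk m k p u w f"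
    unfolding morrey_norm_eq c_def using assms by (intro SUP_upper2[of R]) auto
  then have "ennreal d * (ennreal c * mn u w (\<lambda>x. ennreal (norm (f x)) * indicator (ball 0 R) x)) \<le> ennreal d * morrey_norm blk m k p u w f"
    by (rule mult_left_mono) simp
  then show ?thesis
    unfolding mult.assoc[symmetric] dc using vol_powr(2)[OF assms, of u p] by (simp add: d_def)
qed

lemma morrey_norm_cong_AE:
  assumes "AE x in lborel. f x = g x" "pos_exp u" "pos_exp w"
  shows "morrey_norm blk m k p u w f = morrey_norm blk m k p u w g"
  unfolding morrey_norm_eq
  using assms by (intro SUP_cong refl arg_cong2[of _ _ _ _ "(*)"] mn_cong_AE) (auto elim: eventually_mono)

lemma mn_zero: "pos_exp u \<Longrightarrow> pos_exp w \<Longrightarrow> mn u w (\<lambda>_. 0) = 0"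
  using mn_cmult[of "\<lambda>_. 0" u w 0] by simp

lemma scal_add:
  assumes "\<And>i. i \<in> {1..m} \<Longrightarrow> 1 / s i = 1 / r i + 1 / q i"
  shows "scal s = scal r + scal q"
proof -
  have "N i / s i = N i / r i + N i / q i" if "i \<in> {1..m}" for i
  proof -
    have "N i / s i = N i * (1 / s i)"
      by simp
    then show ?thesis
      unfolding assms[OF that] by (simp add: algebra_simps)
  qed
  then show ?thesis
    unfolding scal_def sum.distrib[symmetric] by (intro sum.cong refl)
qed

text \<open>
  With \<open>A x t = |b x - b (t x)|\<close> this estimates the commutator; \<open>A x t = 1 + |b (t x)|\<close> gives its
  existence almost everywhere.
\<close>

lemma mn_hardy_le:
  fixes f :: "real^'n \<Rightarrow> complex" and \<phi> :: "real \<Rightarrow> real" and A :: "real^'n \<Rightarrow> real \<Rightarrow> ennreal"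
  assumes [measurable]: "f \<in> borel_measurable borel" "\<phi> \<in> borel_measurable borel"
      "case_prod A \<in> borel_measurable (borel \<Otimes>\<^sub>M borel)"
    and \<phi>: "\<And>t. 0 \<le> \<phi> t" "\<And>t. t \<notin> {0<..1} \<Longrightarrow> \<phi> t = 0"
    and ex: "exp_gt1 s" "exp_gt1 s'" "exp_gt1 r" "exp_gt1 r'" "exp_gt1 q" "exp_gt1 q'"
    and conj: "\<And>i. i \<in> {1..m} \<Longrightarrow> 1 / s i = 1 / r i + 1 / q i"
      "\<And>i. i \<in> {1..m} \<Longrightarrow> 1 / s' i = 1 / r' i + 1 / q' i"
    and R: "0 < R" and M: "0 \<le> M"
    and A: "\<And>t. t \<in> {0<..1} \<Longrightarrow> mn q q' (\<lambda>x. A x t * indicator (ball 0 R) x)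
      \<le> ennreal (M * ln (2 / t)) * mn q q' (indicator (ball 0 R))"
  shows "mn s s' (\<lambda>x. (\<integral>\<^sup>+t. A x t * ennreal (norm (f (t *\<^sub>R x)) * \<phi> t) \<partial>lborel) * indicator (ball 0 R) x)
    \<le> ennreal (M * (ballc q q' * vol powr (scal r / dimk - 1 / p)) * R powr (scal s - dimk / p))
      * (morrey_norm blk m k p r r' f * (\<integral>\<^sup>+t. ennreal (t powr (- dimk / p) * \<phi> t * ln (2 / t)) \<partial>lborel))"
proof -
  note pos = ex[THEN exp_gt1_pos]
  define F where "F = morrey_norm blk m k p r r' f"
  define c where "c = M * (ballc q q' * vol powr (scal r / dimk - 1 / p)) * R powr (scal s - dimk / p)"
  have c: "0 \<le> c"
    using M by (simp add: c_def ballc_nonneg)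
  have "mn s s' (\<lambda>x. (\<integral>\<^sup>+t. A x t * ennreal (norm (f (t *\<^sub>R x)) * \<phi> t) \<partial>lborel) * indicator (ball 0 R) x)
      = mn s s' (\<lambda>x. \<integral>\<^sup>+t. A x t * ennreal (norm (f (t *\<^sub>R x)) * \<phi> t) * indicator (ball 0 R) x \<partial>lborel)"
    by (rule arg_cong[of _ _ "mn s s'"], rule ext) (simp add: nn_integral_multc)
  also have "\<dots> \<le> (\<integral>\<^sup>+t. mn s s' (\<lambda>x. A x t * ennreal (norm (f (t *\<^sub>R x)) * \<phi> t) * indicator (ball 0 R) x) \<partial>lborel)"
    using ex by (intro mn_Minkowski sigma_finite_lborel) measurable
  also have "\<dots> \<le> (\<integral>\<^sup>+t. (ennreal c * F) * ennreal (t powr (- dimk / p) * \<phi> t * ln (2 / t)) \<partial>lborel)"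
  proof (rule nn_integral_mono)
    fix t :: real
    show "mn s s' (\<lambda>x. A x t * ennreal (norm (f (t *\<^sub>R x)) * \<phi> t) * indicator (ball 0 R) x)
      \<le> (ennreal c * F) * ennreal (t powr (- dimk / p) * \<phi> t * ln (2 / t))"
    proof (cases "t \<in> {0<..1}")
      case False
      then have "mn s s' (\<lambda>x. A x t * ennreal (norm (f (t *\<^sub>R x)) * \<phi> t) * indicator (ball 0 R) x) = 0"
        using \<phi>(2) pos by (simp add: mn_zero)
      then show ?thesis by simp
    next
      case True
      then have t: "0 < t" "0 \<le> ln (2 / t)"
        by auto
      \<comment> \<open>f is cut off to the ball of radius t R before dilation: this is the quantity
        that the Morrey norm controls, and its dilate is f(t x) cut off to the ball of radius
        R.\<close>
      define g where "g z = ennreal (norm (f z)) * indicator (ball 0 (t * R)) z" for z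
      have [measurable]: "g \<in> borel_measurable borel"
        unfolding g_def by measurable
      have g: "g (t *\<^sub>R x) = ennreal (norm (f (t *\<^sub>R x))) * indicator (ball 0 R) x" for x
        unfolding g_def by (subst indicator_ball_scale[OF t(1), of R x]) (rule refl)
      have [measurable]: "(\<lambda>x. A x t) \<in> borel_measurable borel"
        by measurable
      have "mn s s' (\<lambda>x. A x t * ennreal (norm (f (t *\<^sub>R x)) * \<phi> t) * indicator (ball 0 R) x)
        = mn s s' (\<lambda>x. ennreal (\<phi> t) * ((A x t * indicator (ball 0 R) x) * g (t *\<^sub>R x)))"
        by (rule arg_cong[of _ _ "mn s s'"], rule ext)
           (auto simp: g ennreal_mult \<phi>(1) indicator_def ac_simps)
      also have "\<dots> = ennreal (\<phi> t) * mn s s' (\<lambda>x. (A x t * indicator (ball 0 R) x) * g (t *\<^sub>R x))"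
        using pos by (intro mn_cmult) measurable
      also have "\<dots> \<le> ennreal (\<phi> t) * mn s s' (\<lambda>x. g (t *\<^sub>R x) * (A x t * indicator (ball 0 R) x))"
        by (simp add: mult.commute)
      also have "\<dots> \<le> ennreal (\<phi> t) * (mn r r' (\<lambda>x. g (t *\<^sub>R x)) * mn q q' (\<lambda>x. A x t * indicator (ball 0 R) x))"
        using pos by (intro mult_left_mono mn_Holder conj) (simp_all, measurable)
      also have "mn r r' (\<lambda>x. g (t *\<^sub>R x)) = ennreal (t powr - scal r) * mn r r' g"
        using pos t by (intro mn_scale) auto
      also have "ennreal (\<phi> t) * (ennreal (t powr - scal r) * mn r r' g * mn q q' (\<lambda>x. A x t * indicator (ball 0 R) x))
        \<le> ennreal (\<phi> t) * (ennreal (t powr - scal r)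
            * (ennreal ((t * R) powr (scal r - dimk / p) * vol powr (scal r / dimk - 1 / p)) * F)
            * (ennreal (M * ln (2 / t)) * ennreal (R powr scal q * ballc q q')))"
      proof (intro mult_left_mono mult_mono)
        show "mn r r' g \<le> ennreal ((t * R) powr (scal r - dimk / p) * vol powr (scal r / dimk - 1 / p)) * F"
          unfolding g_def F_def using t R by (intro mn_le_morrey) auto
        show "mn q q' (\<lambda>x. A x t * indicator (ball 0 R) x) \<le> ennreal (M * ln (2 / t)) * ennreal (R powr scal q * ballc q q')"
          using A[OF True] pos R by (simp add: mn_ball)
      qed auto
      also have "\<dots> = (ennreal (\<phi> t) * ennreal (t powr - scal r)
            * ennreal ((t * R) powr (scal r - dimk / p) * vol powr (scal r / dimk - 1 / p))
            * ennreal (M * ln (2 / t)) * ennreal (R powr scal q * ballc q q')) * F"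
        by (simp only: ac_simps)
      also have "ennreal (\<phi> t) * ennreal (t powr - scal r)
            * ennreal ((t * R) powr (scal r - dimk / p) * vol powr (scal r / dimk - 1 / p))
            * ennreal (M * ln (2 / t)) * ennreal (R powr scal q * ballc q q')
          = ennreal (\<phi> t * t powr - scal r * ((t * R) powr (scal r - dimk / p) * vol powr (scal r / dimk - 1 / p))
            * (M * ln (2 / t)) * (R powr scal q * ballc q q'))"
        using t M \<phi>(1) by (simp add: ennreal_mult ballc_nonneg)
      also have "\<phi> t * t powr - scal r * ((t * R) powr (scal r - dimk / p) * vol powr (scal r / dimk - 1 / p))
            * (M * ln (2 / t)) * (R powr scal q * ballc q q')
          = c * (t powr (- dimk / p) * \<phi> t * ln (2 / t))"
      proof -
        \<comment> \<open>The power of t combines the dilation with the Morrey bound on radius t R;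
          the power of R combines that bound with the norm of the indicator.\<close>
        have 1: "t powr (- dimk / p) = t powr - scal r * t powr (scal r - dimk / p)"
          by (simp add: powr_add[symmetric])
        have scal: "scal s = scal r + scal q"
          by (rule scal_add) (rule conj(1))
        have 2: "R powr (scal s - dimk / p) = R powr (scal r - dimk / p) * R powr scal q"
          unfolding scal by (simp add: powr_add[symmetric] algebra_simps)
        have 3: "(t * R) powr (scal r - dimk / p) = t powr (scal r - dimk / p) * R powr (scal r - dimk / p)"
          using t R by (simp add: powr_mult)
        show ?thesis
          unfolding c_def 1 2 3 by (simp only: ac_simps)
      qed
      also have "ennreal (c * (t powr (- dimk / p) * \<phi> t * ln (2 / t))) = ennreal c * ennreal (t powr (- dimk / p) * \<phi> t * ln (2 / t))"
        using c t \<phi>(1) by (intro ennreal_mult) auto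
      finally show ?thesis by (simp only: ac_simps)
    qed
  qed
  also have "\<dots> = (ennreal c * F) * (\<integral>\<^sup>+t. ennreal (t powr (- dimk / p) * \<phi> t * ln (2 / t)) \<partial>lborel)"
    by (intro nn_integral_cmult) measurable
  finally show ?thesis
    by (simp add: c_def F_def mult.assoc)
qed

section \<open>Means over concentric balls\<close>

lemma borel_measurable_dunkl: "f \<in> borel_measurable borel \<Longrightarrow> f \<in> borel_measurable (dunkl_measure k)"
  unfolding dunkl_measure_def by (simp add: measurable_completion)

lemma ball_avg_diff_le:
  fixes b :: "real^'n \<Rightarrow> complex"
  assumes [measurable]: "b \<in> borel_measurable borel" and int: "set_integrable (dunkl_measure k) (ball 0 R) b"
    and R: "0 < R"
  shows "ennreal (norm (ball_avg k b R - c) * (R powr dimk * vol))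
    \<le> (\<integral>\<^sup>+x. ennreal (norm (b x - c)) * indicator (ball 0 R) x \<partial>dunkl_measure k)"
proof -
  let ?\<mu> = "dunkl_measure k"
  define V where "V = R powr dimk * vol"
  have V: "0 < V" "measure ?\<mu> (ball 0 R) = V" "emeasure ?\<mu> (ball 0 R) = ennreal V"
    using R vol_pos by (simp_all add: V_def measure_dunkl_ball emeasure_dunkl_ball)
  have intc: "set_integrable ?\<mu> (ball 0 R) (\<lambda>_. c)"
    unfolding set_integrable_def using V by (intro integrable_scaleR_left integrable_real_indicator) (simp_all add: ball_dunkl_sets)
  have eq: "(LINT x:ball 0 R|?\<mu>. b x - c) = V *\<^sub>R (ball_avg k b R - c)"
    using V int intc by (simp add: set_integral_const ball_dunkl_sets ball_avg_def scaleR_diff_right)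
  have "ennreal (norm (ball_avg k b R - c) * V) = ennreal (norm (LINT x:ball 0 R|?\<mu>. b x - c))"
    unfolding eq using V by (simp add: mult.commute)
  also have "\<dots> \<le> (\<integral>\<^sup>+x. ennreal (norm (indicator (ball 0 R) x *\<^sub>R (b x - c))) \<partial>?\<mu>)"
    unfolding set_lebesgue_integral_def
    by (intro integral_norm_bound_ennreal set_integral_diff(1)[OF int intc, unfolded set_integrable_def])
  also have "\<dots> = (\<integral>\<^sup>+x. ennreal (norm (b x - c)) * indicator (ball 0 R) x \<partial>?\<mu>)"
    by (intro nn_integral_cong) (auto simp: indicator_def)
  finally show ?thesis by (simp add: V_def)
qed

text \<open>The two ball norms come from Hoelder's inequality on the larger ball. The factor 2^N
  compares the volumes of balls whose radii differ by at most a factor 2, and \<open>vol\<close>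
  normalises the mean.\<close>

definition osc_const :: "(nat \<Rightarrow> real) \<Rightarrow> (nat \<Rightarrow> real) \<Rightarrow> real" where
  "osc_const u w = 2 powr dimk * (ballc u w * ballc (conj_exp u) (conj_exp w)) / vol"

lemma osc_const_nonneg: "0 \<le> osc_const u w"
  by (simp add: osc_const_def ballc_nonneg)

text \<open>The mean of |b - c| over the smaller ball is at most its integral over the larger ball
  divided by the smaller volume. The constant c is left free: it is the mean over the larger ball
  when radii are halved, and ln R, with equal radii, for the logarithm.\<close>

lemma ball_avg_diff_le_osc:
  fixes b :: "real^'n \<Rightarrow> complex"
  assumes [measurable]: "b \<in> borel_measurable borel" and int: "set_integrable (dunkl_measure k) (ball 0 R') b"
    and uw: "exp_gt1 u" "exp_gt1 w" and R: "0 < R'" "R' \<le> R" "R \<le> 2 * R'" and K: "0 \<le> K"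
    and le: "mn u w (\<lambda>x. ennreal (norm (b x - c)) * indicator (ball 0 R) x) \<le> ennreal K * mn u w (indicator (ball 0 R))"
  shows "norm (ball_avg k b R' - c) \<le> K * osc_const u w"
proof -
  note pos = uw[THEN exp_gt1_pos]
  have R0: "0 < R" using R by simp
  have "ennreal (norm (ball_avg k b R' - c) * (R' powr dimk * vol))
    \<le> (\<integral>\<^sup>+x. ennreal (norm (b x - c)) * indicator (ball 0 R') x \<partial>dunkl_measure k)"
    using R by (intro ball_avg_diff_le int) auto
  also have "\<dots> \<le> (\<integral>\<^sup>+x. ennreal (norm (b x - c)) * indicator (ball 0 R) x \<partial>dunkl_measure k)"
    using R by (intro nn_integral_mono) (auto simp: indicator_def)
  also have "\<dots> \<le> mn u w (\<lambda>x. ennreal (norm (b x - c)) * indicator (ball 0 R) x)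
      * ennreal (R powr (dimk - scal u) * ballc (conj_exp u) (conj_exp w))"
    using uw R0 by (intro nn_integral_le_mn) auto
  also have "\<dots> \<le> (ennreal K * ennreal (R powr scal u * ballc u w)) * ennreal (R powr (dimk - scal u) * ballc (conj_exp u) (conj_exp w))"
    using le pos R0 by (intro mult_right_mono) (simp_all add: mn_ball)
  also have "\<dots> = ennreal (K * (R powr scal u * ballc u w) * (R powr (dimk - scal u) * ballc (conj_exp u) (conj_exp w)))"
    using K by (simp add: ennreal_mult ballc_nonneg)
  also have "K * (R powr scal u * ballc u w) * (R powr (dimk - scal u) * ballc (conj_exp u) (conj_exp w))
      = K * (ballc u w * ballc (conj_exp u) (conj_exp w)) * R powr dimk"
  proof -
    have 1: "R powr dimk = R powr scal u * R powr (dimk - scal u)"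
      by (simp add: powr_add[symmetric])
    show ?thesis unfolding 1 by (simp only: ac_simps)
  qed
  finally have "norm (ball_avg k b R' - c) * (R' powr dimk * vol) \<le> K * (ballc u w * ballc (conj_exp u) (conj_exp w)) * R powr dimk"
    using K by (subst (asm) ennreal_le_iff) (simp_all add: ballc_nonneg)
  also have "R powr dimk \<le> 2 powr dimk * R' powr dimk"
  proof -
    have "R powr dimk \<le> (2 * R') powr dimk"
      using R dimk_pos by (intro powr_mono2) auto
    then show ?thesis using R by (simp add: powr_mult)
  qed
  finally have "norm (ball_avg k b R' - c) * (R' powr dimk * vol)
      \<le> K * (ballc u w * ballc (conj_exp u) (conj_exp w)) * (2 powr dimk * R' powr dimk)"
    using K by (simp add: mult_left_mono ballc_nonneg)
  also have "\<dots> = K * osc_const u w * (R' powr dimk * vol)"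
    using vol_pos by (simp add: osc_const_def)
  finally show ?thesis
    using R vol_pos by (simp add: mult_le_cancel_right)
qed

lemma ball_avg_log_growth:
  fixes b :: "real^'n \<Rightarrow> complex"
  assumes "b \<in> borel_measurable borel" and int: "\<And>R. set_integrable (dunkl_measure k) (ball 0 R) b"
    and uw: "exp_gt1 u" "exp_gt1 w" and K: "0 \<le> K"
    and le: "\<And>R. 0 < R \<Longrightarrow> mn u w (\<lambda>x. ennreal (norm (b x - ball_avg k b R)) * indicator (ball 0 R) x)
      \<le> ennreal K * mn u w (indicator (ball 0 R))"
    and R: "0 < R" and t: "t \<in> {0<..1}"
  shows "norm (ball_avg k b (t * R) - ball_avg k b R) \<le> K * osc_const u w / ln 2 * ln (2 / t)"
proof -
  define c where "c = K * osc_const u w"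
  have c: "0 \<le> c"
    using K by (simp add: c_def osc_const_nonneg)
  have step: "norm (ball_avg k b R' - ball_avg k b R) \<le> c" if "0 < R'" "R' \<le> R" "R \<le> 2 * R'" for R R'
    unfolding c_def using that by (intro ball_avg_diff_le_osc[OF assms(1) int uw _ _ _ K le]) auto
  have dyadic: "norm (ball_avg k b (t * R) - ball_avg k b R) \<le> real n * c"
    if "t \<in> {0<..1}" "2 powr - real n \<le> t" for n t
    using that
  proof (induction n arbitrary: t)
    case 0
    then have "t = 1" by simp
    then show ?case by simp
  next
    case (Suc n)
    show ?case
    \<comment> \<open>For t >= 1/2 one comparison reaches R. Otherwise the induction hypothesis
      leads from R to 2 t R, and one more halving to t R.\<close>
    proof (cases "1 \<le> 2 * t")
      case True
      have "norm (ball_avg k b (t * R) - ball_avg k b R) \<le> c"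
        using Suc.prems R True by (intro step) (auto simp: mult_le_cancel_right)
      moreover have "1 * c \<le> real (Suc n) * c"
        using c by (intro mult_right_mono) auto
      ultimately show ?thesis by linarith
    next
      case False
      have "2 powr - real (Suc n) = 2 powr - real n / 2"
        by (simp add: powr_diff powr_minus_divide)
      then have "2 powr - real n \<le> 2 * t"
        using Suc.prems by simp
      then have "norm (ball_avg k b (2 * t * R) - ball_avg k b R) \<le> real n * c"
        using False Suc.prems by (intro Suc.IH) auto
      moreover have "norm (ball_avg k b (t * R) - ball_avg k b (2 * t * R)) \<le> c"
        using Suc.prems R by (intro step) auto
      ultimately have "norm (ball_avg k b (t * R) - ball_avg k b R) \<le> c + real n * c"
        using norm_triangle_ineq[of "ball_avg k b (t * R) - ball_avg k b (2 * t * R)" "ball_avg k b (2 * t * R) - ball_avg k b R"]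
        by simp
      then show ?thesis by (simp add: algebra_simps)
    qed
  qed
  define n where "n = nat \<lceil>log 2 (1 / t)\<rceil>"
  have l0: "0 \<le> log 2 (1 / t)"
    using t by simp
  have n: "log 2 (1 / t) \<le> real n" "real n \<le> log 2 (1 / t) + 1"
    using l0 unfolding n_def by linarith+
  have "2 powr - real n \<le> 2 powr - log 2 (1 / t)"
    using n by simp
  also have "\<dots> = t"
    using t by (simp add: log_divide)
  finally have "norm (ball_avg k b (t * R) - ball_avg k b R) \<le> real n * c"
    using t by (intro dyadic)
  also have "\<dots> \<le> (log 2 (1 / t) + 1) * c"
    using n c by (intro mult_right_mono)
  \<comment> \<open>The 1 gained by rounding up the number of halvings turns 1 / t into 2 /
    t.\<close>
  also have "log 2 (1 / t) + 1 = ln (2 / t) / ln 2"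
    using t by (simp add: log_def ln_div field_simps)
  finally show ?thesis
    by (simp add: c_def mult.commute)
qed

end

section \<open>Sufficiency\<close>

context dunkl_blocks
begin

text \<open>Membership in the CMO space for a Borel representative, with the quotient of norms
  multiplied out and K as a bound for the CMO norm.\<close>

definition osc_bound :: "(nat \<Rightarrow> real) \<Rightarrow> (nat \<Rightarrow> real) \<Rightarrow> (real ^ 'n \<Rightarrow> complex) \<Rightarrow> real \<Rightarrow> bool" where
  "osc_bound u w b K \<longleftrightarrow> b \<in> borel_measurable borel \<and> (\<forall>R. set_integrable (dunkl_measure k) (ball 0 R) b) \<and> 0 \<le> K \<and>
    (\<forall>R>0. mn u w (\<lambda>x. ennreal (norm (b x - ball_avg k b R)) * indicator (ball 0 R) x)
      \<le> ennreal K * mn u w (indicator (ball 0 R)))"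

lemma sets_dunkl_measure: "sets (dunkl_measure k) = sets lebesgue"
  by (simp add: dunkl_measure_def)

text \<open>Membership only speaks of integrability on compact sets; b is the pointwise limit of its
  cut-offs to growing balls, each of which is measurable.\<close>

lemma cmo_space_measurable:
  assumes "b \<in> cmo_space blk m k u w"
  shows "b \<in> borel_measurable lebesgue"
proof -
  have meas: "(\<lambda>x. indicator (cball 0 (real n)) x *\<^sub>R b x) \<in> borel_measurable lebesgue" for n
  proof -
    have "set_integrable (dunkl_measure k) (cball 0 (real n)) b"
      using assms by (simp add: cmo_space_def)
    then have "(\<lambda>x. indicator (cball 0 (real n)) x *\<^sub>R b x) \<in> borel_measurable (dunkl_measure k)"
      unfolding set_integrable_def by (rule borel_measurable_integrable)
    then show ?thesis
      using measurable_cong_sets[OF sets_dunkl_measure refl] by blast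
  qed
  show ?thesis
  proof (rule borel_measurable_LIMSEQ_metric[OF meas])
    fix x :: "real^'n"
    obtain n0 :: nat where n0: "norm x \<le> real n0"
      using real_arch_simple by blast
    have "eventually (\<lambda>n. indicator (cball 0 (real n)) x *\<^sub>R b x = b x) sequentially"
      using n0 by (intro eventually_sequentiallyI[of n0]) (auto simp: indicator_def)
    then show "(\<lambda>n. indicator (cball 0 (real n)) x *\<^sub>R b x) \<longlonglongrightarrow> b x"
      by (rule tendsto_eventually)
  qed
qed

lemma ball_avg_cong_AE:
  assumes "b \<in> borel_measurable lebesgue" "b' \<in> borel_measurable borel" "AE x in lborel. b x = b' x"
  shows "set_integrable (dunkl_measure k) (ball 0 R) b \<longleftrightarrow> set_integrable (dunkl_measure k) (ball 0 R) b'"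
    "ball_avg k b R = ball_avg k b' R"
proof -
  have ae: "AE x in dunkl_measure k. indicator (ball 0 R) x *\<^sub>R b x = indicator (ball 0 R) x *\<^sub>R b' x"
    unfolding AE_dunkl_iff using assms(3) by eventually_elim simp
  have [measurable]: "b \<in> borel_measurable (dunkl_measure k)"
    using assms(1) measurable_cong_sets[OF sets_dunkl_measure refl] by blast
  have [measurable]: "b' \<in> borel_measurable (dunkl_measure k)"
    using assms(2) by (rule borel_measurable_dunkl)
  have [measurable]: "ball 0 R \<in> sets (dunkl_measure k)"
    by (rule ball_dunkl_sets)
  have "integrable (dunkl_measure k) (\<lambda>x. indicator (ball 0 R) x *\<^sub>R b x) \<longleftrightarrow> integrable (dunkl_measure k) (\<lambda>x. indicator (ball 0 R) x *\<^sub>R b' x)"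
    by (rule integrable_cong_AE[OF _ _ ae]) measurable
  then show "set_integrable (dunkl_measure k) (ball 0 R) b \<longleftrightarrow> set_integrable (dunkl_measure k) (ball 0 R) b'"
    by (simp add: set_integrable_def)
  have "(\<integral>x. indicator (ball 0 R) x *\<^sub>R b x \<partial>dunkl_measure k) = (\<integral>x. indicator (ball 0 R) x *\<^sub>R b' x \<partial>dunkl_measure k)"
    by (rule integral_cong_AE[OF _ _ ae]) measurable
  then show "ball_avg k b R = ball_avg k b' R"
    by (simp add: ball_avg_def set_lebesgue_integral_def)
qed

lemma mixed_norm_indicator: "mixed_norm blk m k u w (indicator (ball 0 R)) = mn u w (indicator (ball 0 R))"
  unfolding mixed_norm_eq_mn by (rule arg_cong[of _ _ "mn u w"]) (auto simp: indicator_def)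

lemma mixed_norm_times_indicator:
  "mixed_norm blk m k u w (\<lambda>x. f x * indicator (ball 0 R) x) = mn u w (\<lambda>x. ennreal (norm (f x)) * indicator (ball 0 R) x)"
  unfolding mixed_norm_eq_mn by (rule arg_cong[of _ _ "mn u w"]) (auto simp: indicator_def)

lemma cmo_space_osc_bound:
  assumes b: "b \<in> cmo_space blk m k u w" and uw: "exp_gt1 u" "exp_gt1 w"
  obtains b' K where "AE x in lborel. b x = b' x" "osc_bound u w b' K"
proof -
  note pos = uw[THEN exp_gt1_pos]
  have bm: "b \<in> borel_measurable lebesgue"
    using b by (rule cmo_space_measurable)
  obtain b' where b': "b' \<in> borel_measurable borel" and ae: "AE x in lborel. b x = b' x"
    using borel_representative[OF bm] .
  define K where "K = enn2real (cmo_norm blk m k u w b)"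
  have K: "cmo_norm blk m k u w b = ennreal K" "0 \<le> K"
    using b by (auto simp: cmo_space_def K_def)
  show thesis
  proof
    show "AE x in lborel. b x = b' x" by fact
    show "osc_bound u w b' K"
      unfolding osc_bound_def
    proof (intro conjI allI impI b' K(2))
      fix R :: real
      have "set_integrable (dunkl_measure k) (cball 0 R) b"
        using b by (simp add: cmo_space_def)
      then have "set_integrable (dunkl_measure k) (ball 0 R) b"
        by (rule set_integrable_subset) (auto simp: ball_dunkl_sets)
      then show "set_integrable (dunkl_measure k) (ball 0 R) b'"
        using ball_avg_cong_AE(1)[OF bm b' ae] by simp
    next
      fix R :: real assume R: "0 < R"
      define X where "X = mixed_norm blk m k u w (\<lambda>x. (b x - ball_avg k b R) * indicator (ball 0 R) x)"
      \<comment> \<open>This denominator is positive and finite, so the quotient in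
        \<open>cmo_norm\<close> can be cleared.\<close>
      define Y where "Y = mixed_norm blk m k u w (indicator (ball 0 R))"
      have Y: "Y = mn u w (indicator (ball 0 R))" "Y = ennreal (R powr scal u * ballc u w)" "Y \<noteq> 0" "Y \<noteq> top"
        using R pos ballc_pos[OF uw] by (simp_all add: Y_def mixed_norm_indicator mn_ball)
      have "X / Y \<le> ennreal K"
        unfolding X_def Y_def K(1)[symmetric] cmo_norm_def using R by (intro SUP_upper) simp
      then have "X / Y * Y \<le> ennreal K * Y"
        by (rule mult_right_mono) simp
      moreover have "X / Y * Y = X"
        using Y(3) Y(4)[unfolded less_top] by (simp add: ennreal_divide_times ennreal_divide_self)
      moreover have "X = mn u w (\<lambda>x. ennreal (norm (b' x - ball_avg k b' R)) * indicator (ball 0 R) x)"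
        unfolding X_def mixed_norm_times_indicator ball_avg_cong_AE(2)[OF bm b' ae]
        using pos ae by (intro mn_cong_AE) (auto elim: eventually_mono)
      ultimately show "mn u w (\<lambda>x. ennreal (norm (b' x - ball_avg k b' R)) * indicator (ball 0 R) x)
          \<le> ennreal K * mn u w (indicator (ball 0 R))"
        by (simp add: Y(1))
    qed
  qed
qed

context
  fixes u w :: "nat \<Rightarrow> real" and b :: "real ^ 'n \<Rightarrow> complex" and K :: real
  assumes uw: "exp_gt1 u" "exp_gt1 w" and osc: "osc_bound u w b K"
begin

lemma osc_measurable [measurable]: "b \<in> borel_measurable borel"
  using osc by (simp add: osc_bound_def)

lemma osc_nonneg: "0 \<le> K"
  using osc by (simp add: osc_bound_def)

lemma osc_le: "0 < R \<Longrightarrow> mn u w (\<lambda>x. ennreal (norm (b x - ball_avg k b R)) * indicator (ball 0 R) x)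
      \<le> ennreal K * mn u w (indicator (ball 0 R))"
  using osc by (simp add: osc_bound_def)

text \<open>The oscillation bound on radius t R, pulled back to radius R: dilation multiplies both
  sides by the same power of t.\<close>

lemma osc_dilated_le:
  assumes R: "0 < R" and t: "0 < t"
  shows "mn u w (\<lambda>x. ennreal (norm (b (t *\<^sub>R x) - ball_avg k b (t * R))) * indicator (ball 0 R) x)
    \<le> ennreal K * mn u w (indicator (ball 0 R))"
proof -
  note pos = uw[THEN exp_gt1_pos]
  define g where "g z = ennreal (norm (b z - ball_avg k b (t * R))) * indicator (ball 0 (t * R)) z" for z
  have [measurable]: "g \<in> borel_measurable borel"
    unfolding g_def by measurable
  have "mn u w (\<lambda>x. ennreal (norm (b (t *\<^sub>R x) - ball_avg k b (t * R))) * indicator (ball 0 R) x) = mn u w (\<lambda>x. g (t *\<^sub>R x))"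
    unfolding g_def by (subst indicator_ball_scale[OF t, of R]) (rule refl)
  also have "\<dots> = ennreal (t powr - scal u) * mn u w g"
    using pos t by (intro mn_scale) auto
  also have "\<dots> \<le> ennreal (t powr - scal u) * (ennreal K * mn u w (indicator (ball 0 (t * R))))"
    unfolding g_def using R t by (intro mult_left_mono osc_le) auto
  also have "\<dots> = ennreal K * (ennreal (t powr - scal u) * mn u w (indicator (ball 0 (t * R))))"
    by (simp only: ac_simps)
  also have "ennreal (t powr - scal u) * mn u w (indicator (ball 0 (t * R))) = mn u w (\<lambda>x. indicator (ball 0 (t * R)) (t *\<^sub>R x))"
    using pos t by (intro mn_scale[symmetric]) auto
  also have "(\<lambda>x::real^'n. indicator (ball 0 (t * R)) (t *\<^sub>R x) :: ennreal) = indicator (ball 0 R)"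
    by (rule ext) (rule indicator_ball_scale[OF t, symmetric])
  finally show ?thesis .
qed

lemma osc_avg_growth:
  assumes "0 < R" "t \<in> {0<..1}"
  shows "norm (ball_avg k b (t * R) - ball_avg k b R) \<le> K * osc_const u w / ln 2 * ln (2 / t)"
  using osc assms uw by (intro ball_avg_log_growth) (auto simp: osc_bound_def)

text \<open>The two means are inserted between b x and b (t x). The outer differences are
  oscillations on radius R and, after dilation, on radius t R; the middle one is the logarithmic
  growth of the means.\<close>

lemma osc_difference_le:
  assumes R: "0 < R" and t: "t \<in> {0<..1}"
  shows "mn u w (\<lambda>x. ennreal (norm (b x - b (t *\<^sub>R x))) * indicator (ball 0 R) x)
    \<le> ennreal ((2 * K / ln 2 + K * osc_const u w / ln 2) * ln (2 / t)) * mn u w (indicator (ball 0 R))"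
proof -
  note pos = uw[THEN exp_gt1_pos]
  define a where "a = norm (ball_avg k b R - ball_avg k b (t * R))"
  define L where "L = ln (2 / t)"
  have L: "ln 2 \<le> L"
    using t by (simp add: L_def field_simps)
  have a: "a \<le> K * osc_const u w / ln 2 * L"
    using osc_avg_growth[OF R t] by (simp add: a_def L_def norm_minus_commute)
  let ?I = "indicator (ball 0 R) :: real^'n \<Rightarrow> ennreal"
  have "mn u w (\<lambda>x. ennreal (norm (b x - b (t *\<^sub>R x))) * ?I x)
    \<le> mn u w (\<lambda>x. ennreal (norm (b x - ball_avg k b R)) * ?I x + (ennreal a * ?I x + ennreal (norm (b (t *\<^sub>R x) - ball_avg k b (t * R))) * ?I x))"
  proof (intro mn_mono pos)
    fix x
    have "norm (b x - b (t *\<^sub>R x)) \<le> norm (b x - ball_avg k b R) + (a + norm (b (t *\<^sub>R x) - ball_avg k b (t * R)))"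
      unfolding a_def by norm
    then have "ennreal (norm (b x - b (t *\<^sub>R x))) \<le> ennreal (norm (b x - ball_avg k b R)) + (ennreal a + ennreal (norm (b (t *\<^sub>R x) - ball_avg k b (t * R))))"
      by (simp add: ennreal_plus[symmetric] a_def del: ennreal_plus)
    then show "ennreal (norm (b x - b (t *\<^sub>R x))) * ?I x \<le> ennreal (norm (b x - ball_avg k b R)) * ?I x + (ennreal a * ?I x + ennreal (norm (b (t *\<^sub>R x) - ball_avg k b (t * R))) * ?I x)"
      by (auto simp: indicator_def)
  qed
  also have "\<dots> \<le> mn u w (\<lambda>x. ennreal (norm (b x - ball_avg k b R)) * ?I x)
      + mn u w (\<lambda>x. ennreal a * ?I x + ennreal (norm (b (t *\<^sub>R x) - ball_avg k b (t * R))) * ?I x)"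
    using uw by (intro mn_add) measurable
  also have "\<dots> \<le> mn u w (\<lambda>x. ennreal (norm (b x - ball_avg k b R)) * ?I x)
      + (mn u w (\<lambda>x. ennreal a * ?I x) + mn u w (\<lambda>x. ennreal (norm (b (t *\<^sub>R x) - ball_avg k b (t * R))) * ?I x))"
    using uw by (intro add_left_mono mn_add) measurable
  also have "mn u w (\<lambda>x. ennreal a * ?I x) = ennreal a * mn u w ?I"
    using pos by (intro mn_cmult) auto
  also have "mn u w (\<lambda>x. ennreal (norm (b x - ball_avg k b R)) * ?I x)
      + (ennreal a * mn u w ?I + mn u w (\<lambda>x. ennreal (norm (b (t *\<^sub>R x) - ball_avg k b (t * R))) * ?I x))
    \<le> ennreal K * mn u w ?I + (ennreal a * mn u w ?I + ennreal K * mn u w ?I)"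
    using R t by (intro add_mono order.refl osc_le osc_dilated_le) auto
  also have "\<dots> = ennreal (K + (a + K)) * mn u w ?I"
  proof -
    have "0 \<le> a"
      by (simp add: a_def)
    then have "ennreal (K + (a + K)) = ennreal K + (ennreal a + ennreal K)"
      using osc_nonneg ennreal_plus[of K "a + K"] ennreal_plus[of a K] by simp
    then show ?thesis
      by (metis distrib_right)
  qed
  also have "\<dots> \<le> ennreal ((2 * K / ln 2 + K * osc_const u w / ln 2) * L) * mn u w ?I"
  proof (intro mult_right_mono ennreal_leI)
    \<comment> \<open>The two oscillations do not depend on t; they are absorbed using ln (2 / t) >=
      ln 2.\<close>
    have "2 * K = 2 * K / ln 2 * ln 2"
      by simp
    also have "\<dots> \<le> 2 * K / ln 2 * L"
      using L osc_nonneg by (intro mult_left_mono) auto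
    finally show "K + (a + K) \<le> (2 * K / ln 2 + K * osc_const u w / ln 2) * L"
      using a by (simp add: distrib_right)
  qed simp
  finally show ?thesis by (simp add: L_def)
qed

text \<open>The summand 1 serves the Hardy integral of f, the other one that of b f. The constant
  depends on R through the mean of b, which is harmless because only finiteness on each ball is
  drawn from it.\<close>

lemma osc_dilated_size_le:
  assumes R: "0 < R" and t: "t \<in> {0<..1}"
  shows "mn u w (\<lambda>x. (1 + ennreal (norm (b (t *\<^sub>R x)))) * indicator (ball 0 R) x)
    \<le> ennreal (((1 + norm (ball_avg k b R) + K) / ln 2 + K * osc_const u w / ln 2) * ln (2 / t)) * mn u w (indicator (ball 0 R))"
proof -
  note pos = uw[THEN exp_gt1_pos]
  define a where "a = 1 + norm (ball_avg k b R) + norm (ball_avg k b (t * R) - ball_avg k b R)"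
  define L where "L = ln (2 / t)"
  have L: "ln 2 \<le> L"
    using t by (simp add: L_def field_simps)
  have a: "a \<le> 1 + norm (ball_avg k b R) + K * osc_const u w / ln 2 * L" "0 \<le> a"
    using osc_avg_growth[OF R t] by (simp_all add: a_def L_def)
  let ?I = "indicator (ball 0 R) :: real^'n \<Rightarrow> ennreal"
  have "mn u w (\<lambda>x. (1 + ennreal (norm (b (t *\<^sub>R x)))) * ?I x)
    \<le> mn u w (\<lambda>x. ennreal a * ?I x + ennreal (norm (b (t *\<^sub>R x) - ball_avg k b (t * R))) * ?I x)"
  proof (intro mn_mono pos)
    fix x
    have "1 + norm (b (t *\<^sub>R x)) \<le> a + norm (b (t *\<^sub>R x) - ball_avg k b (t * R))"
      unfolding a_def by norm
    then have "ennreal (1 + norm (b (t *\<^sub>R x))) \<le> ennreal (a + norm (b (t *\<^sub>R x) - ball_avg k b (t * R)))"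
      by (rule ennreal_leI)
    then have "1 + ennreal (norm (b (t *\<^sub>R x))) \<le> ennreal a + ennreal (norm (b (t *\<^sub>R x) - ball_avg k b (t * R)))"
      using a(2) by simp
    then show "(1 + ennreal (norm (b (t *\<^sub>R x)))) * ?I x \<le> ennreal a * ?I x + ennreal (norm (b (t *\<^sub>R x) - ball_avg k b (t * R))) * ?I x"
      by (auto simp: indicator_def)
  qed
  also have "\<dots> \<le> mn u w (\<lambda>x. ennreal a * ?I x) + mn u w (\<lambda>x. ennreal (norm (b (t *\<^sub>R x) - ball_avg k b (t * R))) * ?I x)"
    using uw by (intro mn_add) measurable
  also have "mn u w (\<lambda>x. ennreal a * ?I x) = ennreal a * mn u w ?I"
    using pos by (intro mn_cmult) auto
  also have "ennreal a * mn u w ?I + mn u w (\<lambda>x. ennreal (norm (b (t *\<^sub>R x) - ball_avg k b (t * R))) * ?I x)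
    \<le> ennreal a * mn u w ?I + ennreal K * mn u w ?I"
    using R t by (intro add_mono order.refl osc_dilated_le) auto
  also have "\<dots> = ennreal (a + K) * mn u w ?I"
    using osc_nonneg a(2) by (simp add: distrib_right)
  also have "\<dots> \<le> ennreal (((1 + norm (ball_avg k b R) + K) / ln 2 + K * osc_const u w / ln 2) * L) * mn u w ?I"
  proof (intro mult_right_mono ennreal_leI)
    have "1 + norm (ball_avg k b R) + K = (1 + norm (ball_avg k b R) + K) / ln 2 * ln 2"
      by simp
    also have "\<dots> \<le> (1 + norm (ball_avg k b R) + K) / ln 2 * L"
      using L osc_nonneg by (intro mult_left_mono) auto
    finally show "a + K \<le> ((1 + norm (ball_avg k b R) + K) / ln 2 + K * osc_const u w / ln 2) * L"
      using a(1) by (simp add: distrib_right)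
  qed simp
  finally show ?thesis by (simp add: L_def)
qed

end

lemma commutator_bounded_if_integral_finite:
  fixes b :: "real^'n \<Rightarrow> complex" and \<phi> :: "real \<Rightarrow> real"
  assumes b: "b \<in> cmo_space blk m k q q'"
    and ex: "exp_gt1 s" "exp_gt1 s'" "exp_gt1 r" "exp_gt1 r'" "exp_gt1 q" "exp_gt1 q'"
    and conj: "\<And>i. i \<in> {1..m} \<Longrightarrow> 1 / s i = 1 / r i + 1 / q i"
      "\<And>i. i \<in> {1..m} \<Longrightarrow> 1 / s' i = 1 / r' i + 1 / q' i"
    and \<phi>: "\<And>t. t \<in> {0<..1} \<Longrightarrow> 0 \<le> \<phi> t" "set_integrable lebesgue {0<..1} \<phi>"
    and I: "(\<integral>\<^sup>+t\<in>{0<..1}. ennreal (t powr (- dimk / p) * \<phi> t * ln (2 / t)) \<partial>lebesgue) < \<infinity>"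
  shows "commutator_bounded blk m k p r r' s s' \<phi> b"
proof -
  note pos = ex[THEN exp_gt1_pos]
  obtain b' K where b': "AE x in lborel. b x = b' x" and osc: "osc_bound q q' b' K"
    using cmo_space_osc_bound[OF b ex(5,6)] .
  note [measurable] = osc_measurable[OF ex(5,6) osc]
  have K: "0 \<le> K" by (rule osc_nonneg[OF ex(5,6) osc])
  have "(\<lambda>t. indicator {0<..1} t *\<^sub>R \<phi> t) \<in> borel_measurable lebesgue"
    using \<phi>(2) unfolding set_integrable_def by (rule borel_measurable_integrable)
  then obtain \<phi>0 where \<phi>0: "\<phi>0 \<in> borel_measurable lborel" "AE t in lborel. indicator {0<..1} t *\<^sub>R \<phi> t = \<phi>0 t"
    using completion_ex_borel_measurable_real by blast
  \<comment> \<open>A Borel version of \<phi> whose sign and support conditions hold at every point,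
    as \<open>mn_hardy_le\<close> demands; the representative itself has them only almost
    everywhere.\<close>
  define \<psi> where "\<psi> t = max 0 (\<phi>0 t) * indicator {0<..1} t" for t
  have \<psi>m [measurable]: "\<psi> \<in> borel_measurable borel"
    using \<phi>0(1) unfolding \<psi>_def by measurable
  have \<psi>: "0 \<le> \<psi> t" "t \<notin> {0<..1} \<Longrightarrow> \<psi> t = 0" for t
    by (auto simp: \<psi>_def)
  have \<psi>_ae: "AE t in lborel. \<psi> t = indicator {0<..1} t * \<phi> t"
    using \<phi>0(2)
  proof eventually_elim
    case (elim t)
    then show ?case
      using \<phi>(1)[of t] by (cases "t \<in> {0<..1}") (auto simp: \<psi>_def)
  qed
  define I where "I = (\<integral>\<^sup>+t. ennreal (t powr (- dimk / p) * \<psi> t * ln (2 / t)) \<partial>lborel)"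
  have "I = (\<integral>\<^sup>+t\<in>{0<..1}. ennreal (t powr (- dimk / p) * \<phi> t * ln (2 / t)) \<partial>lebesgue)"
    unfolding I_def nn_integral_completion using \<psi>_ae
    by (intro nn_integral_cong_AE) (auto simp: indicator_def elim!: eventually_mono)
  then have I: "I < \<infinity>"
    using assms(12) by (simp only:)
  define M where "M = 2 * K / ln 2 + K * osc_const q q' / ln 2"
  have M: "0 \<le> M"
    using K by (simp add: M_def osc_const_nonneg)
  define c where "c = M * (ballc q q' * vol powr (scal r / dimk - 1 / p))"
  have c: "0 \<le> c"
    using M by (simp add: c_def ballc_nonneg)
  \<comment> \<open>What remains of the Morrey prefactor and the norm estimate after the powers of R
    have cancelled; it depends neither on f nor on R.\<close>
  define C where "C = vol powr (1 / p - scal s / dimk) * c * enn2real I"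
  show ?thesis
    unfolding commutator_bounded_def
  proof (intro exI[of _ C] ballI)
    fix f assume f: "f \<in> morrey_space blk m k p r r'"
    then obtain f' where f'm [measurable]: "f' \<in> borel_measurable borel" and f': "AE x in lborel. f x = f' x"
      using borel_representative by (auto simp: morrey_space_def)
    define F where "F = morrey_norm blk m k p r r' f"
    have F: "F = morrey_norm blk m k p r r' f'" "F < \<infinity>"
      using f f' pos by (auto simp: F_def morrey_space_def intro: morrey_norm_cong_AE)
    \<comment> \<open>A common majorant for the absolute integrals of both Hardy integrands at
      x.\<close>
    define E where "E x = (\<integral>\<^sup>+t. (1 + ennreal (norm (b' (t *\<^sub>R x)))) * ennreal (norm (f' (t *\<^sub>R x)) * \<psi> t) \<partial>lborel)" for x
    have [measurable]: "E \<in> borel_measurable borel"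
      unfolding E_def by measurable
    have E_ball: "AE x in lborel. E x * indicator (ball 0 R) x \<noteq> \<infinity>" if R: "0 < R" for R
    proof -
      define M2 where "M2 = (1 + norm (ball_avg k b' R) + K) / ln 2 + K * osc_const q q' / ln 2"
      have "mn s s' (\<lambda>x. E x * indicator (ball 0 R) x)
        \<le> ennreal (M2 * (ballc q q' * vol powr (scal r / dimk - 1 / p)) * R powr (scal s - dimk / p)) * (F * I)"
        unfolding E_def F(1) I_def
      proof (rule mn_hardy_le[OF f'm \<psi>m _ \<psi> ex conj R])
        show "(\<lambda>(x, t). 1 + ennreal (norm (b' (t *\<^sub>R x)))) \<in> borel_measurable (borel \<Otimes>\<^sub>M borel)"
          by measurable
        show "0 \<le> M2"
          using K by (simp add: M2_def osc_const_nonneg)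
        show "mn q q' (\<lambda>x. (1 + ennreal (norm (b' (t *\<^sub>R x)))) * indicator (ball 0 R) x) \<le> ennreal (M2 * ln (2 / t)) * mn q q' (indicator (ball 0 R))"
          if "t \<in> {0<..1}" for t
          unfolding M2_def by (rule osc_dilated_size_le[OF ex(5,6) osc R that])
      qed
      also have "\<dots> < \<infinity>"
        using F(2) I by (simp add: ennreal_mult_less_top)
      finally have fin: "mn s s' (\<lambda>x. E x * indicator (ball 0 R) x) < \<infinity>" .
      \<comment> \<open>A finite mixed norm on the ball bounds the Dunkl integral there, so E is
        finite at almost every point of the ball.\<close>
      have "(\<integral>\<^sup>+x. E x * indicator (ball 0 R) x \<partial>dunkl_measure k)
        \<le> mn s s' (\<lambda>x. E x * indicator (ball 0 R) x) * ennreal (R powr (dimk - scal s) * ballc (conj_exp s) (conj_exp s'))"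
        using ex R by (intro nn_integral_le_mn) auto
      also have "\<dots> < \<infinity>"
        using fin by (simp add: ennreal_mult_less_top)
      finally have "AE x in dunkl_measure k. E x * indicator (ball 0 R) x \<noteq> \<infinity>"
        by (intro nn_integral_noteq_infinite borel_measurable_dunkl) auto
      then show ?thesis
        by (simp only: AE_dunkl_iff)
    qed
    have E_fin: "AE x in lborel. E x < \<infinity>"
    proof -
      have "AE x in lborel. \<forall>n::nat. E x * indicator (ball 0 (real (Suc n))) x \<noteq> \<infinity>"
        unfolding AE_all_countable using E_ball by (metis of_nat_0_less_iff zero_less_Suc)
      then show ?thesis
      proof eventually_elim
        case (elim x)
        obtain n :: nat where "norm x \<le> real n"
          using real_arch_simple by blast
        then have "x \<in> ball 0 (real (Suc n))" by simp
        then show ?case using elim[rule_format, of n] by (simp add: less_top)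
      qed
    qed
    define G0 where "G0 x t = f' (t *\<^sub>R x) * complex_of_real (\<psi> t)" for x t
    define G1 where "G1 x t = b' (t *\<^sub>R x) * f' (t *\<^sub>R x) * complex_of_real (\<psi> t)" for x t
    have [measurable]: "case_prod G0 \<in> borel_measurable (borel \<Otimes>\<^sub>M borel)" "case_prod G1 \<in> borel_measurable (borel \<Otimes>\<^sub>M borel)"
      unfolding G0_def G1_def by measurable
    have G0x [measurable]: "G0 x \<in> borel_measurable borel" and G1x [measurable]: "G1 x \<in> borel_measurable borel" for x
      unfolding G0_def[abs_def] G1_def[abs_def] by measurable
    have int: "integrable lborel (G0 x)" "integrable lborel (G1 x)" if "E x < \<infinity>" for x
    proof -
      have le: "norm (G0 x t) \<le> (1 + norm (b' (t *\<^sub>R x))) * (norm (f' (t *\<^sub>R x)) * \<psi> t)"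
        "norm (G1 x t) \<le> (1 + norm (b' (t *\<^sub>R x))) * (norm (f' (t *\<^sub>R x)) * \<psi> t)" for t
        using \<psi>(1)[of t] by (simp_all add: G0_def G1_def norm_mult distrib_right)
      have eq: "ennreal ((1 + norm (b' (t *\<^sub>R x))) * (norm (f' (t *\<^sub>R x)) * \<psi> t))
        = (1 + ennreal (norm (b' (t *\<^sub>R x)))) * ennreal (norm (f' (t *\<^sub>R x)) * \<psi> t)" for t
        using \<psi>(1)[of t] by (simp add: ennreal_mult ennreal_plus ennreal_1[symmetric] del: ennreal_1)
      have "(\<integral>\<^sup>+t. norm (G0 x t) \<partial>lborel) \<le> E x" "(\<integral>\<^sup>+t. norm (G1 x t) \<partial>lborel) \<le> E x"
        unfolding E_def eq[symmetric] using le by (intro nn_integral_mono ennreal_leI; simp)+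
      then have "(\<integral>\<^sup>+t. norm (G0 x t) \<partial>lborel) < \<infinity>" "(\<integral>\<^sup>+t. norm (G1 x t) \<partial>lborel) < \<infinity>"
        using that by (blast intro: le_less_trans)+
      then show "integrable lborel (G0 x)" "integrable lborel (G1 x)"
        by (auto intro!: integrableI_bounded)
    qed
    have reps: "AE x in lborel. (AE t in lborel. indicator {0<..1} t *\<^sub>R (f (t *\<^sub>R x) * complex_of_real (\<phi> t)) = G0 x t) \<and>
        (AE t in lborel. indicator {0<..1} t *\<^sub>R (b (t *\<^sub>R x) * f (t *\<^sub>R x) * complex_of_real (\<phi> t)) = G1 x t)"
      using AE_dilation[OF f'] AE_dilation[OF b']
    proof eventually_elim
      case (elim x)
      from elim \<psi>_ae have "AE t in lborel. indicator {0<..1} t *\<^sub>R (f (t *\<^sub>R x) * complex_of_real (\<phi> t)) = G0 x t \<and>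
        indicator {0<..1} t *\<^sub>R (b (t *\<^sub>R x) * f (t *\<^sub>R x) * complex_of_real (\<phi> t)) = G1 x t"
        by eventually_elim (auto simp: G0_def G1_def indicator_def)
      then show ?case by simp
    qed
    define D where "D x = b' x * integral\<^sup>L lborel (G0 x) - integral\<^sup>L lborel (G1 x)" for x
    have [measurable]: "D \<in> borel_measurable borel"
      unfolding D_def by measurable
    \<comment> \<open>The equality with D also covers points where an integral fails to exist, since
      both Bochner integrals then have the default value 0. D is Borel, which later makes the
      commutator Lebesgue measurable; finiteness of E is used only for existence.\<close>
    have comm_eq: "AE x in lborel. commutator \<phi> b f x = D x \<and> (E x < \<infinity> \<longrightarrow> commutator_defined \<phi> b f x)"
      using reps b'
    proof eventually_elim
      case (elim x)
      note rep0 = lebesgue_integral_borel_representative[OF G0x elim(1)[THEN conjunct1]]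
      note rep1 = lebesgue_integral_borel_representative[OF G1x elim(1)[THEN conjunct2]]
      have "commutator \<phi> b f x = D x"
        unfolding commutator_def hardy_op_def set_lebesgue_integral_def D_def rep0(2) rep1(2) elim(2) ..
      moreover have "commutator_defined \<phi> b f x" if "E x < \<infinity>"
        unfolding commutator_defined_def hardy_defined_def set_integrable_def rep0(1) rep1(1)
        using int[OF that] by simp
      ultimately show ?case by simp
    qed
    have D_le: "AE x in lborel. ennreal (norm (commutator \<phi> b f x))
        \<le> (\<integral>\<^sup>+t. ennreal (norm (b' x - b' (t *\<^sub>R x))) * ennreal (norm (f' (t *\<^sub>R x)) * \<psi> t) \<partial>lborel)"
      using comm_eq E_fin
    proof eventually_elim
      case (elim x)
      note i = int[OF elim(2)]
      have "D x = (\<integral>t. b' x * G0 x t - G1 x t \<partial>lborel)"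
        using i by (simp add: D_def)
      moreover have "integrable lborel (\<lambda>t. b' x * G0 x t - G1 x t)"
        using i by simp
      ultimately have "ennreal (norm (D x)) \<le> (\<integral>\<^sup>+t. norm (b' x * G0 x t - G1 x t) \<partial>lborel)"
        using integral_norm_bound_ennreal by metis
      also have "\<dots> = (\<integral>\<^sup>+t. ennreal (norm (b' x - b' (t *\<^sub>R x))) * ennreal (norm (f' (t *\<^sub>R x)) * \<psi> t) \<partial>lborel)"
      proof (rule nn_integral_cong)
        fix t
        have "b' x * G0 x t - G1 x t = (b' x - b' (t *\<^sub>R x)) * (f' (t *\<^sub>R x) * complex_of_real (\<psi> t))"
          by (simp add: G0_def G1_def algebra_simps)
        then have "norm (b' x * G0 x t - G1 x t) = norm (b' x - b' (t *\<^sub>R x)) * (norm (f' (t *\<^sub>R x)) * \<psi> t)"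
          using \<psi>(1)[of t] by (simp add: norm_mult)
        then show "ennreal (norm (b' x * G0 x t - G1 x t)) = ennreal (norm (b' x - b' (t *\<^sub>R x))) * ennreal (norm (f' (t *\<^sub>R x)) * \<psi> t)"
          using \<psi>(1)[of t] by (simp add: ennreal_mult)
      qed
      finally show ?case using elim(1) by simp
    qed
    have norm_le: "morrey_norm blk m k p s s' (commutator \<phi> b f) \<le> ennreal C * F"
      unfolding morrey_norm_eq
    proof (rule SUP_least)
      fix R :: real assume "R \<in> {0<..}"
      then have R: "0 < R" by simp
      have "mn s s' (\<lambda>x. ennreal (norm (commutator \<phi> b f x)) * indicator (ball 0 R) x)
        \<le> mn s s' (\<lambda>x. (\<integral>\<^sup>+t. ennreal (norm (b' x - b' (t *\<^sub>R x))) * ennreal (norm (f' (t *\<^sub>R x)) * \<psi> t) \<partial>lborel) * indicator (ball 0 R) x)"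
        using pos D_le by (intro mn_mono_AE) (auto intro: mult_right_mono elim!: eventually_mono)
      also have "\<dots> \<le> ennreal (M * (ballc q q' * vol powr (scal r / dimk - 1 / p)) * R powr (scal s - dimk / p)) * (F * I)"
        unfolding F(1) I_def
      proof (rule mn_hardy_le[OF f'm \<psi>m _ \<psi> ex conj R M])
        show "(\<lambda>(x, t). ennreal (norm (b' x - b' (t *\<^sub>R x)))) \<in> borel_measurable (borel \<Otimes>\<^sub>M borel)"
          by measurable
        show "mn q q' (\<lambda>x. ennreal (norm (b' x - b' (t *\<^sub>R x))) * indicator (ball 0 R) x) \<le> ennreal (M * ln (2 / t)) * mn q q' (indicator (ball 0 R))"
          if "t \<in> {0<..1}" for t
          unfolding M_def by (rule osc_difference_le[OF ex(5,6) osc R that])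
      qed
      finally have "ennreal ((R powr dimk * vol) powr (1 / p - scal s / dimk)) * mn s s' (\<lambda>x. ennreal (norm (commutator \<phi> b f x)) * indicator (ball 0 R) x)
        \<le> ennreal ((R powr dimk * vol) powr (1 / p - scal s / dimk)) * (ennreal (c * R powr (scal s - dimk / p)) * (F * I))"
        unfolding c_def by (rule mult_left_mono) simp
      also have "\<dots> = ennreal ((R powr dimk * vol) powr (1 / p - scal s / dimk) * (c * R powr (scal s - dimk / p)) * enn2real I) * F"
        using I c by (simp add: ennreal_mult ac_simps)
      also have "(R powr dimk * vol) powr (1 / p - scal s / dimk) * (c * R powr (scal s - dimk / p)) * enn2real I = C"
      proof -
        have "R powr (dimk / p - scal s) * R powr (scal s - dimk / p) = 1"
          using R by (simp add: powr_add[symmetric])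
        then show ?thesis
          unfolding vol_powr(1)[OF R] C_def by (simp add: ac_simps)
      qed
      finally show "ennreal ((R powr dimk * vol) powr (1 / p - scal s / dimk)) * mn s s' (\<lambda>x. ennreal (norm (commutator \<phi> b f x)) * indicator (ball 0 R) x)
        \<le> ennreal C * F" .
    qed
    show "(AE x in dunkl_measure k. commutator_defined \<phi> b f x) \<and>
        commutator \<phi> b f \<in> morrey_space blk m k p s s' \<and>
        morrey_norm blk m k p s s' (commutator \<phi> b f) \<le> ennreal C * morrey_norm blk m k p r r' f"
    proof (intro conjI)
      show "AE x in dunkl_measure k. commutator_defined \<phi> b f x"
        unfolding AE_dunkl_iff using comm_eq E_fin by eventually_elim simp
      have "D \<in> borel_measurable lebesgue"
        by (intro measurable_completion) simp
      then have "commutator \<phi> b f \<in> borel_measurable lebesgue"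
        by (rule borel_measurable_AE) (use comm_eq in \<open>auto simp: AE_completion_iff elim: eventually_mono\<close>)
      moreover have "ennreal C * F < \<infinity>"
        using F(2) by (simp add: ennreal_mult_less_top)
      ultimately show "commutator \<phi> b f \<in> morrey_space blk m k p s s'"
        using le_less_trans[OF norm_le] by (simp add: morrey_space_def)
      show "morrey_norm blk m k p s s' (commutator \<phi> b f) \<le> ennreal C * morrey_norm blk m k p r r' f"
        using norm_le by (simp add: F_def)
    qed
  qed
qed

end

section \<open>Necessity\<close>

context dunkl_blocks
begin

lemma scal_pos:
  assumes "exp_gt1 u"
  shows "0 < scal u"
  unfolding scal_def
proof (rule sum_pos)
  show "{1..m} \<noteq> {}"
    using range_blk by blast
  show "0 < N i / u i" if "i \<in> {1..m}" for i
    using hom_dim_pos[OF that] exp_gt1_pos[OF assms] that by (simp add: pos_exp_def)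
qed simp

lemma indicator_unit_ball_scale:
  "0 < R \<Longrightarrow> indicator (ball 0 1) ((1 / R) *\<^sub>R (x::real^'n)) = (indicator (ball 0 R) x :: ennreal)"
  by (subst indicator_ball_scale[of "1 / R" R x]) simp_all

text \<open>The function is homogeneous of degree -N/p, the degree for which the Morrey prefactor
  cancels every power of R. Each ball therefore gives the same value as the unit ball, which is
  finite because N/p < scal r.\<close>

lemma norm_powr_in_morrey_space:
  assumes ex: "exp_gt1 r" "exp_gt1 r'" and p: "0 < p" "dimk / p < scal r"
  shows "(\<lambda>x. complex_of_real (norm x powr - (dimk / p))) \<in> morrey_space blk m k p r r'"
proof -
  note pos = ex[THEN exp_gt1_pos]
  define a where "a = dimk / p"
  have a: "0 \<le> a" "a < scal r"
    using p dimk_pos by (simp_all add: a_def)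
  define f where "f x = complex_of_real (norm x powr - a)" for x :: "real^'n"
  have "f \<in> borel_measurable borel"
    unfolding f_def by measurable
  then have meas: "f \<in> borel_measurable lebesgue"
    by (intro measurable_completion) simp
  define g where "g y = ennreal (norm y powr - a) * indicator (ball 0 1) y" for y :: "real^'n"
  have [measurable]: "g \<in> borel_measurable borel"
    unfolding g_def by measurable
  have g: "mn r r' g < \<infinity>"
    unfolding g_def using ex a by (intro mn_norm_powr_finite)
  have "morrey_norm blk m k p r r' f \<le> ennreal (vol powr (1 / p - scal r / dimk)) * mn r r' g"
    unfolding morrey_norm_eq
  proof (rule SUP_least)
    fix R :: real assume "R \<in> {0<..}"
    then have R: "0 < R" by simp
    have "ennreal (norm (f x)) * indicator (ball 0 R) x = ennreal (R powr - a) * g ((1 / R) *\<^sub>R x)" for x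
    proof -
      have "norm x powr - a = R powr - a * norm ((1 / R) *\<^sub>R x) powr - a"
        using R by (simp add: powr_mult[symmetric])
      then have "ennreal (norm x powr - a) = ennreal (R powr - a) * ennreal (norm ((1 / R) *\<^sub>R x) powr - a)"
        by (simp add: ennreal_mult[symmetric])
      then show ?thesis
        using indicator_unit_ball_scale[OF R, of x] by (simp add: f_def g_def mult.assoc)
    qed
    then have "mn r r' (\<lambda>x. ennreal (norm (f x)) * indicator (ball 0 R) x) = mn r r' (\<lambda>x. ennreal (R powr - a) * g ((1 / R) *\<^sub>R x))"
      by simp
    also have "\<dots> = ennreal (R powr - a) * mn r r' (\<lambda>x. g ((1 / R) *\<^sub>R x))"
      using pos by (intro mn_cmult) measurable
    also have "mn r r' (\<lambda>x. g ((1 / R) *\<^sub>R x)) = ennreal ((1 / R) powr - scal r) * mn r r' g"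
      using pos R by (intro mn_scale) auto
    also have "(1 / R) powr - scal r = R powr scal r"
      using R by (simp add: powr_divide powr_minus field_simps)
    finally have "ennreal ((R powr dimk * vol) powr (1 / p - scal r / dimk)) * mn r r' (\<lambda>x. ennreal (norm (f x)) * indicator (ball 0 R) x)
      = ennreal ((R powr dimk * vol) powr (1 / p - scal r / dimk)) * (ennreal (R powr - a) * (ennreal (R powr scal r) * mn r r' g))"
      by simp
    also have "\<dots> = ennreal ((R powr dimk * vol) powr (1 / p - scal r / dimk) * (R powr - a * R powr scal r)) * mn r r' g"
      by (simp add: ennreal_mult mult.assoc)
    also have "(R powr dimk * vol) powr (1 / p - scal r / dimk) * (R powr - a * R powr scal r) = vol powr (1 / p - scal r / dimk)"
    proof -
      have "R powr (dimk / p - scal r) * (R powr - a * R powr scal r) = 1"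
        using R by (simp add: powr_add[symmetric] a_def)
      then show ?thesis
        unfolding vol_powr(1)[OF R] by (simp add: ac_simps)
    qed
    finally show "ennreal ((R powr dimk * vol) powr (1 / p - scal r / dimk)) * mn r r' (\<lambda>x. ennreal (norm (f x)) * indicator (ball 0 R) x)
      \<le> ennreal (vol powr (1 / p - scal r / dimk)) * mn r r' g"
      by simp
  qed
  also have "\<dots> < \<infinity>"
    using g by (simp add: ennreal_mult_less_top)
  finally have "morrey_norm blk m k p r r' f < \<infinity>" .
  with meas have "f \<in> morrey_space blk m k p r r'"
    by (simp add: morrey_space_def)
  then show ?thesis
    by (simp add: f_def[abs_def] a_def)
qed

text \<open>The bound ln y <= y - 1 at y = x^(-e). At x = 0 both sides are 0 by the conventions for
  \<open>ln\<close> and \<open>powr\<close>.\<close>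

lemma abs_ln_le_powr:
  fixes x :: real
  assumes "0 \<le> x" "x < 1" "0 < e"
  shows "\<bar>ln x\<bar> \<le> 1 / e * x powr - e"
proof (cases "x = 0")
  case False
  then have x: "0 < x" using assms by simp
  have "e * \<bar>ln x\<bar> = ln (x powr - e)"
    using x assms by (simp add: ln_powr)
  also have "\<dots> \<le> x powr - e"
    using ln_le_minus_one[of "x powr - e"] x by simp
  finally show ?thesis
    using assms by (simp add: field_simps)
qed simp

text \<open>ln |x| - ln R = ln |x / R|, so by dilation the deviation from the constant ln R,
  relative to the norm of the ball, is the same on every ball. The mean then differs from ln R by a
  bounded amount and may replace it.\<close>

lemma ln_norm_in_cmo_space:
  assumes uw: "exp_gt1 u" "exp_gt1 w"
  shows "(\<lambda>x. complex_of_real (ln (norm x))) \<in> cmo_space blk m k u w"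
proof -
  note pos = uw[THEN exp_gt1_pos]
  define b where "b x = complex_of_real (ln (norm x))" for x :: "real^'n"
  have bm [measurable]: "b \<in> borel_measurable borel"
    unfolding b_def by measurable
  define g where "g y = ennreal \<bar>ln (norm y)\<bar> * indicator (ball 0 1) y" for y :: "real^'n"
  have gm [measurable]: "g \<in> borel_measurable borel"
    unfolding g_def by measurable
  have g: "mn u w g < \<infinity>"
  proof -
    \<comment> \<open>Any exponent strictly between 0 and \<open>scal u\<close> would do.\<close>
    define e where "e = scal u / 2"
    have e: "0 < e" "e < scal u"
      using scal_pos[OF uw(1)] by (simp_all add: e_def)
    have "mn u w g \<le> mn u w (\<lambda>x. ennreal (1 / e) * (ennreal (norm x powr - e) * indicator (ball 0 1) x))"
    proof (intro mn_mono pos)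
      fix x :: "real^'n"
      show "g x \<le> ennreal (1 / e) * (ennreal (norm x powr - e) * indicator (ball 0 1) x)"
      proof (cases "norm x < 1")
        case True
        have "ennreal \<bar>ln (norm x)\<bar> \<le> ennreal (1 / e * norm x powr - e)"
          using e True by (intro ennreal_leI abs_ln_le_powr) auto
        also have "\<dots> = ennreal (1 / e) * ennreal (norm x powr - e)"
          using e by (intro ennreal_mult) auto
        finally show ?thesis
          using True by (simp add: g_def)
      qed (simp add: g_def)
    qed
    also have "\<dots> = ennreal (1 / e) * mn u w (\<lambda>x. ennreal (norm x powr - e) * indicator (ball 0 1) x)"
      using pos by (intro mn_cmult) measurable
    also have "\<dots> < \<infinity>"
      using mn_norm_powr_finite[OF uw, of e] e by (simp add: ennreal_mult_less_top)
    finally show ?thesis .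
  qed
  define l where "l = enn2real (mn u w g)"
  have l: "mn u w g = ennreal l" "0 \<le> l"
    using g by (simp_all add: l_def)
  \<comment> \<open>The ratio of the norm of the logarithm on the unit ball to the norm of the
    ball's indicator.\<close>
  define K where "K = l / ballc u w"
  have K: "0 \<le> K" "l = K * ballc u w"
    using l ballc_pos[OF uw] by (simp_all add: K_def)
  have dev: "mn u w (\<lambda>x. ennreal (norm (b x - complex_of_real (ln R))) * indicator (ball 0 R) x)
      \<le> ennreal K * mn u w (indicator (ball 0 R))" if R: "0 < R" for R
  proof -
    \<comment> \<open>The logarithm identity fails at the origin, where
      \<open>ln 0 = 0\<close>.\<close>
    have nz: "AE x in lborel. x \<noteq> (0::real^'n)"
      by (rule AE_lborel_singleton)
    have "mn u w (\<lambda>x. ennreal (norm (b x - complex_of_real (ln R))) * indicator (ball 0 R) x) = mn u w (\<lambda>x. g ((1 / R) *\<^sub>R x))"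
    proof (intro mn_cong_AE pos)
      show "AE x in lborel. ennreal (norm (b x - complex_of_real (ln R))) * indicator (ball 0 R) x = g ((1 / R) *\<^sub>R x)"
        using nz
      proof eventually_elim
        case (elim x)
        have "b x - complex_of_real (ln R) = complex_of_real (ln (norm ((1 / R) *\<^sub>R x)))"
          using R elim by (simp add: b_def ln_div)
        then have "norm (b x - complex_of_real (ln R)) = \<bar>ln (norm ((1 / R) *\<^sub>R x))\<bar>"
          by (simp only: norm_of_real)
        then show ?case
          unfolding g_def indicator_unit_ball_scale[OF R] by simp
      qed
    qed
    also have "\<dots> = ennreal ((1 / R) powr - scal u) * mn u w g"
      using pos R by (intro mn_scale) auto
    also have "(1 / R) powr - scal u = R powr scal u"
      using R by (simp add: powr_divide powr_minus field_simps)
    also have "ennreal (R powr scal u) * mn u w g = ennreal K * mn u w (indicator (ball 0 R))"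
    proof -
      have "ennreal (R powr scal u) * mn u w g = ennreal (R powr scal u * (K * ballc u w))"
        unfolding l(1) K(2) using K(1) by (intro ennreal_mult[symmetric]) (auto simp: ballc_nonneg)
      also have "R powr scal u * (K * ballc u w) = K * (R powr scal u * ballc u w)"
        by (simp only: ac_simps)
      also have "ennreal \<dots> = ennreal K * ennreal (R powr scal u * ballc u w)"
        using K(1) by (intro ennreal_mult) (auto simp: ballc_nonneg)
      finally show ?thesis
        using pos R by (simp add: mn_ball)
    qed
    finally show ?thesis by simp
  qed
  \<comment> \<open>Applied with c = 0 for local integrability and with c the mean of b for the CMO
    norm.\<close>
  have shift: "mn u w (\<lambda>x. ennreal (norm (b x - c)) * indicator (ball 0 R) x)
      \<le> ennreal (K + norm (c - complex_of_real (ln R))) * mn u w (indicator (ball 0 R))" if R: "0 < R" for R c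
  proof -
    define d where "d = norm (c - complex_of_real (ln R))"
    have "mn u w (\<lambda>x. ennreal (norm (b x - c)) * indicator (ball 0 R) x)
      \<le> mn u w (\<lambda>x. ennreal (norm (b x - complex_of_real (ln R))) * indicator (ball 0 R) x + ennreal d * indicator (ball 0 R) x)"
    proof (intro mn_mono pos)
      fix x
      have "norm (b x - c) \<le> norm (b x - complex_of_real (ln R)) + d"
        unfolding d_def by norm
      then have "ennreal (norm (b x - c)) \<le> ennreal (norm (b x - complex_of_real (ln R)) + d)"
        by (rule ennreal_leI)
      then have "ennreal (norm (b x - c)) \<le> ennreal (norm (b x - complex_of_real (ln R))) + ennreal d"
        by (simp add: d_def)
      then show "ennreal (norm (b x - c)) * indicator (ball 0 R) x
        \<le> ennreal (norm (b x - complex_of_real (ln R))) * indicator (ball 0 R) x + ennreal d * indicator (ball 0 R) x"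
        by (auto simp: indicator_def)
    qed
    also have "\<dots> \<le> mn u w (\<lambda>x. ennreal (norm (b x - complex_of_real (ln R))) * indicator (ball 0 R) x) + mn u w (\<lambda>x. ennreal d * indicator (ball 0 R) x)"
      using uw by (intro mn_add) measurable
    also have "mn u w (\<lambda>x. ennreal d * indicator (ball 0 R) x) = ennreal d * mn u w (indicator (ball 0 R))"
      using pos by (intro mn_cmult) auto
    also have "mn u w (\<lambda>x. ennreal (norm (b x - complex_of_real (ln R))) * indicator (ball 0 R) x) + ennreal d * mn u w (indicator (ball 0 R))
      \<le> ennreal K * mn u w (indicator (ball 0 R)) + ennreal d * mn u w (indicator (ball 0 R))"
      using R by (intro add_right_mono dev)
    also have "\<dots> = (ennreal K + ennreal d) * mn u w (indicator (ball 0 R))"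
      by (rule distrib_right[symmetric])
    also have "ennreal K + ennreal d = ennreal (K + d)"
      using K(1) by (intro ennreal_plus[symmetric]) (auto simp: d_def)
    finally show ?thesis by (simp add: d_def)
  qed
  have intball: "set_integrable (dunkl_measure k) (ball 0 R) b" if R: "0 < R" for R
  proof -
    have "(\<integral>\<^sup>+x. ennreal (norm (b x)) * indicator (ball 0 R) x \<partial>dunkl_measure k)
      \<le> mn u w (\<lambda>x. ennreal (norm (b x)) * indicator (ball 0 R) x) * ennreal (R powr (dimk - scal u) * ballc (conj_exp u) (conj_exp w))"
      using uw R by (intro nn_integral_le_mn) auto
    also have "\<dots> \<le> (ennreal (K + norm (0 - complex_of_real (ln R))) * mn u w (indicator (ball 0 R))) * ennreal (R powr (dimk - scal u) * ballc (conj_exp u) (conj_exp w))"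
      using shift[OF R, of 0] by (intro mult_right_mono) auto
    also have "\<dots> < \<infinity>"
      using mn_ball_finite[OF pos R] by (simp add: ennreal_mult_less_top)
    finally have fin: "(\<integral>\<^sup>+x. ennreal (norm (b x)) * indicator (ball 0 R) x \<partial>dunkl_measure k) < \<infinity>" .
    have "(\<integral>\<^sup>+x. norm (indicator (ball 0 R) x *\<^sub>R b x) \<partial>dunkl_measure k) = (\<integral>\<^sup>+x. ennreal (norm (b x)) * indicator (ball 0 R) x \<partial>dunkl_measure k)"
      by (intro nn_integral_cong) (auto simp: indicator_def)
    moreover have "(\<lambda>x. indicator (ball 0 R) x *\<^sub>R b x) \<in> borel_measurable borel"
      by (intro borel_measurable_scaleR borel_measurable_indicator bm) simp
    ultimately show ?thesis
      unfolding set_integrable_def using fin by (intro integrableI_bounded borel_measurable_dunkl) simp_all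
  qed
  have loc: "set_integrable (dunkl_measure k) S b" if S: "compact S" for S
  proof -
    obtain R where R: "0 < R" "S \<subseteq> ball 0 R"
      using bounded_subset_ballD[OF compact_imp_bounded[OF S], of 0] by auto
    have "S \<in> sets (dunkl_measure k)"
      using S by (simp add: sets_dunkl_measure compact_imp_closed)
    then show ?thesis
      using set_integrable_subset[OF intball[OF R(1)]] R(2) by blast
  qed
  have "cmo_norm blk m k u w b \<le> ennreal (K + K * osc_const u w)"
    unfolding cmo_norm_def
  proof (rule SUP_least)
    fix R :: real assume "R \<in> {0<..}"
    then have R: "0 < R" by simp
    have "norm (ball_avg k b R - complex_of_real (ln R)) \<le> K * osc_const u w"
      using R K(1) by (intro ball_avg_diff_le_osc[OF bm intball uw _ _ _ _ dev]) auto
    then have "mn u w (\<lambda>x. ennreal (norm (b x - ball_avg k b R)) * indicator (ball 0 R) x)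
      \<le> ennreal (K + K * osc_const u w) * mn u w (indicator (ball 0 R))"
      by (intro order.trans[OF shift[OF R]] mult_right_mono ennreal_leI) auto
    moreover have "0 < mn u w (indicator (ball 0 R))"
      using R pos ballc_pos[OF uw] by (simp add: mn_ball)
    ultimately show "mixed_norm blk m k u w (\<lambda>x. (b x - ball_avg k b R) * indicator (ball 0 R) x) / mixed_norm blk m k u w (indicator (ball 0 R))
        \<le> ennreal (K + K * osc_const u w)"
      unfolding mixed_norm_times_indicator mixed_norm_indicator
      by (intro divide_le_posI_ennreal) (auto simp: mult.commute)
  qed
  then have "cmo_norm blk m k u w b < \<infinity>"
    by (rule le_less_trans) simp
  with loc have "b \<in> cmo_space blk m k u w"
    by (simp add: cmo_space_def)
  then show ?thesis
    by (simp add: b_def[abs_def])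
qed

text \<open>On the ray through x both integrands are explicit: t^(-a) \<phi> t up to a factor
  depending on x, without and with ln |t x|. A linear combination of the two is the integrand of the
  condition, so no norm estimate is involved.\<close>

lemma integral_finite_if_commutator_defined:
  fixes \<phi> :: "real \<Rightarrow> real" and x :: "real^'n"
  assumes def: "commutator_defined \<phi> (\<lambda>x. complex_of_real (ln (norm x))) (\<lambda>x. complex_of_real (norm x powr - a)) x"
    and x: "x \<noteq> 0" and \<phi>: "\<And>t. t \<in> {0<..1} \<Longrightarrow> 0 \<le> \<phi> t"
  shows "(\<integral>\<^sup>+t\<in>{0<..1}. ennreal (t powr - a * \<phi> t * ln (2 / t)) \<partial>lebesgue) < \<infinity>"
proof -
  define F where "F t = indicator {0<..1} t *\<^sub>R (complex_of_real (norm (t *\<^sub>R x) powr - a) * complex_of_real (\<phi> t))" for t :: real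
  define G where "G t = indicator {0<..1} t *\<^sub>R (complex_of_real (ln (norm (t *\<^sub>R x))) * complex_of_real (norm (t *\<^sub>R x) powr - a) * complex_of_real (\<phi> t))" for t :: real
  have FG: "integrable lebesgue F" "integrable lebesgue G"
    using def unfolding commutator_defined_def hardy_defined_def set_integrable_def F_def G_def by simp_all
  \<comment> \<open>Coefficients chosen from ln (2 / t) = ln 2 + ln |x| - ln |t x|, with |x|^a
    removing the dependence of |t x|^(-a) on x.\<close>
  define H where "H t = complex_of_real (norm x powr a) * (complex_of_real (ln 2 + ln (norm x)) * F t - G t)" for t
  have "integrable lebesgue H"
    unfolding H_def using FG by simp
  then have fin: "(\<integral>\<^sup>+t. norm (H t) \<partial>lebesgue) < \<infinity>"
    by (simp add: integrable_iff_bounded)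
  have "(\<integral>\<^sup>+t\<in>{0<..1}. ennreal (t powr - a * \<phi> t * ln (2 / t)) \<partial>lebesgue) = (\<integral>\<^sup>+t. norm (H t) \<partial>lebesgue)"
  proof (rule nn_integral_cong)
    fix t :: real
    show "ennreal (t powr - a * \<phi> t * ln (2 / t)) * indicator {0<..1} t = ennreal (norm (H t))"
    proof (cases "t \<in> {0<..1}")
      case True
      then have t: "0 < t" "0 \<le> ln (2 / t)" by auto
      have n: "0 < norm x" using x by simp
      have "norm x powr a * norm (t *\<^sub>R x) powr - a = t powr - a"
      proof -
        have "norm (t *\<^sub>R x) powr - a = t powr - a * norm x powr - a"
          using t by (simp add: powr_mult)
        moreover have "norm x powr a * norm x powr - a = 1"
          using n by (simp add: powr_add[symmetric])
        ultimately show ?thesis by (simp add: ac_simps)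
      qed
      moreover have "ln 2 + ln (norm x) - ln (norm (t *\<^sub>R x)) = ln (2 / t)"
        using t n by (simp add: ln_mult ln_div)
      moreover have "H t = complex_of_real ((norm x powr a * norm (t *\<^sub>R x) powr - a) * \<phi> t * (ln 2 + ln (norm x) - ln (norm (t *\<^sub>R x))))"
        using True by (simp add: H_def F_def G_def algebra_simps)
      ultimately have "H t = complex_of_real (t powr - a * \<phi> t * ln (2 / t))"
        by (simp only:)
      then have "norm (H t) = t powr - a * \<phi> t * ln (2 / t)"
        using \<phi>[OF True] t by (simp only: norm_of_real) simp
      then show ?thesis using True by simp
    qed (simp add: H_def F_def G_def)
  qed
  with fin show ?thesis by simp
qed

end

theorem theorem4p1:
  fixes blk :: "'n::finite \<Rightarrow> nat" and m :: nat
    and k :: "real ^ 'n"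
    and p :: real
    and s r q s' r' q' :: "nat \<Rightarrow> real"
    and \<phi> :: "real \<Rightarrow> real"
  assumes "CARD('n) \<ge> 2"
    and "range blk = {1..m}"
    and "\<And>j. k $ j \<ge> 0"
    and "p > 0"
    and "\<And>i. i \<in> {1..m} \<Longrightarrow> 1 < s i \<and> s i < r i"
    and "\<And>i. i \<in> {1..m} \<Longrightarrow> 1 < s' i \<and> s' i < r' i"
    and "\<And>i. i \<in> {1..m} \<Longrightarrow> 1 < q i \<and> 1 < q' i"
    and "\<And>i. i \<in> {1..m} \<Longrightarrow> 1 / s i = 1 / r i + 1 / q i"
    and "\<And>i. i \<in> {1..m} \<Longrightarrow> 1 / s' i = 1 / r' i + 1 / q' i"
    and "(\<Sum>i=1..m. hom_dim k (block blk i) / r i) > hom_dim k UNIV / p"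
    and "\<And>t. t \<in> {0<..1} \<Longrightarrow> \<phi> t \<ge> 0"
    and "set_integrable lebesgue {0<..1} \<phi>"
  shows "(\<forall>b\<in>cmo_space blk m k q q'. commutator_bounded blk m k p r r' s s' \<phi> b) \<longleftrightarrow>
     (\<integral>\<^sup>+t\<in>{0<..1}. ennreal (t powr (- hom_dim k UNIV / p) * \<phi> t * ln (2 / t)) \<partial>lebesgue) < \<infinity>"
proof -
  interpret dunkl_blocks blk m k
    using assms(2,3) by unfold_locales
  have ex: "exp_gt1 s" "exp_gt1 s'" "exp_gt1 r" "exp_gt1 r'" "exp_gt1 q" "exp_gt1 q'"
    using assms(5-7) by (force simp: exp_gt1_def)+
  show ?thesis
  proof
    assume "\<forall>b\<in>cmo_space blk m k q q'. commutator_bounded blk m k p r r' s s' \<phi> b"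
    then have "commutator_bounded blk m k p r r' s s' \<phi> (\<lambda>x. complex_of_real (ln (norm x)))"
      using ln_norm_in_cmo_space[OF ex(5,6)] by blast
    moreover have "(\<lambda>x. complex_of_real (norm x powr - (dimk / p))) \<in> morrey_space blk m k p r r'"
      using assms(4,10) by (intro norm_powr_in_morrey_space ex) (simp_all add: scal_def)
    ultimately have "AE x in dunkl_measure k. commutator_defined \<phi> (\<lambda>x. complex_of_real (ln (norm x))) (\<lambda>x. complex_of_real (norm x powr - (dimk / p))) x"
      unfolding commutator_bounded_def by blast
    then have def: "AE x in lborel. commutator_defined \<phi> (\<lambda>x. complex_of_real (ln (norm x))) (\<lambda>x. complex_of_real (norm x powr - (dimk / p))) (x :: real^'n)"
      by (simp only: AE_dunkl_iff)
    have nz: "AE x in lborel. x \<noteq> (0::real^'n)"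
      by (rule AE_lborel_singleton)
    have "\<exists>x::real^'n. commutator_defined \<phi> (\<lambda>x. complex_of_real (ln (norm x))) (\<lambda>x. complex_of_real (norm x powr - (dimk / p))) x \<and> x \<noteq> 0"
    proof (rule ccontr)
      assume "\<not> ?thesis"
      with def nz have "AE x in (lborel :: (real^'n) measure). False"
        by (auto elim: eventually_elim2)
      then have "emeasure (lborel :: (real^'n) measure) UNIV = 0"
        by (subst (asm) AE_iff_measurable[of UNIV]) auto
      then show False by simp
    qed
    then obtain x :: "real^'n" where "commutator_defined \<phi> (\<lambda>x. complex_of_real (ln (norm x))) (\<lambda>x. complex_of_real (norm x powr - (dimk / p))) x" "x \<noteq> 0"
      by blast
    from integral_finite_if_commutator_defined[OF this assms(11)]
    show "(\<integral>\<^sup>+t\<in>{0<..1}. ennreal (t powr (- dimk / p) * \<phi> t * ln (2 / t)) \<partial>lebesgue) < \<infinity>"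
      by simp
  next
    assume "(\<integral>\<^sup>+t\<in>{0<..1}. ennreal (t powr (- dimk / p) * \<phi> t * ln (2 / t)) \<partial>lebesgue) < \<infinity>"
    then show "\<forall>b\<in>cmo_space blk m k q q'. commutator_bounded blk m k p r r' s s' \<phi> b"
      using commutator_bounded_if_integral_finite[OF _ ex assms(8,9,11,12)] by blast
  qed
qed

end
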